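(* Let $n=\dim\mathfrak{a}$, let $\ell\in\mathbb{N}_0$, let $\lambda\in\mathfrak{a}_{\mathrm{reg}}$, and let $k\colon R\to\mathbb{R}$ be a $W$-invariant multiplicity function with $k_\alpha>\ell+\frac{n+1}{2}$ for all $\alpha\in R$. Then the density $f_\lambda^k$ (with respect to Lebesgue measure on $\mathfrak{a}$) of the representing measure $\mu_\lambda^k$ of the Dunkl kernel is of class $C_c^\ell(\mathfrak{a})$.
   Context: $(\mathfrak{a},\langle\cdot,\cdot\rangle)$ is a finite-dimensional Euclidean space; $\langle\cdot,\cdot\rangle$ is extended to a complex bilinear form on $\mathfrak{a}_{\mathbb{C}}=\mathbb{C}\otimes_{\mathbb{R}}\mathfrak{a}$. $R\subseteq\mathfrak{a}$ is a reduced root system spanning $\mathfrak{a}$ (a finite set of nonzero vectors, stable under all its reflections, with $R\cap\mathbb{R}\alpha=\{\pm\alpha\}$; the crystallographic condition is not imposed), normalized by $\langle\alpha,\alpha\rangle=2$ for all $\alpha\in R$. $W$ is the finite reflection group generated by $s_\alpha(x)=x-\langle\alpha,x\rangle\alpha$, $\alpha\in R$. $R_+\subseteq R$ is a fixed set of positive roots. $\mathfrak{a}_{\mathrm{reg}}=\{x\in\mathfrak{a}:\langle\alpha,x\rangle\ne0\ \forall\alpha\in R\}$. $C_c^\ell(\mathfrak{a})$ denotes the compactly supported functions on $\mathfrak{a}$ of class $C^\ell$. For a $W$-invariant $k\colon R\to\mathbb{C}$, the Dunkl operator in direction $\xi\in\mathfrak{a}$ is $T_\xi=\partial_\xi+\sum_{\alpha\in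 R_+}k_\alpha\langle\alpha,\xi\rangle\frac{1-s_\alpha}{\langle\alpha,\cdot\rangle}$, where $(s_\alpha f)(x)=f(s_\alpha x)$. If $\operatorname{Re}k\ge0$, the Dunkl kernel $\operatorname{Exp}_k\colon\mathfrak{a}_{\mathbb{C}}\times\mathfrak{a}_{\mathbb{C}}\to\mathbb{C}$ is the unique holomorphic function such that for every $\lambda\in\mathfrak{a}_{\mathbb{C}}$, $f=\operatorname{Exp}_k(\lambda,\cdot)$ is the unique solution of $T_\xi f=\langle\xi,\lambda\rangle f$ for all $\xi\in\mathfrak{a}$, $f(0)=1$. Representing measure: for real $k\ge0$ and $\lambda\in\mathfrak{a}$ there is (known theorem of Rösler) a unique compactly supported probability measure $\mu_\lambda^k$ on $\mathfrak{a}$ with $\operatorname{Exp}_k(\lambda,z)=\int_{\mathfrak{a}}e^{\langle z,\xi\rangle}\,d\mu_\lambda^k(\xi)$ for all $z\in\mathfrak{a}_{\mathbb{C}}$. When $k_\alpha>\frac12$ for all $\alpha$ and $\lambda\in\mathfrak{a}_{\mathrm{reg}}$, $\mu_\lambda^k$ is absolutely continuous with respect to Lebesgue measure, with density denoted $f_\lambda^k$ (defined up to almost everywhere equality). *)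

theory Defs
  imports "HOL-Probability.Probability"
begin

section \<open>Root systems and reflection groups\<close>

text \<open>The usual factor \<open>2 / (\<alpha> \<bullet> \<alpha>)\<close> is absent because all roots are
  normalized to \<open>\<alpha> \<bullet> \<alpha> = 2\<close>.\<close>

definition root_reflection :: "'a::euclidean_space \<Rightarrow> 'a \<Rightarrow> 'a" where
  "root_reflection \<alpha> x = x - (\<alpha> \<bullet> x) *\<^sub>R \<alpha>"

definition normalized_root_system :: "'a::euclidean_space set \<Rightarrow> bool" where
  "normalized_root_system R \<longleftrightarrow>
     finite R \<and> 0 \<notin> R \<and> span R = UNIV \<and>
     (\<forall>\<alpha>\<in>R. root_reflection \<alpha> ` R = R) \<and>
     (\<forall>\<alpha>\<in>R. R \<inter> span {\<alpha>} = {\<alpha>, - \<alpha>}) \<and>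
     (\<forall>\<alpha>\<in>R. \<alpha> \<bullet> \<alpha> = 2)"

definition positive_roots :: "'a::euclidean_space set \<Rightarrow> 'a set \<Rightarrow> bool" where
  "positive_roots R P \<longleftrightarrow>
     (\<exists>\<beta>. (\<forall>\<alpha>\<in>R. \<alpha> \<bullet> \<beta> \<noteq> 0) \<and> P = {\<alpha>\<in>R. 0 < \<alpha> \<bullet> \<beta>})"

text \<open>Reflections are involutions, so the generated monoid is the generated group.\<close>

inductive_set reflection_group :: "('a::euclidean_space) set \<Rightarrow> ('a \<Rightarrow> 'a) set"
  for R :: "'a set" where
  one: "id \<in> reflection_group R"
| step: "w \<in> reflection_group R \<Longrightarrow> \<alpha> \<in> R \<Longrightarrow> root_reflection \<alpha> \<circ> w \<in> reflection_group R"

text \<open>A multiplicity function is a function on the whole space of which only the values on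
  \<open>R\<close> are used.\<close>

definition W_invariant :: "'a::euclidean_space set \<Rightarrow> ('a \<Rightarrow> 'b) \<Rightarrow> bool" where
  "W_invariant R k \<longleftrightarrow> (\<forall>w\<in>reflection_group R. \<forall>\<alpha>\<in>R. k (w \<alpha>) = k \<alpha>)"

definition regular_points :: "'a::euclidean_space set \<Rightarrow> 'a set" where
  "regular_points R = {x. \<forall>\<alpha>\<in>R. \<alpha> \<bullet> x \<noteq> 0}"

section \<open>Complexification\<close>

text \<open>The pair \<open>(x, y)\<close> stands for \<open>x + \<i>y\<close> in the complexification.\<close>

type_synonym 'a complexified = "'a \<times> 'a"

definition complexify :: "'a::euclidean_space \<Rightarrow> 'a complexified" where
  "complexify x = (x, 0)"

definition mult_i :: "'a::euclidean_space complexified \<Rightarrow> 'a complexified" where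
  "mult_i z = (- snd z, fst z)"

text \<open>Bilinear (not sesquilinear) extension of the inner product.\<close>

definition cbilin :: "'a::euclidean_space complexified \<Rightarrow> 'a complexified \<Rightarrow> complex" where
  "cbilin z w = Complex (fst z \<bullet> fst w - snd z \<bullet> snd w) (fst z \<bullet> snd w + snd z \<bullet> fst w)"

text \<open>Holomorphic on a whole complex vector space, given as a real space with complex structure
  \<open>J\<close>: everywhere Frechet differentiable with complex-linear derivative.\<close>

definition holomorphic_wrt :: "('v::euclidean_space \<Rightarrow> 'v) \<Rightarrow> ('v \<Rightarrow> complex) \<Rightarrow> bool" where
  "holomorphic_wrt J F \<longleftrightarrow>
     (\<forall>z. \<exists>D. (F has_derivative D) (at z) \<and> (\<forall>v. D (J v) = \<i> * D v))"

section \<open>Dunkl operators and the Dunkl kernel\<close>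

text \<open>On the hyperplane \<open>\<alpha> \<bullet> x = 0\<close> the difference quotient is given its
  continuous extension, which is the derivative in direction \<open>\<alpha>\<close>
  (for \<open>\<alpha> \<bullet> \<alpha> = 2\<close> one has \<open>x - s\<^sub>\<alpha> x = (\<alpha> \<bullet> x) \<alpha>\<close>).\<close>

definition dunkl_quotient :: "'a::euclidean_space \<Rightarrow> ('a \<Rightarrow> complex) \<Rightarrow> 'a \<Rightarrow> complex" where
  "dunkl_quotient \<alpha> f x =
     (if \<alpha> \<bullet> x = 0 then frechet_derivative f (at x) \<alpha>
      else (f x - f (root_reflection \<alpha> x)) / complex_of_real (\<alpha> \<bullet> x))"

definition dunkl_operator ::
  "'a::euclidean_space set \<Rightarrow> ('a \<Rightarrow> complex) \<Rightarrow> 'a \<Rightarrow> ('a \<Rightarrow> complex) \<Rightarrow> 'a \<Rightarrow> complex" where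
  "dunkl_operator P k \<xi> f x =
     frechet_derivative f (at x) \<xi> +
     (\<Sum>\<alpha>\<in>P. k \<alpha> * complex_of_real (\<alpha> \<bullet> \<xi>) * dunkl_quotient \<alpha> f x)"

text \<open>The Dunkl operators act on functions on the real space, hence on the restriction of
  \<open>f\<close> to it.\<close>

definition dunkl_eigenfunction ::
  "'a::euclidean_space set \<Rightarrow> ('a \<Rightarrow> complex) \<Rightarrow> 'a complexified \<Rightarrow> ('a complexified \<Rightarrow> complex) \<Rightarrow> bool"
where
  "dunkl_eigenfunction P k lam f \<longleftrightarrow>
     (\<forall>\<xi> x. dunkl_operator P k \<xi> (\<lambda>y. f (complexify y)) x
             = cbilin (complexify \<xi>) lam * f (complexify x)) \<and>
     f 0 = 1"

text \<open>Uniqueness of the joint eigenfunction is understood among functions holomorphic on the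
  complexification; it determines \<open>E\<close>.\<close>

definition is_dunkl_kernel ::
  "'a::euclidean_space set \<Rightarrow> ('a \<Rightarrow> complex) \<Rightarrow> ('a complexified \<Rightarrow> 'a complexified \<Rightarrow> complex) \<Rightarrow> bool"
where
  "is_dunkl_kernel P k E \<longleftrightarrow>
     holomorphic_wrt (map_prod mult_i mult_i) (\<lambda>(lam, z). E lam z) \<and>
     (\<forall>lam. dunkl_eigenfunction P k lam (E lam) \<and>
          (\<forall>g. holomorphic_wrt mult_i g \<and> dunkl_eigenfunction P k lam g \<longrightarrow> g = E lam))"

section \<open>Representing measures and densities\<close>

definition is_representing_measure ::
  "('a::euclidean_space complexified \<Rightarrow> 'a complexified \<Rightarrow> complex) \<Rightarrow> 'a \<Rightarrow> 'a measure \<Rightarrow> bool"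
where
  "is_representing_measure E lam \<mu> \<longleftrightarrow>
     prob_space \<mu> \<and> sets \<mu> = sets borel \<and>
     (\<exists>K. compact K \<and> emeasure \<mu> (- K) = 0) \<and>
     (\<forall>z. E (complexify lam) z = (\<integral>\<xi>. exp (cbilin z (complexify \<xi>)) \<partial>\<mu>))"

text \<open>The nonnegativity clause is needed because \<open>ennreal\<close> truncates negative
  values to \<open>0\<close>; with it, \<open>f\<close> is determined by \<open>\<mu>\<close> up to
  almost everywhere equality.\<close>

definition is_lebesgue_density :: "'a::euclidean_space measure \<Rightarrow> ('a \<Rightarrow> real) \<Rightarrow> bool" where
  "is_lebesgue_density \<mu> f \<longleftrightarrow>
     f \<in> borel_measurable lborel \<and> (AE x in lborel. 0 \<le> f x) \<and>
     \<mu> = density lborel (\<lambda>x. ennreal (f x))"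

section \<open>Compactly supported functions of class \<open>C\<^sup>l\<close>\<close>

fun class_C :: "nat \<Rightarrow> ('a::euclidean_space \<Rightarrow> real) \<Rightarrow> bool" where
  "class_C 0 f \<longleftrightarrow> continuous_on UNIV f"
| "class_C (Suc l) f \<longleftrightarrow>
     (\<forall>x. f differentiable (at x)) \<and>
     (\<forall>v. class_C l (\<lambda>x. frechet_derivative f (at x) v))"

definition class_Cc :: "nat \<Rightarrow> ('a::euclidean_space \<Rightarrow> real) \<Rightarrow> bool" where
  "class_Cc l f \<longleftrightarrow> class_C l f \<and> compact (closure {x. f x \<noteq> 0})"

end

theory Submission
  imports Defs "HOL-Complex_Analysis.Complex_Analysis"
begin

text \<open>The density is recovered by Fourier inversion from the function \<open>x \<mapsto> Exp\<^sub>k(lam, \<rho> + \<i>x)\<close>,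
  the characteristic function of \<open>exp(\<rho> \<bullet> \<eta>) \<mu>(d\<eta>)\<close>. The real part \<open>\<rho>\<close> is chosen dominant and
  large, which keeps every \<open>\<beta> \<bullet> (\<rho> + \<i>x)\<close> away from \<open>0\<close>, so that no wall of the root system is met,
  and everything reduces to the bound \<open>O(\<Prod>\<beta>. (1 + |\<beta> \<bullet> x|) powr (- k\<^sub>\<beta>))\<close>: a basis of roots
  already makes the product, multiplied by \<open>(1 + |x|)^l\<close>, integrable as soon as all \<open>k\<^sub>\<beta> > l + 1\<close>.

  For the bound, the Dunkl equations are continued analytically to complex arguments. The values on
  a \<open>W\<close>-orbit, multiplied by \<open>\<Prod>\<beta>. (\<beta> \<bullet> (\<rho> + \<i>x)) powr k\<^sub>\<beta>\<close> and stripped of the phases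
  \<open>exp(\<i> w x \<bullet> lam)\<close>, satisfy a linear system without diagonal terms whose coefficients are
  \<open>exp(- \<i> c (\<beta> \<bullet> x)) d log(\<beta> \<bullet> (\<rho> + \<i>x))\<close>, where \<open>c = w \<beta> \<bullet> lam \<noteq> 0\<close> because \<open>lam\<close> is
  regular. These oscillate, and integration by parts bounds the solution along suitable paths.\<close>

section \<open>Linear systems with oscillating coefficients\<close>

text \<open>Along a ray the coefficients of the orbit system have size 1/s, so a plain Gronwall
  estimate would lose a power of s, and only the oscillation repairs this. Two uniformity problems
  remain. The constants along a ray of direction \<open>\<xi>\<close> involve the minimum of
  |\<beta> . \<xi>| over the positive roots and blow up near the walls. Hence the ray through x
  itself is of no use: x is reached through one of finitely many fixed regular directions, which
  requires estimates for going outwards and for coming back. Moreover, the integration by parts must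
  be an invertible change of unknowns already at the start of the path, where decay in s does not
  help yet; this forces \<beta> . \<rho> to be large compared with \<open>k \<beta>\<close> divided
  by the numbers |\<gamma> . lam|. Tilting by \<open>exp (\<rho> \<bullet> \<eta>)\<close> is
  harmless for regularity: the support is compact, so the tilted measure is finite, and the smooth
  factor \<open>exp (- (\<rho> \<bullet> y))\<close> undoes the tilt. Since a density is known only
  up to null sets, the conclusion provides a representative of class C^l with compact
  support.\<close>

lemma multiplicative_gronwall:
  fixes B B' a a' :: "real \<Rightarrow> real"
  assumes dB: "\<And>s. 0 \<le> s \<Longrightarrow> s \<le> S \<Longrightarrow> (B has_real_derivative B' s) (at s)"
    and da: "\<And>s. 0 \<le> s \<Longrightarrow> s \<le> S \<Longrightarrow> (a has_real_derivative a' s) (at s)"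
    and bound: "\<And>s. 0 \<le> s \<Longrightarrow> s \<le> S \<Longrightarrow> \<bar>B' s\<bar> \<le> a' s * B s"
    and "0 \<le> S"
  shows "B S \<le> exp (a S - a 0) * B 0" and "B 0 \<le> exp (a S - a 0) * B S"
proof -
  \<comment> \<open>Multiplying by \<open>exp (- a)\<close> gives a nonincreasing function,
    multiplying by \<open>exp a\<close> a nondecreasing one; the latter controls \<open>B\<close>
    backwards in time.\<close>
  have "B S * exp (- a S) \<le> B 0 * exp (- a 0)"
  proof (rule DERIV_nonpos_imp_nonincreasing[OF \<open>0 \<le> S\<close>])
    fix s assume s: "0 \<le> s" "s \<le> S"
    have "((\<lambda>s. B s * exp (- a s)) has_real_derivative (B' s - a' s * B s) * exp (- a s)) (at s)"
      by (auto intro!: derivative_eq_intros dB da s simp: algebra_simps)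
    moreover have "(B' s - a' s * B s) * exp (- a s) \<le> 0"
      using bound[OF s] by (intro mult_nonpos_nonneg) auto
    ultimately show "\<exists>y. ((\<lambda>s. B s * exp (- a s)) has_real_derivative y) (at s) \<and> y \<le> 0"
      by blast
  qed
  then show "B S \<le> exp (a S - a 0) * B 0"
    by (simp add: exp_diff exp_minus field_simps)
  have "B 0 * exp (a 0) \<le> B S * exp (a S)"
  proof (rule DERIV_nonneg_imp_nondecreasing[OF \<open>0 \<le> S\<close>])
    fix s assume s: "0 \<le> s" "s \<le> S"
    have "((\<lambda>s. B s * exp (a s)) has_real_derivative (B' s + a' s * B s) * exp (a s)) (at s)"
      by (auto intro!: derivative_eq_intros dB da s simp: algebra_simps)
    moreover have "(B' s + a' s * B s) * exp (a s) \<ge> 0"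
      using bound[OF s] by (intro mult_nonneg_nonneg) auto
    ultimately show "\<exists>y. ((\<lambda>s. B s * exp (a s)) has_real_derivative y) (at s) \<and> y \<ge> 0"
      by blast
  qed
  then show "B 0 \<le> exp (a S - a 0) * B S"
    by (simp add: exp_diff field_simps)
qed

text \<open>Gronwall is applied to the square of the norm, which stays differentiable where the
  vector vanishes. In \<open>2 * card W\<close> the 2 comes from differentiating squares, and
  \<open>card W\<close> from estimating every component by the full norm. The reverse inequality
  serves for travelling a path backwards.\<close>

lemma sum_norm_power2_gronwall:
  fixes K K' :: "'w \<Rightarrow> real \<Rightarrow> complex" and a a' :: "real \<Rightarrow> real"
  assumes "finite W"
    and dK: "\<And>w s. w \<in> W \<Longrightarrow> 0 \<le> s \<Longrightarrow> s \<le> S \<Longrightarrow> (K w has_vector_derivative K' w s) (at s)"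
    and da: "\<And>s. 0 \<le> s \<Longrightarrow> s \<le> S \<Longrightarrow> (a has_real_derivative a' s) (at s)"
    and bound: "\<And>w s. w \<in> W \<Longrightarrow> 0 \<le> s \<Longrightarrow> s \<le> S \<Longrightarrow>
        2 * real (card W) * norm (K' w s) \<le> a' s * L2_set (\<lambda>w. norm (K w s)) W"
    and "0 \<le> S"
  shows "(\<Sum>w\<in>W. (norm (K w S))\<^sup>2) \<le> exp (a S - a 0) * (\<Sum>w\<in>W. (norm (K w 0))\<^sup>2)"
    and "(\<Sum>w\<in>W. (norm (K w 0))\<^sup>2) \<le> exp (a S - a 0) * (\<Sum>w\<in>W. (norm (K w S))\<^sup>2)"
proof -
  define B where "B s = (\<Sum>w\<in>W. K w s \<bullet> K w s)" for s
  define B' where "B' s = (\<Sum>w\<in>W. 2 * (K w s \<bullet> K' w s))" for s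
  have dB: "(B has_real_derivative B' s) (at s)" if s: "0 \<le> s" "s \<le> S" for s
    unfolding B_def B'_def
  proof (rule DERIV_sum)
    fix w assume w: "w \<in> W"
    have "((\<lambda>s. K w s \<bullet> K w s) has_derivative
        (\<lambda>h. K w s \<bullet> (h *\<^sub>R K' w s) + (h *\<^sub>R K' w s) \<bullet> K w s)) (at s)"
      using dK[OF w s] unfolding has_vector_derivative_def
      by (intro has_derivative_inner) auto
    then show "((\<lambda>s. K w s \<bullet> K w s) has_real_derivative 2 * (K w s \<bullet> K' w s)) (at s)"
      unfolding has_field_derivative_def
      by (rule has_derivative_eq_rhs) (auto simp: fun_eq_iff inner_commute)
  qed
  have B_L2: "B s = L2_set (\<lambda>w. norm (K w s)) W * L2_set (\<lambda>w. norm (K w s)) W" for s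
    unfolding B_def L2_set_def by (simp add: sum_nonneg dot_square_norm)
  have B_bound: "\<bar>B' s\<bar> \<le> a' s * B s" if s: "0 \<le> s" "s \<le> S" for s
  proof -
    let ?q = "L2_set (\<lambda>w. norm (K w s)) W"
    have "\<bar>B' s\<bar> \<le> (\<Sum>w\<in>W. \<bar>2 * (K w s \<bullet> K' w s)\<bar>)"
      unfolding B'_def by (rule sum_abs)
    also have "\<dots> \<le> (\<Sum>w\<in>W. ?q * (2 * norm (K' w s)))"
    proof (rule sum_mono)
      fix w assume w: "w \<in> W"
      have "\<bar>K w s \<bullet> K' w s\<bar> \<le> norm (K w s) * norm (K' w s)"
        by (rule Cauchy_Schwarz_ineq2)
      also have "\<dots> \<le> ?q * norm (K' w s)"
        using member_le_L2_set[OF \<open>finite W\<close> w, of "\<lambda>w. norm (K w s)"]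
        by (intro mult_right_mono) auto
      finally show "\<bar>2 * (K w s \<bullet> K' w s)\<bar> \<le> ?q * (2 * norm (K' w s))"
        by simp
    qed
    also have "\<dots> \<le> (\<Sum>w\<in>W. ?q * (a' s * ?q / card W))"
    proof (intro sum_mono mult_left_mono)
      fix w assume w: "w \<in> W"
      then have "card W > 0"
        using \<open>finite W\<close> card_gt_0_iff by blast
      then show "2 * norm (K' w s) \<le> a' s * ?q / card W"
        using bound[OF w s] by (simp add: field_simps)
    qed simp
    also have "\<dots> \<le> a' s * B s"
      using B_L2[of s] by (cases "W = {}") (auto simp: \<open>finite W\<close>)
    finally show ?thesis .
  qed
  have B_eq: "B s = (\<Sum>w\<in>W. (norm (K w s))\<^sup>2)" for s
    unfolding B_def by (simp add: dot_square_norm)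
  show "(\<Sum>w\<in>W. (norm (K w S))\<^sup>2) \<le> exp (a S - a 0) * (\<Sum>w\<in>W. (norm (K w 0))\<^sup>2)"
    and "(\<Sum>w\<in>W. (norm (K w 0))\<^sup>2) \<le> exp (a S - a 0) * (\<Sum>w\<in>W. (norm (K w S))\<^sup>2)"
    using multiplicative_gronwall[OF dB da B_bound \<open>0 \<le> S\<close>] unfolding B_eq by auto
qed

text \<open>The off-diagonal coefficients are only \<open>O(1/s)\<close>, which is not integrable, but up to an
  integrable remainder they are derivatives of functions \<open>\<Psi>\<close> that are \<open>O(1/s)\<close>. Integrating by
  parts replaces \<open>K\<close> by \<open>K - \<Psi>K\<close>, whose derivative is \<open>O(1/s\<^sup>2)\<close>.\<close>

lemma oscillatory_system_bound:
  fixes K :: "'w \<Rightarrow> real \<Rightarrow> complex" and A \<Psi> r :: "'b \<Rightarrow> 'w \<Rightarrow> real \<Rightarrow> complex"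
    and \<tau> :: "'b \<Rightarrow> 'w \<Rightarrow> 'w"
  assumes "finite W" "finite P"
    and \<tau>: "\<And>b w. b \<in> P \<Longrightarrow> w \<in> W \<Longrightarrow> \<tau> b w \<in> W"
    and dK: "\<And>w s. w \<in> W \<Longrightarrow> 0 \<le> s \<Longrightarrow> s \<le> S \<Longrightarrow>
        (K w has_vector_derivative (\<Sum>b\<in>P. A b w s * K (\<tau> b w) s)) (at s)"
    and d\<Psi>: "\<And>b w s. b \<in> P \<Longrightarrow> w \<in> W \<Longrightarrow> 0 \<le> s \<Longrightarrow> s \<le> S \<Longrightarrow>
        (\<Psi> b w has_vector_derivative A b w s + r b w s) (at s)"
    and A: "\<And>b w s. b \<in> P \<Longrightarrow> w \<in> W \<Longrightarrow> 0 \<le> s \<Longrightarrow> s \<le> S \<Longrightarrow> norm (A b w s) \<le> C / (1 + s)"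
    and r: "\<And>b w s. b \<in> P \<Longrightarrow> w \<in> W \<Longrightarrow> 0 \<le> s \<Longrightarrow> s \<le> S \<Longrightarrow> norm (r b w s) \<le> C / (1 + s)\<^sup>2"
    and \<Psi>: "\<And>b w s. b \<in> P \<Longrightarrow> w \<in> W \<Longrightarrow> 0 \<le> s \<Longrightarrow> s \<le> S \<Longrightarrow> norm (\<Psi> b w s) \<le> C / (1 + s)"
    and \<Psi>_small: "\<And>b w s. b \<in> P \<Longrightarrow> w \<in> W \<Longrightarrow> 0 \<le> s \<Longrightarrow> s \<le> S \<Longrightarrow>
        norm (\<Psi> b w s) * (2 * real (card P) * real (card W)) \<le> 1"
    and "0 \<le> S" "0 \<le> C"
  defines "D \<equiv> 9 * exp (4 * real (card W) * (real (card P) * C + (real (card P) * C)\<^sup>2))"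
  shows "(\<Sum>w\<in>W. (norm (K w S))\<^sup>2) \<le> D * (\<Sum>w\<in>W. (norm (K w 0))\<^sup>2)"
    and "(\<Sum>w\<in>W. (norm (K w 0))\<^sup>2) \<le> D * (\<Sum>w\<in>W. (norm (K w S))\<^sup>2)"
proof -
  define q where "q s = L2_set (\<lambda>w. norm (K w s)) W" for s
  define M where "M w s = K w s - (\<Sum>b\<in>P. \<Psi> b w s * K (\<tau> b w) s)" for w s
  define m where "m s = L2_set (\<lambda>w. norm (M w s)) W" for s
  \<comment> \<open>In the derivative of \<open>M\<close> the terms \<open>A * K\<close> cancel.
    What is left is \<open>r * K\<close> and \<open>\<Psi>\<close> times the derivative of
    \<open>K (\<tau> b w)\<close>, a product of two factors of size 1/s.\<close>
  define M' where "M' w s = - (\<Sum>b\<in>P. r b w s * K (\<tau> b w) s +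
      \<Psi> b w s * (\<Sum>g\<in>P. A g (\<tau> b w) s * K (\<tau> g (\<tau> b w)) s))" for w s
  define p where "p = real (card P)"
  define c where "c = p * C + (p * C)\<^sup>2"
  have q_nonneg: "0 \<le> q s" for s
    unfolding q_def by simp
  have K_le: "norm (K w s) \<le> q s" if "w \<in> W" for w s
    unfolding q_def using member_le_L2_set[OF \<open>finite W\<close> that, of "\<lambda>w. norm (K w s)"] by simp
  have dM: "(M w has_vector_derivative M' w s) (at s)" if w: "w \<in> W" and s: "0 \<le> s" "s \<le> S" for w s
  proof -
    have "((\<lambda>s. K w s - (\<Sum>b\<in>P. \<Psi> b w s * K (\<tau> b w) s)) has_vector_derivative
        (\<Sum>b\<in>P. A b w s * K (\<tau> b w) s) - (\<Sum>b\<in>P. \<Psi> b w s * (\<Sum>g\<in>P. A g (\<tau> b w) s * K (\<tau> g (\<tau> b w)) s)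
           + (A b w s + r b w s) * K (\<tau> b w) s)) (at s)"
      using w s
      by (intro has_vector_derivative_diff has_vector_derivative_sum has_vector_derivative_mult dK d\<Psi> \<tau>)
    then show ?thesis
      unfolding M_def[abs_def] M'_def
      by (rule has_vector_derivative_eq_rhs)
         (simp add: sum_subtractf[symmetric] sum_negf[symmetric] algebra_simps)
  qed
  have M'_le: "norm (M' w s) \<le> c / (1 + s)\<^sup>2 * q s" if w: "w \<in> W" and s: "0 \<le> s" "s \<le> S" for w s
  proof -
    have "norm (M' w s) \<le> (\<Sum>b\<in>P. norm (r b w s * K (\<tau> b w) s +
      \<Psi> b w s * (\<Sum>g\<in>P. A g (\<tau> b w) s * K (\<tau> g (\<tau> b w)) s)))"
      unfolding M'_def norm_minus_cancel by (rule norm_sum)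
    also have "\<dots> \<le> (\<Sum>b\<in>P. C / (1 + s)\<^sup>2 * q s + C / (1 + s) * (p * (C / (1 + s) * q s)))"
    proof (rule sum_mono)
      fix b assume b: "b \<in> P"
      have "norm (\<Sum>g\<in>P. A g (\<tau> b w) s * K (\<tau> g (\<tau> b w)) s) \<le>
          (\<Sum>g\<in>P. norm (A g (\<tau> b w) s * K (\<tau> g (\<tau> b w)) s))"
        by (rule norm_sum)
      also have "\<dots> \<le> (\<Sum>g\<in>P. C / (1 + s) * q s)"
        unfolding norm_mult using b w s \<open>0 \<le> C\<close>
        by (intro sum_mono mult_mono A K_le \<tau>) auto
      finally have *: "norm (\<Sum>g\<in>P. A g (\<tau> b w) s * K (\<tau> g (\<tau> b w)) s) \<le> p * (C / (1 + s) * q s)"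
        by (simp add: p_def)
      have "norm (r b w s * K (\<tau> b w) s + \<Psi> b w s * (\<Sum>g\<in>P. A g (\<tau> b w) s * K (\<tau> g (\<tau> b w)) s))
          \<le> norm (r b w s) * norm (K (\<tau> b w) s) +
            norm (\<Psi> b w s) * norm (\<Sum>g\<in>P. A g (\<tau> b w) s * K (\<tau> g (\<tau> b w)) s)"
        unfolding norm_mult[symmetric] by (rule norm_triangle_ineq)
      also have "\<dots> \<le> C / (1 + s)\<^sup>2 * q s + C / (1 + s) * (p * (C / (1 + s) * q s))"
        using b w s \<open>0 \<le> C\<close> by (intro add_mono mult_mono r K_le \<Psi> \<tau> *) auto
      finally show "norm (r b w s * K (\<tau> b w) s +
          \<Psi> b w s * (\<Sum>g\<in>P. A g (\<tau> b w) s * K (\<tau> g (\<tau> b w)) s))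
          \<le> C / (1 + s)\<^sup>2 * q s + C / (1 + s) * (p * (C / (1 + s) * q s))" .
    qed
    also have "\<dots> = c / (1 + s)\<^sup>2 * q s"
      by (simp add: c_def p_def[symmetric] add_divide_distrib power2_eq_square distrib_left distrib_right)
    finally show ?thesis .
  qed
  have M_le: "norm (M w s - K w s) * (2 * real (card W)) \<le> q s" if w: "w \<in> W" and s: "0 \<le> s" "s \<le> S" for w s
  proof (cases "P = {}")
    case True
    then show ?thesis by (simp add: M_def q_nonneg)
  next
    case False
    then have "p > 0"
      using \<open>finite P\<close> by (simp add: p_def card_gt_0_iff)
    have "norm (M w s - K w s) * (2 * real (card W))
        \<le> (\<Sum>b\<in>P. norm (\<Psi> b w s * K (\<tau> b w) s)) * (2 * real (card W))"
      unfolding M_def by (intro mult_right_mono) (auto intro: norm_sum)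
    also have "\<dots> = (\<Sum>b\<in>P. norm (\<Psi> b w s) * (2 * p * real (card W)) * norm (K (\<tau> b w) s) / p)"
      using \<open>p > 0\<close> by (subst sum_distrib_right) (auto intro!: sum.cong simp: norm_mult)
    also have "\<dots> \<le> (\<Sum>b\<in>P. 1 * q s / p)"
      using w s \<open>p > 0\<close> unfolding p_def
      by (intro sum_mono divide_right_mono mult_mono \<Psi>_small K_le \<tau>) auto
    also have "\<dots> = q s"
      using \<open>p > 0\<close> by (simp add: p_def)
    finally show ?thesis .
  qed
  \<comment> \<open>\<open>\<Psi>_small\<close> makes the passage from \<open>K\<close> to
    \<open>M\<close> invertible in norm: the two differ by at most half of \<open>q\<close>, so
    \<open>m\<close> and \<open>q\<close> are comparable with absolute constants.\<close>
  have L2_MK: "L2_set (\<lambda>w. norm (M w s - K w s)) W \<le> q s / 2" if s: "0 \<le> s" "s \<le> S" for s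
  proof (cases "W = {}")
    case True
    then show ?thesis using q_nonneg by simp
  next
    case False
    then have "card W > 0"
      using \<open>finite W\<close> by (simp add: card_gt_0_iff)
    have "L2_set (\<lambda>w. norm (M w s - K w s)) W \<le> (\<Sum>w\<in>W. norm (M w s - K w s))"
      by (rule L2_set_le_sum) auto
    also have "\<dots> \<le> (\<Sum>w\<in>W. q s / (2 * real (card W)))"
      using M_le[OF _ s] \<open>card W > 0\<close> by (intro sum_mono) (simp add: field_simps)
    also have "\<dots> = q s / 2"
      using \<open>card W > 0\<close> by simp
    finally show ?thesis .
  qed
  have m_le: "m s \<le> 3 / 2 * q s" if s: "0 \<le> s" "s \<le> S" for s
  proof -
    have "m s \<le> L2_set (\<lambda>w. norm (K w s) + norm (M w s - K w s)) W"
      unfolding m_def by (intro L2_set_mono) (auto intro: norm_triangle_sub)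
    also have "\<dots> \<le> q s + L2_set (\<lambda>w. norm (M w s - K w s)) W"
      unfolding q_def by (rule L2_set_triangle_ineq)
    finally show ?thesis
      using L2_MK[OF s] by simp
  qed
  have q_le: "q s \<le> 2 * m s" if s: "0 \<le> s" "s \<le> S" for s
  proof -
    have "q s \<le> L2_set (\<lambda>w. norm (M w s) + norm (M w s - K w s)) W"
      unfolding q_def by (intro L2_set_mono) (auto simp: norm_minus_commute intro: norm_triangle_sub)
    also have "\<dots> \<le> m s + L2_set (\<lambda>w. norm (M w s - K w s)) W"
      unfolding m_def by (rule L2_set_triangle_ineq)
    finally show ?thesis
      using L2_MK[OF s] by simp
  qed
  have q_sq: "(\<Sum>w\<in>W. (norm (K w s))\<^sup>2) = (q s)\<^sup>2" and m_sq: "(\<Sum>w\<in>W. (norm (M w s))\<^sup>2) = (m s)\<^sup>2" for s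
    unfolding q_def m_def L2_set_def by (simp_all add: sum_nonneg)
  have c_nonneg: "0 \<le> c"
    using \<open>0 \<le> C\<close> by (simp add: c_def p_def)
  \<comment> \<open>A primitive of the rate \<open>4 * card W * c / (1 + s)^2\<close>. Its total
    increase is at most \<open>4 * card W * c\<close>, so \<open>D\<close> does not depend on
    \<open>S\<close>. The 4 is the 2 of the Gronwall lemma times the 2 in
    \<open>q s \<le> 2 * m s\<close>.\<close>
  define a where "a s = - (4 * real (card W) * c / (1 + s))" for s :: real
  have da: "(a has_real_derivative 4 * real (card W) * c / (1 + s)\<^sup>2) (at s)" if s: "0 \<le> s" for s
    unfolding a_def[abs_def] using s
    by (auto intro!: derivative_eq_intros simp: power2_eq_square)
  have bound: "2 * real (card W) * norm (M' w s) \<le>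
      4 * real (card W) * c / (1 + s)\<^sup>2 * L2_set (\<lambda>w. norm (M w s)) W"
    if w: "w \<in> W" and s: "0 \<le> s" "s \<le> S" for w s
  proof -
    have "2 * real (card W) * norm (M' w s) \<le> 2 * real (card W) * (c / (1 + s)\<^sup>2 * (2 * m s))"
      using M'_le[OF w s] mult_left_mono[OF q_le[OF s], of "c / (1 + s)\<^sup>2"] c_nonneg
      by (intro mult_left_mono) auto
    then show ?thesis
      by (simp add: m_def algebra_simps)
  qed
  have "a S - a 0 \<le> 4 * real (card W) * c"
    using \<open>0 \<le> S\<close> c_nonneg unfolding a_def by (simp add: field_simps)
  then have exp_le: "9 * exp (a S - a 0) \<le> D"
    unfolding D_def c_def p_def by simp
  have m_S0: "(m S)\<^sup>2 \<le> exp (a S - a 0) * (m 0)\<^sup>2" "(m 0)\<^sup>2 \<le> exp (a S - a 0) * (m S)\<^sup>2"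
    using sum_norm_power2_gronwall[OF \<open>finite W\<close> dM da bound \<open>0 \<le> S\<close>] unfolding m_sq by auto
  \<comment> \<open>The 9 in \<open>D\<close> is (2 * 3/2)^2: \<open>q \<le> 2 * m\<close> is used
    at one end of the path and \<open>m \<le> 3/2 * q\<close> at the other.\<close>
  have combine: "(q t)\<^sup>2 \<le> D * (q s)\<^sup>2"
    if *: "(m t)\<^sup>2 \<le> exp (a S - a 0) * (m s)\<^sup>2" "0 \<le> s" "s \<le> S" "0 \<le> t" "t \<le> S" for s t
  proof -
    have "(q t)\<^sup>2 \<le> (2 * m t)\<^sup>2"
      using q_le[of t] q_nonneg that by (intro power_mono) auto
    also have "\<dots> = 4 * (m t)\<^sup>2"
      by (simp add: power_mult_distrib)
    also have "\<dots> \<le> 4 * (exp (a S - a 0) * (m s)\<^sup>2)"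
      using * by simp
    also have "\<dots> \<le> 4 * (exp (a S - a 0) * (3 / 2 * q s)\<^sup>2)"
      using m_le[of s] that by (intro mult_left_mono power_mono) (auto simp: m_def)
    also have "\<dots> = 9 * exp (a S - a 0) * (q s)\<^sup>2"
      by (simp add: power_mult_distrib power2_eq_square)
    also have "\<dots> \<le> D * (q s)\<^sup>2"
      using exp_le by (intro mult_right_mono) auto
    finally show ?thesis .
  qed
  show "(\<Sum>w\<in>W. (norm (K w S))\<^sup>2) \<le> D * (\<Sum>w\<in>W. (norm (K w 0))\<^sup>2)"
    and "(\<Sum>w\<in>W. (norm (K w 0))\<^sup>2) \<le> D * (\<Sum>w\<in>W. (norm (K w S))\<^sup>2)"
    unfolding q_sq using combine m_S0 \<open>0 \<le> S\<close> by auto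
qed

section \<open>Laplace transforms of compactly supported measures\<close>

lemma cbilin_complexify: "cbilin z (complexify \<eta>) = Complex (fst z \<bullet> \<eta>) (snd z \<bullet> \<eta>)"
  by (simp add: cbilin_def complexify_def)

lemma cbilin_complexify_add:
  "cbilin (z + v) (complexify \<eta>) = cbilin z (complexify \<eta>) + cbilin v (complexify \<eta>)"
  by (simp add: cbilin_complexify inner_left_distrib complex_eq_iff)

lemma cbilin_complexify_scaleR:
  "cbilin (c *\<^sub>R v) (complexify \<eta>) = c *\<^sub>R cbilin v (complexify \<eta>)"
  by (simp add: cbilin_complexify complex_eq_iff)

lemma norm_cbilin_complexify_le: "norm (cbilin z (complexify \<eta>)) \<le> 2 * norm z * norm \<eta>"
proof -
  have "norm (cbilin z (complexify \<eta>)) \<le> \<bar>fst z \<bullet> \<eta>\<bar> + \<bar>snd z \<bullet> \<eta>\<bar>"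
    using cmod_le[of "cbilin z (complexify \<eta>)"] by (simp add: cbilin_complexify)
  also have "\<dots> \<le> norm (fst z) * norm \<eta> + norm (snd z) * norm \<eta>"
    by (intro add_mono Cauchy_Schwarz_ineq2)
  also have "\<dots> \<le> norm z * norm \<eta> + norm z * norm \<eta>"
    using norm_fst_le[of "fst z" "snd z"] norm_snd_le[of "snd z" "fst z"]
    by (intro add_mono mult_right_mono) auto
  finally show ?thesis by (simp add: algebra_simps)
qed

lemma borel_measurable_cbilin_complexify [measurable]:
  "(\<lambda>\<eta>. cbilin z (complexify \<eta>)) \<in> borel_measurable borel"
  unfolding cbilin_complexify Complex_eq by measurable

lemma norm_exp_remainder: "norm (exp z - 1 - z) \<le> exp (norm z) * (norm z)\<^sup>2" for z :: complex
  using Taylor_exp_field[of z 1] by (simp add: power2_eq_square diff_diff_eq)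

lemma root_reflection_add_scaleR:
  "root_reflection \<alpha> (a + c *\<^sub>R b) = root_reflection \<alpha> a + c *\<^sub>R root_reflection \<alpha> b"
  by (simp add: root_reflection_def algebra_simps inner_add_right)

locale compactly_supported_measure = finite_measure \<mu> for \<mu> :: "'a::euclidean_space measure" +
  fixes r :: real
  assumes sets_eq [measurable_cong, simp]: "sets \<mu> = sets borel"
    and supported: "AE \<eta> in \<mu>. norm \<eta> \<le> r"
    and r_nonneg: "0 \<le> r"
begin

text \<open>The factor \<open>h\<close> keeps the family closed under differentiation, since a
  derivative brings down a linear function of \<open>\<eta>\<close>. With \<open>h = 1\<close> and
  the representing measure this is the Dunkl kernel in its second argument.\<close>

definition laplace_transform :: "('a \<Rightarrow> complex) \<Rightarrow> 'a complexified \<Rightarrow> complex" where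
  "laplace_transform h z = (\<integral>\<eta>. h \<eta> * exp (cbilin z (complexify \<eta>)) \<partial>\<mu>)"

lemma AE_norm_cbilin: "AE \<eta> in \<mu>. norm (cbilin z (complexify \<eta>)) \<le> 2 * norm z * r"
  using supported
proof eventually_elim
  case (elim \<eta>)
  then show ?case
    using norm_cbilin_complexify_le[of z \<eta>] mult_left_mono[OF elim, of "2 * norm z"] by simp
qed

lemma AE_norm_exp_cbilin: "AE \<eta> in \<mu>. norm (exp (cbilin z (complexify \<eta>))) \<le> exp (2 * norm z * r)"
  using AE_norm_cbilin[of z]
proof eventually_elim
  case (elim \<eta>)
  then show ?case
    using norm_exp[of "cbilin z (complexify \<eta>)"] by (meson exp_le_cancel_iff order_trans)
qed

lemma integrable_bounded:
  fixes g :: "'a \<Rightarrow> complex"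
  assumes "g \<in> borel_measurable borel" "AE \<eta> in \<mu>. norm (g \<eta>) \<le> B"
  shows "integrable \<mu> g"
  using assms by (intro integrable_const_bound[of g B]) auto

lemma norm_integral_le:
  fixes g :: "'a \<Rightarrow> complex"
  assumes "g \<in> borel_measurable borel" "AE \<eta> in \<mu>. norm (g \<eta>) \<le> B"
  shows "norm (\<integral>\<eta>. g \<eta> \<partial>\<mu>) \<le> B * measure \<mu> (space \<mu>)"
proof -
  have "norm (\<integral>\<eta>. g \<eta> \<partial>\<mu>) \<le> (\<integral>\<eta>. norm (g \<eta>) \<partial>\<mu>)"
    by (rule integral_norm_bound)
  also have "\<dots> \<le> (\<integral>\<eta>. B \<partial>\<mu>)"
    using assms integrable_bounded[OF assms] by (intro integral_mono_AE) auto
  finally show ?thesis by (simp add: mult.commute)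
qed

lemma AE_norm_mult_le:
  fixes g h :: "'a \<Rightarrow> complex"
  assumes "AE \<eta> in \<mu>. norm (g \<eta>) \<le> B" "AE \<eta> in \<mu>. norm (h \<eta>) \<le> C"
  shows "AE \<eta> in \<mu>. norm (g \<eta> * h \<eta>) \<le> B * C"
  using assms
proof eventually_elim
  case (elim \<eta>)
  then show ?case
    unfolding norm_mult by (intro mult_mono) (auto intro: order_trans[OF norm_ge_zero])
qed

lemma laplace_integrable:
  assumes "h \<in> borel_measurable borel" "AE \<eta> in \<mu>. norm (h \<eta>) \<le> B"
  shows "integrable \<mu> (\<lambda>\<eta>. h \<eta> * exp (cbilin z (complexify \<eta>)))"
proof (rule integrable_bounded[where B = "B * exp (2 * norm z * r)"])
  show "AE \<eta> in \<mu>. norm (h \<eta> * exp (cbilin z (complexify \<eta>))) \<le> B * exp (2 * norm z * r)"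
    by (rule AE_norm_mult_le[OF assms(2) AE_norm_exp_cbilin])
qed (use assms in measurable)

text \<open>As the support is bounded, the quadratic Taylor remainder of the exponential is uniform
  in \<open>\<eta>\<close>, so the difference quotient converges at the linear rate
  \<open>C * norm (y - z)\<close>.\<close>

lemma has_derivative_laplace_transform:
  assumes [measurable]: "h \<in> borel_measurable borel" and h: "AE \<eta> in \<mu>. norm (h \<eta>) \<le> B"
  shows "(laplace_transform h has_derivative
      (\<lambda>v. laplace_transform (\<lambda>\<eta>. h \<eta> * cbilin v (complexify \<eta>)) z)) (at z)"
proof (rule has_derivativeI_sandwich[of 1])
  let ?e = "\<lambda>v \<eta>. cbilin v (complexify \<eta>)"
  let ?D = "\<lambda>v. laplace_transform (\<lambda>\<eta>. h \<eta> * ?e v \<eta>) z"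
  have int_D: "integrable \<mu> (\<lambda>\<eta>. h \<eta> * ?e v \<eta> * exp (?e z \<eta>))" for v
    by (rule laplace_integrable[OF _ AE_norm_mult_le[OF h AE_norm_cbilin]]) measurable
  have bnd: "norm (?D v) \<le> norm v * (B * (2 * r) * exp (2 * norm z * r) * measure \<mu> (space \<mu>))" for v
  proof -
    have "AE \<eta> in \<mu>. norm (h \<eta> * ?e v \<eta> * exp (?e z \<eta>)) \<le> B * (2 * norm v * r) * exp (2 * norm z * r)"
      by (intro AE_norm_mult_le[OF AE_norm_mult_le[OF h AE_norm_cbilin] AE_norm_exp_cbilin])
    from norm_integral_le[OF _ this] show ?thesis
      unfolding laplace_transform_def by (simp add: mult_ac)
  qed
  show "bounded_linear ?D"
  proof (rule bounded_linear_intro[OF _ _ bnd])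
    show "?D (x + y) = ?D x + ?D y" for x y
      unfolding laplace_transform_def
      by (subst Bochner_Integration.integral_add[symmetric])
         (auto intro!: int_D simp: cbilin_complexify_add distrib_left distrib_right)
    show "?D (c *\<^sub>R x) = c *\<^sub>R ?D x" for c x
      unfolding laplace_transform_def
      by (subst Bochner_Integration.integral_scaleR_right[symmetric]) (simp add: cbilin_complexify_scaleR)
  qed
  define C where "C = B * exp (2 * norm z * r) * (exp (2 * r) * (2 * r)\<^sup>2) * measure \<mu> (space \<mu>)"
  show "norm (laplace_transform h y - laplace_transform h z - ?D (y - z)) / norm (y - z) \<le> C * norm (y - z)"
    if y: "y \<noteq> z" "dist y z < 1" for y
  proof -
    define v where "v = y - z"
    have v: "norm v \<le> 1" "norm v > 0"
      using y by (auto simp: v_def dist_norm)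
    have y_eq: "y = z + v"
      by (simp add: v_def)
    have "laplace_transform h y - laplace_transform h z - ?D v =
        (\<integral>\<eta>. h \<eta> * exp (?e z \<eta>) * (exp (?e v \<eta>) - 1 - ?e v \<eta>) \<partial>\<mu>)"
      unfolding laplace_transform_def y_eq
      by (subst Bochner_Integration.integral_diff[symmetric];
          (intro Bochner_Integration.integrable_diff laplace_integrable[OF _ h] int_D; simp)?)+
         (simp add: cbilin_complexify_add exp_add algebra_simps)
    moreover have "AE \<eta> in \<mu>. norm (h \<eta> * exp (?e z \<eta>) * (exp (?e v \<eta>) - 1 - ?e v \<eta>))
        \<le> B * exp (2 * norm z * r) * (exp (2 * r) * (2 * norm v * r)\<^sup>2)"
      using h AE_norm_exp_cbilin[of z] AE_norm_cbilin[of v]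
    proof eventually_elim
      case (elim \<eta>)
      have "2 * norm v * r \<le> 2 * r"
        using v r_nonneg by (simp add: mult_left_le_one_le)
      then have "norm (?e v \<eta>) \<le> 2 * r"
        using elim(3) by simp
      then have "exp (norm (?e v \<eta>)) * (norm (?e v \<eta>))\<^sup>2 \<le> exp (2 * r) * (2 * norm v * r)\<^sup>2"
        using elim(3) by (intro mult_mono power_mono) auto
      then have *: "norm (exp (?e v \<eta>) - 1 - ?e v \<eta>) \<le> exp (2 * r) * (2 * norm v * r)\<^sup>2"
        using norm_exp_remainder order_trans by blast
      have "0 \<le> B"
        using elim(1) norm_ge_zero order_trans by blast
      then show ?case
        unfolding norm_mult by (intro mult_mono elim *) auto
    qed
    ultimately have "norm (laplace_transform h y - laplace_transform h z - ?D v)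
        \<le> B * exp (2 * norm z * r) * (exp (2 * r) * (2 * norm v * r)\<^sup>2) * measure \<mu> (space \<mu>)"
      using norm_integral_le by simp
    also have "\<dots> = C * norm v * norm v"
      by (simp add: C_def power2_eq_square)
    finally show ?thesis
      using v by (simp add: v_def[symmetric] divide_le_eq)
  qed
  show "((\<lambda>y. C * norm (y - z)) \<longlongrightarrow> 0) (at z)"
    by (rule tendsto_eq_intros tendsto_norm | simp)+
qed simp

lemma inner_bounded: "AE \<eta> in \<mu>. norm (complex_of_real (\<xi> \<bullet> \<eta>)) \<le> norm \<xi> * r"
  using supported
proof eventually_elim
  case (elim \<eta>)
  then show ?case
    using Cauchy_Schwarz_ineq2[of \<xi> \<eta>] mult_left_mono[OF elim, of "norm \<xi>"] by simp
qed

text \<open>The argument is the point a + \<zeta> b of the complexification with complex \<zeta>.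
  Restriction to complex lines reduces the analytic continuation of the Dunkl equations to one
  complex variable.\<close>

lemma laplace_transform_holomorphic_on_line:
  assumes h: "h \<in> borel_measurable borel" "AE \<eta> in \<mu>. norm (h \<eta>) \<le> B"
  shows "(\<lambda>\<zeta>. laplace_transform h (a + Re \<zeta> *\<^sub>R b, Im \<zeta> *\<^sub>R b)) holomorphic_on S"
proof (rule holomorphic_onI)
  fix \<zeta>
  let ?D = "laplace_transform (\<lambda>\<eta>. h \<eta> * complex_of_real (b \<bullet> \<eta>)) (a + Re \<zeta> *\<^sub>R b, Im \<zeta> *\<^sub>R b)"
  have line: "((\<lambda>\<zeta>. (a + Re \<zeta> *\<^sub>R b, Im \<zeta> *\<^sub>R b)) has_derivative (\<lambda>t. (Re t *\<^sub>R b, Im t *\<^sub>R b))) (at \<zeta>)"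
    by (auto intro!: derivative_eq_intros)
  have "((\<lambda>\<zeta>. laplace_transform h (a + Re \<zeta> *\<^sub>R b, Im \<zeta> *\<^sub>R b)) has_derivative
      (\<lambda>t. laplace_transform (\<lambda>\<eta>. h \<eta> * cbilin (Re t *\<^sub>R b, Im t *\<^sub>R b) (complexify \<eta>))
             (a + Re \<zeta> *\<^sub>R b, Im \<zeta> *\<^sub>R b))) (at \<zeta>)"
    using has_derivative_compose[OF line has_derivative_laplace_transform[OF h]] by simp
  moreover have "laplace_transform (\<lambda>\<eta>. h \<eta> * cbilin (Re t *\<^sub>R b, Im t *\<^sub>R b) (complexify \<eta>))
      (a + Re \<zeta> *\<^sub>R b, Im \<zeta> *\<^sub>R b) = ?D * t" for t
  proof -
    have "cbilin (Re t *\<^sub>R b, Im t *\<^sub>R b) (complexify \<eta>) = complex_of_real (b \<bullet> \<eta>) * t" for \<eta>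
      by (simp add: cbilin_complexify complex_eq_iff)
    then show ?thesis
      unfolding laplace_transform_def
      by (subst integral_mult_left_zero[symmetric]) (simp add: mult_ac)
  qed
  ultimately have "((\<lambda>\<zeta>. laplace_transform h (a + Re \<zeta> *\<^sub>R b, Im \<zeta> *\<^sub>R b)) has_field_derivative ?D) (at \<zeta>)"
    unfolding has_field_derivative_def by (simp add: fun_eq_iff)
  then show "(\<lambda>\<zeta>. laplace_transform h (a + Re \<zeta> *\<^sub>R b, Im \<zeta> *\<^sub>R b)) field_differentiable at \<zeta> within S"
    using field_differentiable_at_within field_differentiable_def by blast
qed

lemma laplace_transform_1_has_derivative:
  "(laplace_transform (\<lambda>_. 1) has_derivative
      (\<lambda>v. laplace_transform (\<lambda>\<eta>. cbilin v (complexify \<eta>)) z)) (at z)"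
  using has_derivative_laplace_transform[of "\<lambda>_. 1" 1] by simp

lemma frechet_derivative_laplace_transform:
  "frechet_derivative (\<lambda>y. laplace_transform (\<lambda>_. 1) (complexify y)) (at x) \<xi> =
     laplace_transform (\<lambda>\<eta>. complex_of_real (\<xi> \<bullet> \<eta>)) (complexify x)"
proof -
  have "(complexify has_derivative complexify) (at x)"
    unfolding complexify_def[abs_def] by (auto intro!: derivative_eq_intros)
  from has_derivative_compose[OF this laplace_transform_1_has_derivative]
  have "((\<lambda>y. laplace_transform (\<lambda>_. 1) (complexify y)) has_derivative
      (\<lambda>v. laplace_transform (\<lambda>\<eta>. cbilin (complexify v) (complexify \<eta>)) (complexify x))) (at x)" .
  from frechet_derivative_at[OF this, symmetric] show ?thesis
    by (simp add: cbilin_complexify) (simp add: complexify_def complex_of_real_def)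
qed

lemma imaginary_derivative_laplace_transform:
  assumes "(p has_vector_derivative v) (at s)"
  shows "((\<lambda>s. laplace_transform (\<lambda>_. 1) (a, p s)) has_vector_derivative
      \<i> * laplace_transform (\<lambda>\<eta>. complex_of_real (v \<bullet> \<eta>)) (a, p s)) (at s)"
proof -
  have "((\<lambda>s. (a, p s)) has_derivative (\<lambda>t. (0, t *\<^sub>R v))) (at s)"
    using assms unfolding has_vector_derivative_def by (intro has_derivative_Pair) auto
  from has_derivative_compose[OF this laplace_transform_1_has_derivative]
  have "((\<lambda>s. laplace_transform (\<lambda>_. 1) (a, p s)) has_derivative
      (\<lambda>t. laplace_transform (\<lambda>\<eta>. cbilin (0, t *\<^sub>R v) (complexify \<eta>)) (a, p s))) (at s)" .
  moreover have "laplace_transform (\<lambda>\<eta>. cbilin (0, t *\<^sub>R v) (complexify \<eta>)) (a, p s) =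
      t *\<^sub>R (\<i> * laplace_transform (\<lambda>\<eta>. complex_of_real (v \<bullet> \<eta>)) (a, p s))" for t
  proof -
    have "cbilin (0, t *\<^sub>R v) (complexify \<eta>) = complex_of_real t * \<i> * complex_of_real (v \<bullet> \<eta>)" for \<eta>
      by (simp add: cbilin_complexify complex_eq_iff)
    then have "laplace_transform (\<lambda>\<eta>. cbilin (0, t *\<^sub>R v) (complexify \<eta>)) (a, p s) =
        complex_of_real t * \<i> * laplace_transform (\<lambda>\<eta>. complex_of_real (v \<bullet> \<eta>)) (a, p s)"
      unfolding laplace_transform_def
      by (subst integral_mult_right_zero[symmetric]) (simp only: mult.assoc)
    then show ?thesis
      by (simp add: scaleR_conv_of_real)
  qed
  ultimately show ?thesis
    unfolding has_vector_derivative_def by simp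
qed

text \<open>Identity theorem on the complex line \<sigma> + \<zeta> x. For real \<zeta> near 0 the
  point is real and off the walls of \<open>P\<close>, where the Dunkl equation holds with honest
  difference quotients; at \<zeta> = \<i> the point is \<open>(\<sigma>, x)\<close>.\<close>

lemma dunkl_equation_complex:
  fixes k :: "'a \<Rightarrow> complex" and lam \<sigma> x \<xi> :: 'a
  assumes "finite P" and \<sigma>: "\<And>\<alpha>. \<alpha> \<in> P \<Longrightarrow> \<alpha> \<bullet> \<sigma> \<noteq> 0"
    and eigen: "dunkl_eigenfunction P k (complexify lam) (laplace_transform (\<lambda>_. 1))"
  shows "laplace_transform (\<lambda>\<eta>. complex_of_real (\<xi> \<bullet> \<eta>)) (\<sigma>, x) =
    complex_of_real (\<xi> \<bullet> lam) * laplace_transform (\<lambda>_. 1) (\<sigma>, x) -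
    (\<Sum>\<alpha>\<in>P. k \<alpha> * complex_of_real (\<alpha> \<bullet> \<xi>) *
      ((laplace_transform (\<lambda>_. 1) (\<sigma>, x) -
        laplace_transform (\<lambda>_. 1) (root_reflection \<alpha> \<sigma>, root_reflection \<alpha> x))
       / Complex (\<alpha> \<bullet> \<sigma>) (\<alpha> \<bullet> x)))"
proof -
  let ?F = "laplace_transform (\<lambda>_. 1)"
  let ?G = "laplace_transform (\<lambda>\<eta>. complex_of_real (\<xi> \<bullet> \<eta>))"
  define L where "L a b \<zeta> = (a + Re \<zeta> *\<^sub>R b, Im \<zeta> *\<^sub>R b)" for a b :: 'a and \<zeta>
  define \<phi> where "\<phi> \<zeta> = ?G (L \<sigma> x \<zeta>) + (\<Sum>\<alpha>\<in>P. k \<alpha> * complex_of_real (\<alpha> \<bullet> \<xi>) *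
      ((?F (L \<sigma> x \<zeta>) - ?F (L (root_reflection \<alpha> \<sigma>) (root_reflection \<alpha> x) \<zeta>))
        / (complex_of_real (\<alpha> \<bullet> \<sigma>) + \<zeta> * complex_of_real (\<alpha> \<bullet> x))))
      - complex_of_real (\<xi> \<bullet> lam) * ?F (L \<sigma> x \<zeta>)" for \<zeta>
  \<comment> \<open>A denominator can vanish only at the real number - (\<alpha> . \<sigma>) /
    (\<alpha> . x). A vertical strip of half-width \<open>\<epsilon>\<close> around the imaginary
    axis therefore contains no pole, but contains both 0 and \<i>. Taking the reciprocal of a sum of
    reciprocals makes roots with \<alpha> . x = 0 harmless.\<close>
  define \<epsilon> where "\<epsilon> = 1 / (1 + (\<Sum>\<alpha>\<in>P. \<bar>\<alpha> \<bullet> x\<bar> / \<bar>\<alpha> \<bullet> \<sigma>\<bar>))"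
  have sum_nonneg': "(\<Sum>\<alpha>\<in>P. \<bar>\<alpha> \<bullet> x\<bar> / \<bar>\<alpha> \<bullet> \<sigma>\<bar>) \<ge> 0"
    by (simp add: sum_nonneg)
  then have "\<epsilon> > 0"
    unfolding \<epsilon>_def by simp
  have \<epsilon>: "\<epsilon> * \<bar>\<alpha> \<bullet> x\<bar> \<le> \<bar>\<alpha> \<bullet> \<sigma>\<bar>" if "\<alpha> \<in> P" for \<alpha>
  proof -
    have "\<bar>\<alpha> \<bullet> x\<bar> / \<bar>\<alpha> \<bullet> \<sigma>\<bar> \<le> (\<Sum>\<alpha>\<in>P. \<bar>\<alpha> \<bullet> x\<bar> / \<bar>\<alpha> \<bullet> \<sigma>\<bar>)"
      using that \<open>finite P\<close> by (intro member_le_sum) auto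
    then have "\<bar>\<alpha> \<bullet> x\<bar> / \<bar>\<alpha> \<bullet> \<sigma>\<bar> \<le> 1 / \<epsilon>"
      unfolding \<epsilon>_def by simp
    then show ?thesis
      using \<sigma>[OF that] \<open>\<epsilon> > 0\<close> by (simp add: field_simps)
  qed
  define S where "S = {\<zeta>::complex. \<bar>Re \<zeta>\<bar> < \<epsilon>}"
  have S_eq: "S = {\<zeta>. Re \<zeta> < \<epsilon>} \<inter> {\<zeta>. - \<epsilon> < Re \<zeta>}"
    by (auto simp: S_def)
  have "open S"
    unfolding S_eq by (intro open_Int open_halfspace_Re_lt open_halfspace_Re_gt)
  have "connected S"
    unfolding S_eq by (intro convex_connected convex_Int convex_halfspace_Re_lt convex_halfspace_Re_gt)
  have denom: "complex_of_real (\<alpha> \<bullet> \<sigma>) + \<zeta> * complex_of_real (\<alpha> \<bullet> x) \<noteq> 0"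
    if "\<alpha> \<in> P" "\<zeta> \<in> S" for \<alpha> \<zeta>
  proof
    assume "complex_of_real (\<alpha> \<bullet> \<sigma>) + \<zeta> * complex_of_real (\<alpha> \<bullet> x) = 0"
    then have eq: "\<alpha> \<bullet> \<sigma> = - (Re \<zeta> * (\<alpha> \<bullet> x))"
      by (simp add: complex_eq_iff)
    then have "\<alpha> \<bullet> x \<noteq> 0"
      using \<sigma>[OF \<open>\<alpha> \<in> P\<close>] by auto
    moreover have "\<epsilon> * \<bar>\<alpha> \<bullet> x\<bar> \<le> \<bar>Re \<zeta>\<bar> * \<bar>\<alpha> \<bullet> x\<bar>"
      using \<epsilon>[OF \<open>\<alpha> \<in> P\<close>] unfolding eq by (simp add: abs_mult)
    ultimately show False
      using \<open>\<zeta> \<in> S\<close> by (simp add: S_def)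
  qed
  have "\<phi> holomorphic_on S"
    unfolding \<phi>_def[abs_def] L_def
    by (intro holomorphic_intros laplace_transform_holomorphic_on_line[OF _ inner_bounded])
       (auto simp: denom intro!: laplace_transform_holomorphic_on_line[where B = 1])
  moreover have "0 islimpt complex_of_real ` {-\<epsilon><..<\<epsilon>}"
    unfolding islimpt_approachable
  proof (intro allI impI)
    fix e :: real assume "e > 0"
    then show "\<exists>x'\<in>complex_of_real ` {-\<epsilon><..<\<epsilon>}. x' \<noteq> 0 \<and> dist x' 0 < e"
      using \<open>\<epsilon> > 0\<close> by (intro bexI[of _ "complex_of_real (min \<epsilon> e / 2)"] imageI) auto
  qed
  moreover have "\<phi> \<zeta> = 0" if "\<zeta> \<in> complex_of_real ` {-\<epsilon><..<\<epsilon>}" for \<zeta>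
  proof -
    from that obtain t where t: "\<zeta> = complex_of_real t" "- \<epsilon> < t" "t < \<epsilon>"
      by auto
    then have "\<zeta> \<in> S"
      by (simp add: S_def abs_less_iff)
    define y where "y = \<sigma> + t *\<^sub>R x"
    have y: "\<alpha> \<bullet> y \<noteq> 0"
      "complex_of_real (\<alpha> \<bullet> \<sigma>) + \<zeta> * complex_of_real (\<alpha> \<bullet> x) = complex_of_real (\<alpha> \<bullet> y)" if "\<alpha> \<in> P" for \<alpha>
    proof -
      show eq: "complex_of_real (\<alpha> \<bullet> \<sigma>) + \<zeta> * complex_of_real (\<alpha> \<bullet> x) = complex_of_real (\<alpha> \<bullet> y)"
        by (simp add: y_def t inner_add_right)
      show "\<alpha> \<bullet> y \<noteq> 0"
        using denom[OF that \<open>\<zeta> \<in> S\<close>] unfolding eq by simp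
    qed
    have L_y: "L \<sigma> x \<zeta> = complexify y"
      "L (root_reflection \<alpha> \<sigma>) (root_reflection \<alpha> x) \<zeta> = complexify (root_reflection \<alpha> y)" for \<alpha>
      by (simp_all add: L_def t complexify_def y_def root_reflection_add_scaleR)
    have "dunkl_operator P k \<xi> (\<lambda>y. ?F (complexify y)) y = cbilin (complexify \<xi>) (complexify lam) * ?F (complexify y)"
      using eigen unfolding dunkl_eigenfunction_def by blast
    moreover have "cbilin (complexify \<xi>) (complexify lam) = complex_of_real (\<xi> \<bullet> lam)"
      by (simp add: cbilin_complexify complex_eq_iff) (simp add: complexify_def)
    moreover have "(\<Sum>\<alpha>\<in>P. k \<alpha> * complex_of_real (\<alpha> \<bullet> \<xi>) *
      ((?F (L \<sigma> x \<zeta>) - ?F (L (root_reflection \<alpha> \<sigma>) (root_reflection \<alpha> x) \<zeta>))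
        / (complex_of_real (\<alpha> \<bullet> \<sigma>) + \<zeta> * complex_of_real (\<alpha> \<bullet> x)))) =
      (\<Sum>\<alpha>\<in>P. k \<alpha> * complex_of_real (\<alpha> \<bullet> \<xi>) * dunkl_quotient \<alpha> (\<lambda>y. ?F (complexify y)) y)"
      by (rule sum.cong) (simp_all add: y dunkl_quotient_def L_y)
    ultimately show ?thesis
      unfolding \<phi>_def dunkl_operator_def frechet_derivative_laplace_transform L_y by simp
  qed
  moreover have "complex_of_real ` {-\<epsilon><..<\<epsilon>} \<subseteq> S" "0 \<in> S" "\<i> \<in> S"
    using \<open>\<epsilon> > 0\<close> by (auto simp: S_def)
  ultimately have "\<phi> \<i> = 0"
    using analytic_continuation[of \<phi> S "complex_of_real ` {-\<epsilon><..<\<epsilon>}" 0 \<i>] \<open>open S\<close> \<open>connected S\<close>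
    by blast
  moreover have "L a b \<i> = (a, b)" for a b
    by (simp add: L_def)
  moreover have "complex_of_real a + \<i> * complex_of_real b = Complex a b" for a b
    by (simp add: Complex_eq)
  ultimately show ?thesis
    unfolding \<phi>_def by (simp add: algebra_simps)
qed

end

section \<open>Root systems and reflection groups\<close>

lemma linear_root_reflection: "linear (root_reflection \<alpha>)"
  by (rule linearI) (simp_all add: root_reflection_def algebra_simps inner_add_right)

locale root_system =
  fixes R P :: "'a::euclidean_space set"
  assumes root_system: "normalized_root_system R" and positive: "positive_roots R P"
begin

lemma finite_R: "finite R"
  and span_R: "span R = UNIV"
  and reflection_image: "\<alpha> \<in> R \<Longrightarrow> root_reflection \<alpha> ` R = R"
  and root_norm: "\<alpha> \<in> R \<Longrightarrow> \<alpha> \<bullet> \<alpha> = 2"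
  using root_system by (auto simp: normalized_root_system_def)

lemma uminus_root: "\<alpha> \<in> R \<Longrightarrow> - \<alpha> \<in> R"
  using root_system by (auto simp: normalized_root_system_def)

lemma P_subset: "P \<subseteq> R"
  and uminus_notin_P: "\<alpha> \<in> P \<Longrightarrow> - \<alpha> \<notin> P"
  and root_cases: "\<alpha> \<in> R \<Longrightarrow> \<alpha> \<in> P \<or> - \<alpha> \<in> P"
  using positive uminus_root by (auto simp: positive_roots_def not_less_iff_gr_or_eq)

lemma finite_P: "finite P"
  using P_subset finite_R finite_subset by blast

lemma R_eq: "R = P \<union> uminus ` P"
  using P_subset uminus_root root_cases by (force intro: image_eqI[of _ _ "- x" for x])

lemma sum_even_roots:
  fixes g :: "'a \<Rightarrow> complex"
  assumes "\<And>\<alpha>. \<alpha> \<in> R \<Longrightarrow> g (- \<alpha>) = g \<alpha>"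
  shows "sum g R = 2 * sum g P"
proof -
  have "sum g R = sum g P + sum g (uminus ` P)"
    unfolding R_eq using finite_P uminus_notin_P by (intro sum.union_disjoint) auto
  also have "sum g (uminus ` P) = sum (\<lambda>\<alpha>. g (- \<alpha>)) P"
    by (subst sum.reindex) (auto simp: inj_on_def)
  also have "\<dots> = sum g P"
    using assms P_subset by (intro sum.cong) auto
  finally show ?thesis by simp
qed

lemma span_P: "span P = UNIV"
proof -
  have "R \<subseteq> span P"
    unfolding R_eq by (auto intro: span_base span_neg)
  then show ?thesis
    using span_R span_minimal subspace_span by blast
qed

lemma exists_dominant:
  assumes "0 < N"
  obtains \<rho> where "\<And>\<alpha>. \<alpha> \<in> P \<Longrightarrow> N \<le> \<alpha> \<bullet> \<rho>"
proof -
  obtain \<beta> where \<beta>: "P = {\<alpha>\<in>R. 0 < \<alpha> \<bullet> \<beta>}"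
    using positive by (auto simp: positive_roots_def)
  have "\<exists>\<delta>>0. \<forall>\<alpha>\<in>P. \<delta> \<le> \<alpha> \<bullet> \<beta>"
  proof (cases "P = {}")
    case True
    then show ?thesis by (auto intro: exI[of _ 1])
  next
    case False
    then show ?thesis
      using finite_P \<beta> by (intro exI[of _ "Min ((\<lambda>\<alpha>. \<alpha> \<bullet> \<beta>) ` P)"]) (auto simp: Min_gr_iff)
  qed
  then obtain \<delta> where \<delta>: "\<delta> > 0" "\<And>\<alpha>. \<alpha> \<in> P \<Longrightarrow> \<delta> \<le> \<alpha> \<bullet> \<beta>"
    by blast
  show ?thesis
  proof (rule that[of "(N / \<delta>) *\<^sub>R \<beta>"])
    fix \<alpha> assume "\<alpha> \<in> P"
    then have "N / \<delta> * \<delta> \<le> N / \<delta> * (\<alpha> \<bullet> \<beta>)"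
      using \<delta> assms by (intro mult_left_mono) auto
    then show "N \<le> \<alpha> \<bullet> (N / \<delta>) *\<^sub>R \<beta>"
      using \<delta> by simp
  qed
qed

lemma inner_root_reflection:
  assumes "\<alpha> \<in> R"
  shows "root_reflection \<alpha> x \<bullet> root_reflection \<alpha> y = x \<bullet> y"
  using root_norm[OF assms] by (simp add: root_reflection_def algebra_simps inner_commute)

lemma reflection_group_linear: "w \<in> reflection_group R \<Longrightarrow> linear w"
proof (induction rule: reflection_group.induct)
  case one
  then show ?case by (simp add: linear_iff)
next
  case (step w \<alpha>)
  then show ?case
    using linear_compose linear_root_reflection by blast
qed

lemma reflection_group_inner: "w \<in> reflection_group R \<Longrightarrow> w x \<bullet> w y = x \<bullet> y"
  by (induction rule: reflection_group.induct) (simp_all add: inner_root_reflection)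

lemma reflection_group_image: "w \<in> reflection_group R \<Longrightarrow> w ` R = R"
proof (induction rule: reflection_group.induct)
  case (step w \<alpha>)
  then show ?case
    by (metis image_comp reflection_image)
qed simp

lemma reflection_group_root: "w \<in> reflection_group R \<Longrightarrow> \<alpha> \<in> R \<Longrightarrow> w \<alpha> \<in> R"
  using reflection_group_image by blast

lemma reflection_group_comp:
  "w \<in> reflection_group R \<Longrightarrow> \<beta> \<in> R \<Longrightarrow> w \<circ> root_reflection \<beta> \<in> reflection_group R"
proof (induction rule: reflection_group.induct)
  case one
  then show ?case
    using reflection_group.step[OF reflection_group.one, of \<beta>] by simp
next
  case (step w \<alpha>)
  then show ?case
    by (metis comp_assoc reflection_group.step)
qed

text \<open>Group elements are linear and \<open>R\<close> spans the space, so each is determined by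
  its action on the finite set \<open>R\<close>.\<close>

lemma finite_reflection_group: "finite (reflection_group R)"
proof (rule inj_on_finite[where f = "\<lambda>w. restrict w R" and B = "R \<rightarrow>\<^sub>E R"])
  show "inj_on (\<lambda>w. restrict w R) (reflection_group R)"
  proof (rule inj_onI)
    fix w w' assume w: "w \<in> reflection_group R" "w' \<in> reflection_group R"
      and eq: "restrict w R = restrict w' R"
    have "w x = w' x" if "x \<in> R" for x
      using fun_cong[OF eq, of x] that by simp
    then show "w = w'"
      using w reflection_group_linear linear_eq_on_span[of w w' R] span_R by blast
  qed
  show "(\<lambda>w. restrict w R) ` reflection_group R \<subseteq> R \<rightarrow>\<^sub>E R"
    using reflection_group_root by auto
  show "finite (R \<rightarrow>\<^sub>E R)"
    using finite_R by (intro finite_PiE) auto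
qed

text \<open>\<open>w\<close> need not map \<open>P\<close> to itself, but it permutes
  \<open>R\<close>; for an even summand the sum over \<open>P\<close> is half the sum over
  \<open>R\<close>, which removes the choice of positive roots.\<close>

lemma sum_even_roots_reindex:
  fixes g :: "'a \<Rightarrow> complex"
  assumes "\<And>\<alpha>. \<alpha> \<in> R \<Longrightarrow> g (- \<alpha>) = g \<alpha>" and w: "w \<in> reflection_group R"
  shows "(\<Sum>\<alpha>\<in>P. g \<alpha>) = (\<Sum>\<beta>\<in>P. g (w \<beta>))"
proof -
  have "inj w"
  proof (rule injI)
    fix x y assume "w x = w y"
    then have "w (x - y) = 0"
      using linear_diff[OF reflection_group_linear[OF w]] by simp
    then show "x = y"
      using reflection_group_inner[OF w, of "x - y" "x - y"] by simp
  qed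
  have "2 * (\<Sum>\<alpha>\<in>P. g \<alpha>) = sum g (w ` R)"
    using sum_even_roots[of g] assms(1) reflection_group_image[OF w] by simp
  also have "\<dots> = (\<Sum>\<beta>\<in>R. g (w \<beta>))"
    using \<open>inj w\<close> by (subst sum.reindex) (auto intro: inj_on_subset)
  also have "\<dots> = 2 * (\<Sum>\<beta>\<in>P. g (w \<beta>))"
    using assms(1) reflection_group_image[OF w] linear_neg[OF reflection_group_linear[OF w]]
    by (intro sum_even_roots) auto
  finally show ?thesis by simp
qed

lemma reflection_conjugate:
  assumes "w \<in> reflection_group R"
  shows "root_reflection (w \<beta>) (w y) = w (root_reflection \<beta> y)"
  using reflection_group_linear[OF assms]
  by (simp add: root_reflection_def reflection_group_inner[OF assms] linear_diff linear_scale)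

text \<open>Perturb x slightly in the regular direction \<open>\<eta>\<close>. Where \<alpha> . x is
  nonzero the sign survives; where it is zero the sign condition is void and \<open>\<eta>\<close>
  provides regularity.\<close>

lemma compatible_regular:
  assumes "\<And>\<alpha>. \<alpha> \<in> P \<Longrightarrow> \<alpha> \<bullet> \<eta> \<noteq> 0"
  obtains \<xi> where "\<And>\<alpha>. \<alpha> \<in> P \<Longrightarrow> \<alpha> \<bullet> \<xi> \<noteq> 0" "\<And>\<alpha>. \<alpha> \<in> P \<Longrightarrow> 0 \<le> (\<alpha> \<bullet> x) * sgn (\<alpha> \<bullet> \<xi>)"
proof -
  define B where "B = {\<alpha>\<in>P. \<alpha> \<bullet> x \<noteq> 0}"
  define \<epsilon> where "\<epsilon> = 1 / (1 + (\<Sum>\<alpha>\<in>B. \<bar>\<alpha> \<bullet> \<eta>\<bar> / \<bar>\<alpha> \<bullet> x\<bar>))"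
  have sum_ge: "(\<Sum>\<alpha>\<in>B. \<bar>\<alpha> \<bullet> \<eta>\<bar> / \<bar>\<alpha> \<bullet> x\<bar>) \<ge> 0"
    by (simp add: sum_nonneg)
  then have "\<epsilon> > 0"
    unfolding \<epsilon>_def by simp
  have small: "\<bar>\<epsilon> * (\<alpha> \<bullet> \<eta>)\<bar> < \<bar>\<alpha> \<bullet> x\<bar>" if "\<alpha> \<in> B" for \<alpha>
  proof -
    have "\<bar>\<alpha> \<bullet> \<eta>\<bar> / \<bar>\<alpha> \<bullet> x\<bar> \<le> (\<Sum>\<alpha>\<in>B. \<bar>\<alpha> \<bullet> \<eta>\<bar> / \<bar>\<alpha> \<bullet> x\<bar>)"
      using that finite_P by (intro member_le_sum) (auto simp: B_def)
    then have "\<bar>\<alpha> \<bullet> \<eta>\<bar> / \<bar>\<alpha> \<bullet> x\<bar> < 1 / \<epsilon>"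
      unfolding \<epsilon>_def by simp
    then show ?thesis
      using that \<open>\<epsilon> > 0\<close> by (simp add: B_def field_simps abs_mult)
  qed
  show ?thesis
  proof (rule that[of "x + \<epsilon> *\<^sub>R \<eta>"])
    fix \<alpha> assume \<alpha>: "\<alpha> \<in> P"
    show "\<alpha> \<bullet> (x + \<epsilon> *\<^sub>R \<eta>) \<noteq> 0"
      using small[of \<alpha>] assms[OF \<alpha>] \<alpha> \<open>\<epsilon> > 0\<close>
      by (cases "\<alpha> \<bullet> x = 0") (auto simp: B_def inner_add_right)
    show "0 \<le> (\<alpha> \<bullet> x) * sgn (\<alpha> \<bullet> (x + \<epsilon> *\<^sub>R \<eta>))"
      using small[of \<alpha>] \<alpha> by (cases "\<alpha> \<bullet> x = 0") (auto simp: B_def inner_add_right sgn_if)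
  qed
qed

text \<open>Only the sign pattern of a compatible direction matters, so finitely many directions suffice.\<close>

lemma finite_compatible_regular:
  assumes "\<And>\<alpha>. \<alpha> \<in> P \<Longrightarrow> \<alpha> \<bullet> \<eta> \<noteq> 0"
  obtains \<Xi> where "finite \<Xi>" "\<And>\<xi> \<alpha>. \<xi> \<in> \<Xi> \<Longrightarrow> \<alpha> \<in> P \<Longrightarrow> \<alpha> \<bullet> \<xi> \<noteq> 0"
    "\<And>x. \<exists>\<xi>\<in>\<Xi>. \<forall>\<alpha>\<in>P. 0 \<le> (\<alpha> \<bullet> x) * sgn (\<alpha> \<bullet> \<xi>)"
proof -
  define pat where "pat \<xi> = restrict (\<lambda>\<alpha>. sgn (\<alpha> \<bullet> \<xi>)) P" for \<xi>
  define Reg where "Reg = {\<xi>. \<forall>\<alpha>\<in>P. \<alpha> \<bullet> \<xi> \<noteq> 0}"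
  have "finite (P \<rightarrow>\<^sub>E {-1, 0, 1::real})"
    using finite_P by (intro finite_PiE) auto
  moreover have "pat ` Reg \<subseteq> P \<rightarrow>\<^sub>E {-1, 0, 1}"
    unfolding pat_def image_subset_iff restrict_PiE_iff by (simp add: sgn_if)
  ultimately have "finite (pat ` Reg)"
    by (rule rev_finite_subset)
  then obtain \<Xi> where \<Xi>: "\<Xi> \<subseteq> Reg" "finite \<Xi>" "pat ` Reg = pat ` \<Xi>"
    using finite_subset_image[of "pat ` Reg" pat Reg] by auto
  show ?thesis
  proof (rule that[OF \<Xi>(2)])
    show "\<alpha> \<bullet> \<xi> \<noteq> 0" if "\<xi> \<in> \<Xi>" "\<alpha> \<in> P" for \<xi> \<alpha>
      using that \<Xi>(1) by (auto simp: Reg_def)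
    fix x
    obtain \<xi> where \<xi>: "\<And>\<alpha>. \<alpha> \<in> P \<Longrightarrow> \<alpha> \<bullet> \<xi> \<noteq> 0" "\<And>\<alpha>. \<alpha> \<in> P \<Longrightarrow> 0 \<le> (\<alpha> \<bullet> x) * sgn (\<alpha> \<bullet> \<xi>)"
      using compatible_regular[OF assms] by metis
    then have "pat \<xi> \<in> pat ` \<Xi>"
      using \<Xi>(3) by (auto simp: Reg_def)
    then obtain \<xi>' where \<xi>': "\<xi>' \<in> \<Xi>" "pat \<xi> = pat \<xi>'"
      by auto
    have "sgn (\<alpha> \<bullet> \<xi>') = sgn (\<alpha> \<bullet> \<xi>)" if "\<alpha> \<in> P" for \<alpha>
      using fun_cong[OF \<xi>'(2), of \<alpha>] that by (simp add: pat_def)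
    then show "\<exists>\<xi>\<in>\<Xi>. \<forall>\<alpha>\<in>P. 0 \<le> (\<alpha> \<bullet> x) * sgn (\<alpha> \<bullet> \<xi>)"
      using \<xi>(2) \<xi>'(1) by (intro bexI[of _ \<xi>']) simp_all
  qed
qed

end

section \<open>Decay of the Dunkl kernel\<close>

lemma has_vector_derivative_cis:
  assumes "(g has_real_derivative d) (at s)"
  shows "((\<lambda>s. cis (g s)) has_vector_derivative \<i> * complex_of_real d * cis (g s)) (at s)"
proof -
  have "((\<lambda>s. \<i> * complex_of_real (g s)) has_vector_derivative \<i> * complex_of_real d) (at s)"
    using assms by (intro has_vector_derivative_mult_right has_vector_derivative_of_real)
  from field_vector_diff_chain_at[OF this DERIV_exp] show ?thesis
    by (simp add: cis_conv_exp o_def)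
qed

lemma has_vector_derivative_inner_left:
  assumes "(p has_vector_derivative v) (at s)"
  shows "((\<lambda>s. a \<bullet> p s) has_real_derivative a \<bullet> v) (at s)"
  using bounded_linear.has_vector_derivative[OF bounded_linear_inner_right assms]
  by (simp add: has_real_derivative_iff_has_vector_derivative)

lemma has_vector_derivative_Complex_inner:
  assumes "(p has_vector_derivative v) (at s)"
  shows "((\<lambda>s. Complex c (a \<bullet> p s)) has_vector_derivative \<i> * complex_of_real (a \<bullet> v)) (at s)"
proof -
  have "((\<lambda>s. complex_of_real c + \<i> * complex_of_real (a \<bullet> p s)) has_vector_derivative
      0 + \<i> * complex_of_real (a \<bullet> v)) (at s)"
    using has_vector_derivative_inner_left[OF assms]
    by (intro has_vector_derivative_add has_vector_derivative_const has_vector_derivative_mult_right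
        has_vector_derivative_of_real)
  then show ?thesis
    by (simp add: Complex_eq)
qed

lemma finite_lower_bound:
  fixes g :: "'b \<Rightarrow> real"
  assumes "finite A" "\<And>a. a \<in> A \<Longrightarrow> 0 < g a"
  obtains d where "0 < d" "\<And>a. a \<in> A \<Longrightarrow> d \<le> g a"
proof (cases "A = {}")
  case True
  then show ?thesis using that[of 1] by simp
next
  case False
  then show ?thesis
    using that[of "Min (g ` A)"] assms by (auto simp: Min_gr_iff)
qed

lemma finite_upper_bound:
  fixes g :: "'b \<Rightarrow> real"
  assumes "finite A"
  obtains D where "0 < D" "\<And>a. a \<in> A \<Longrightarrow> g a \<le> D"
proof (rule that)
  show "0 < 1 + (\<Sum>a\<in>A. \<bar>g a\<bar>)"
    by (simp add: add_pos_nonneg sum_nonneg)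
  show "g a \<le> 1 + (\<Sum>a\<in>A. \<bar>g a\<bar>)" if "a \<in> A" for a
    using member_le_sum[OF that, of "\<lambda>a. \<bar>g a\<bar>"] assms by (auto intro: order_trans[OF abs_ge_self])
qed

text \<open>Equal signs exclude cancellation: moving in a compatible direction increases the
  distance from the wall of \<beta> linearly, whatever the starting point.\<close>

lemma abs_inner_compatible:
  fixes x \<xi> \<beta> :: "'a::euclidean_space"
  assumes "0 \<le> (\<beta> \<bullet> x) * sgn (\<beta> \<bullet> \<xi>)" "0 \<le> s"
  shows "\<bar>\<beta> \<bullet> (x + s *\<^sub>R \<xi>)\<bar> = \<bar>\<beta> \<bullet> x\<bar> + s * \<bar>\<beta> \<bullet> \<xi>\<bar>"
proof (cases "\<beta> \<bullet> \<xi>" "0 :: real" rule: linorder_cases)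
  case less
  then have "\<beta> \<bullet> x \<le> 0" "s * (\<beta> \<bullet> \<xi>) \<le> 0"
    using assms by (simp_all add: mult_nonneg_nonpos)
  then show ?thesis
    using less by (simp add: inner_add_right)
next
  case greater
  then have "0 \<le> \<beta> \<bullet> x" "0 \<le> s * (\<beta> \<bullet> \<xi>)"
    using assms by simp_all
  then show ?thesis
    using greater by (simp add: inner_add_right)
qed (simp add: inner_add_right)

locale dunkl_measure = compactly_supported_measure \<mu> r + root_system R P
  for \<mu> :: "'a::euclidean_space measure" and r :: real and R P :: "'a set" +
  fixes k :: "'a \<Rightarrow> real" and lam :: 'a
  assumes k_invariant: "W_invariant R k"
    and k_nonneg: "\<And>\<alpha>. \<alpha> \<in> R \<Longrightarrow> 0 \<le> k \<alpha>"
    and lam_regular: "lam \<in> regular_points R"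
    and eigenfunction:
      "dunkl_eigenfunction P (\<lambda>\<alpha>. complex_of_real (k \<alpha>)) (complexify lam) (laplace_transform (\<lambda>_. 1))"
begin

section \<open>The differential system on a W-orbit\<close>

abbreviation "W \<equiv> reflection_group R"

abbreviation "F \<equiv> laplace_transform (\<lambda>_. 1)"

text \<open>The principal logarithm is the right branch here: for dominant \<open>\<rho>\<close> all
  factors lie in the open right half-plane, away from the cut.\<close>

definition weight :: "'a \<Rightarrow> 'a \<Rightarrow> complex" where
  "weight \<rho> x = exp (\<Sum>\<beta>\<in>P. complex_of_real (k \<beta>) * Ln (Complex (\<beta> \<bullet> \<rho>) (\<beta> \<bullet> x)))"

text \<open>The weight is taken at x for every \<open>w\<close>, not at w x, so it is a common
  factor of the whole orbit vector and one choice removes all diagonal terms at once.\<close>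

definition K :: "'a \<Rightarrow> ('a \<Rightarrow> 'a) \<Rightarrow> 'a \<Rightarrow> complex" where
  "K \<rho> w x = cis (- (w x \<bullet> lam)) * F (w \<rho>, w x) * weight \<rho> x"

text \<open>The last factor is the quotient of the phases of two orbit members joined by a
  reflection: w x - w (s x) = (\<beta> . x) w \<beta>, where s is the reflection in \<beta>. The
  vector \<open>v\<close> is the velocity of the path.\<close>

definition coeff :: "'a \<Rightarrow> 'a \<Rightarrow> ('a \<Rightarrow> 'a) \<Rightarrow> 'a \<Rightarrow> 'a \<Rightarrow> complex" where
  "coeff \<rho> \<beta> w x v = complex_of_real (k \<beta>) * (\<i> * complex_of_real (\<beta> \<bullet> v) / Complex (\<beta> \<bullet> \<rho>) (\<beta> \<bullet> x)) *
     cis (- (w \<beta> \<bullet> lam) * (\<beta> \<bullet> x))"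

lemma k_reflection_group: "w \<in> W \<Longrightarrow> \<alpha> \<in> R \<Longrightarrow> k (w \<alpha>) = k \<alpha>"
  using k_invariant by (simp add: W_invariant_def)

lemma k_uminus:
  assumes "\<alpha> \<in> R"
  shows "k (- \<alpha>) = k \<alpha>"
proof -
  have "root_reflection \<alpha> \<in> W"
    using reflection_group.step[OF reflection_group.one assms] by simp
  moreover have "root_reflection \<alpha> \<alpha> = - \<alpha>"
    using root_norm[OF assms] by (simp add: root_reflection_def scaleR_2)
  ultimately show ?thesis
    using k_reflection_group assms by metis
qed

lemma has_vector_derivative_reflection_group:
  assumes "w \<in> W" "(p has_vector_derivative v) (at s)"
  shows "((\<lambda>s. w (p s)) has_vector_derivative w v) (at s)"
  using assms reflection_group_linear linear_conv_bounded_linear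
    bounded_linear.has_vector_derivative by blast

lemma weight_derivative:
  assumes p: "(p has_vector_derivative v) (at s)" and \<rho>: "\<And>\<beta>. \<beta> \<in> P \<Longrightarrow> 0 < \<beta> \<bullet> \<rho>"
  shows "((\<lambda>s. weight \<rho> (p s)) has_vector_derivative
    (\<Sum>\<beta>\<in>P. complex_of_real (k \<beta>) * (\<i> * complex_of_real (\<beta> \<bullet> v) / Complex (\<beta> \<bullet> \<rho>) (\<beta> \<bullet> p s)))
      * weight \<rho> (p s)) (at s)"
proof -
  have "((\<lambda>s. \<Sum>\<beta>\<in>P. complex_of_real (k \<beta>) * Ln (Complex (\<beta> \<bullet> \<rho>) (\<beta> \<bullet> p s))) has_vector_derivative
      (\<Sum>\<beta>\<in>P. complex_of_real (k \<beta>) * (\<i> * complex_of_real (\<beta> \<bullet> v) * inverse (Complex (\<beta> \<bullet> \<rho>) (\<beta> \<bullet> p s)))))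
      (at s)"
  proof (intro has_vector_derivative_sum has_vector_derivative_mult_right)
    fix \<beta> assume "\<beta> \<in> P"
    then have "Complex (\<beta> \<bullet> \<rho>) (\<beta> \<bullet> p s) \<notin> \<real>\<^sub>\<le>\<^sub>0"
      using \<rho>[of \<beta>] by (auto simp: complex_nonpos_Reals_iff)
    from field_vector_diff_chain_at[OF has_vector_derivative_Complex_inner[OF p] has_field_derivative_Ln[OF this]]
    show "((\<lambda>s. Ln (Complex (\<beta> \<bullet> \<rho>) (\<beta> \<bullet> p s))) has_vector_derivative
        \<i> * complex_of_real (\<beta> \<bullet> v) * inverse (Complex (\<beta> \<bullet> \<rho>) (\<beta> \<bullet> p s))) (at s)"
      by (simp add: o_def)
  qed
  from field_vector_diff_chain_at[OF this DERIV_exp] show ?thesis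
    by (simp add: weight_def[abs_def] o_def divide_inverse)
qed

text \<open>The equation at the orbit point of \<open>w\<close> is rewritten so that its
  denominators are the same for all \<open>w\<close> and the reflected values belong to
  \<open>w \<circ> root_reflection \<beta>\<close>; this closes the system on the orbit. It rests on
  the invariance of \<open>k\<close>, the evenness of the summands in the root, and conjugation of
  reflections.\<close>

lemma reflected_dunkl_equation:
  assumes \<rho>: "\<And>\<beta>. \<beta> \<in> P \<Longrightarrow> 0 < \<beta> \<bullet> \<rho>" and w: "w \<in> W"
  shows "laplace_transform (\<lambda>\<eta>. complex_of_real (w v \<bullet> \<eta>)) (w \<rho>, w x) =
    complex_of_real (w v \<bullet> lam) * F (w \<rho>, w x) -
    (\<Sum>\<beta>\<in>P. complex_of_real (k \<beta>) * complex_of_real (\<beta> \<bullet> v) *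
      ((F (w \<rho>, w x) - F ((w \<circ> root_reflection \<beta>) \<rho>, (w \<circ> root_reflection \<beta>) x))
        / Complex (\<beta> \<bullet> \<rho>) (\<beta> \<bullet> x)))"
proof -
  \<comment> \<open>\<open>w \<rho>\<close> is in general no longer dominant, but it is still
    regular: with \<alpha> = w \<beta> the pairing equals \<beta> . \<rho>, which is nonzero for
    both signs of \<beta>.\<close>
  have nz: "\<alpha> \<bullet> w \<rho> \<noteq> 0" if "\<alpha> \<in> P" for \<alpha>
  proof -
    have "\<alpha> \<in> w ` R"
      using that P_subset reflection_group_image[OF w] by auto
    then obtain \<beta> where "\<beta> \<in> R" "\<alpha> = w \<beta>"
      by auto
    then show ?thesis
      using root_cases[of \<beta>] \<rho>[of \<beta>] \<rho>[of "- \<beta>"] reflection_group_inner[OF w] by auto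
  qed
  define g where "g \<alpha> = complex_of_real (k \<alpha>) * complex_of_real (\<alpha> \<bullet> w v) *
      ((F (w \<rho>, w x) - F (root_reflection \<alpha> (w \<rho>), root_reflection \<alpha> (w x)))
       / Complex (\<alpha> \<bullet> w \<rho>) (\<alpha> \<bullet> w x))" for \<alpha>
  have "g (- \<alpha>) = g \<alpha>" if "\<alpha> \<in> R" for \<alpha>
  proof -
    have "Complex (- (\<alpha> \<bullet> w \<rho>)) (- (\<alpha> \<bullet> w x)) = - Complex (\<alpha> \<bullet> w \<rho>) (\<alpha> \<bullet> w x)"
      by (simp add: complex_eq_iff)
    then show ?thesis
      by (simp add: g_def k_uminus[OF that] root_reflection_def[of "- \<alpha>"] root_reflection_def[symmetric])
  qed
  then have "(\<Sum>\<alpha>\<in>P. g \<alpha>) = (\<Sum>\<beta>\<in>P. g (w \<beta>))"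
    using w by (rule sum_even_roots_reindex)
  also have "\<dots> = (\<Sum>\<beta>\<in>P. complex_of_real (k \<beta>) * complex_of_real (\<beta> \<bullet> v) *
      ((F (w \<rho>, w x) - F ((w \<circ> root_reflection \<beta>) \<rho>, (w \<circ> root_reflection \<beta>) x))
        / Complex (\<beta> \<bullet> \<rho>) (\<beta> \<bullet> x)))"
    using P_subset by (intro sum.cong) (auto simp: g_def k_reflection_group[OF w] reflection_group_inner[OF w]
        reflection_conjugate[OF w])
  finally show ?thesis
    using dunkl_equation_complex[OF finite_P nz eigenfunction, of "w v" "w x"]
    unfolding g_def by simp
qed

text \<open>In the product rule the derivative of the phase cancels the eigenvalue term, and the
  derivative of the weight cancels the part of the difference quotients that contains the
  unreflected value. Only the coupling of \<open>w\<close> to its reflected neighbours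
  remains.\<close>

lemma K_derivative:
  assumes p: "(p has_vector_derivative v) (at s)" and \<rho>: "\<And>\<beta>. \<beta> \<in> P \<Longrightarrow> 0 < \<beta> \<bullet> \<rho>" and w: "w \<in> W"
  shows "((\<lambda>s. K \<rho> w (p s)) has_vector_derivative
    (\<Sum>\<beta>\<in>P. coeff \<rho> \<beta> w (p s) v * K \<rho> (w \<circ> root_reflection \<beta>) (p s))) (at s)"
proof -
  note wp = has_vector_derivative_reflection_group[OF w p]
  let ?x = "p s"
  let ?c = "cis (- (w ?x \<bullet> lam))" and ?F = "F (w \<rho>, w ?x)" and ?m = "weight \<rho> ?x"
  define a where "a \<beta> = complex_of_real (k \<beta>) * (\<i> * complex_of_real (\<beta> \<bullet> v) / Complex (\<beta> \<bullet> \<rho>) (\<beta> \<bullet> ?x))" for \<beta>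
  define H where "H \<beta> = F ((w \<circ> root_reflection \<beta>) \<rho>, (w \<circ> root_reflection \<beta>) ?x)" for \<beta>
  have "((\<lambda>s. - (w (p s) \<bullet> lam)) has_real_derivative - (w v \<bullet> lam)) (at s)"
    using has_vector_derivative_inner_left[OF wp, of lam] by (intro DERIV_minus) (simp add: inner_commute)
  note dc = has_vector_derivative_cis[OF this]
  have "\<i> * laplace_transform (\<lambda>\<eta>. complex_of_real (w v \<bullet> \<eta>)) (w \<rho>, w ?x) =
      \<i> * complex_of_real (w v \<bullet> lam) * ?F - (\<Sum>\<beta>\<in>P. a \<beta> * (?F - H \<beta>))"
    by (subst reflected_dunkl_equation[OF \<rho> w])
       (simp_all add: a_def H_def right_diff_distrib sum_distrib_left mult_ac diff_divide_distrib)
  then have dF: "((\<lambda>s. F (w \<rho>, w (p s))) has_vector_derivative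
      \<i> * complex_of_real (w v \<bullet> lam) * ?F - (\<Sum>\<beta>\<in>P. a \<beta> * (?F - H \<beta>))) (at s)"
    using imaginary_derivative_laplace_transform[OF wp, of "w \<rho>"] by simp
  have coeff_K: "coeff \<rho> \<beta> w ?x v * K \<rho> (w \<circ> root_reflection \<beta>) ?x = ?c * ?m * (a \<beta> * H \<beta>)" for \<beta>
  proof -
    have "w (root_reflection \<beta> ?x) = w ?x - (\<beta> \<bullet> ?x) *\<^sub>R w \<beta>"
      using reflection_group_linear[OF w] by (simp add: root_reflection_def linear_diff linear_scale)
    then have "- (w \<beta> \<bullet> lam) * (\<beta> \<bullet> ?x) + - (w (root_reflection \<beta> ?x) \<bullet> lam) = - (w ?x \<bullet> lam)"
      by (simp add: inner_diff_left)
    then have c_split: "?c = cis (- (w \<beta> \<bullet> lam) * (\<beta> \<bullet> ?x)) * cis (- (w (root_reflection \<beta> ?x) \<bullet> lam))"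
      by (simp only: cis_mult)
    show ?thesis
      unfolding c_split coeff_def K_def a_def H_def o_def by (simp only: mult_ac)
  qed
  have "((\<lambda>s. cis (- (w (p s) \<bullet> lam)) * F (w \<rho>, w (p s)) * weight \<rho> (p s)) has_vector_derivative
      ?c * ?F * ((\<Sum>\<beta>\<in>P. a \<beta>) * ?m) +
      (?c * (\<i> * complex_of_real (w v \<bullet> lam) * ?F - (\<Sum>\<beta>\<in>P. a \<beta> * (?F - H \<beta>))) +
       \<i> * complex_of_real (- (w v \<bullet> lam)) * ?c * ?F) * ?m) (at s)"
    unfolding a_def by (intro has_vector_derivative_mult dc dF[unfolded a_def] weight_derivative p \<rho>)
  moreover have "?c * ?F * ((\<Sum>\<beta>\<in>P. a \<beta>) * ?m) +
      (?c * (\<i> * complex_of_real (w v \<bullet> lam) * ?F - (\<Sum>\<beta>\<in>P. a \<beta> * (?F - H \<beta>))) +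
       \<i> * complex_of_real (- (w v \<bullet> lam)) * ?c * ?F) * ?m = ?c * ?m * (\<Sum>\<beta>\<in>P. a \<beta> * H \<beta>)"
    by (simp add: right_diff_distrib sum_subtractf sum_distrib_right[symmetric]) (simp add: algebra_simps)
  ultimately show ?thesis
    unfolding coeff_K K_def[of \<rho> w] by (simp add: sum_distrib_left)
qed

section \<open>Uniform bound for the orbit vector\<close>

lemma norm_coeff:
  "norm (coeff \<rho> \<beta> w x v) = \<bar>k \<beta>\<bar> * \<bar>\<beta> \<bullet> v\<bar> / norm (Complex (\<beta> \<bullet> \<rho>) (\<beta> \<bullet> x))"
  by (simp add: coeff_def norm_mult norm_divide)

definition Q :: "'a \<Rightarrow> 'a \<Rightarrow> real" where
  "Q \<rho> x = (\<Sum>w\<in>W. (norm (K \<rho> w x))\<^sup>2)"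

lemma Q_nonneg: "0 \<le> Q \<rho> x"
  by (simp add: Q_def sum_nonneg)

text \<open>Condition on \<open>\<rho>\<close> that makes the correction \<open>\<Psi>\<close> of \<open>oscillatory_system_bound\<close> small.\<close>

definition far :: "'a \<Rightarrow> bool" where
  "far \<rho> \<longleftrightarrow> (\<forall>\<beta>\<in>P. 1 \<le> \<beta> \<bullet> \<rho> \<and>
     (\<forall>\<gamma>\<in>R. k \<beta> * (2 * real (card P) * real (card W)) \<le> \<bar>\<gamma> \<bullet> lam\<bar> * (\<beta> \<bullet> \<rho>)))"

lemma exists_far: obtains \<rho> where "far \<rho>"
proof -
  obtain c where c: "0 < c" "\<And>\<gamma>. \<gamma> \<in> R \<Longrightarrow> c \<le> \<bar>\<gamma> \<bullet> lam\<bar>"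
    using finite_lower_bound[OF finite_R, of "\<lambda>\<gamma>. \<bar>\<gamma> \<bullet> lam\<bar>"] lam_regular
    by (auto simp: regular_points_def)
  obtain \<kappa> where \<kappa>: "0 < \<kappa>" "\<And>\<beta>. \<beta> \<in> P \<Longrightarrow> k \<beta> \<le> \<kappa>"
    using finite_upper_bound[OF finite_P, of k] by blast
  define m where "m = 2 * real (card P) * real (card W)"
  have "0 \<le> m"
    by (simp add: m_def)
  then have "0 < 1 + \<kappa> * m / c"
    using c \<kappa> by (simp add: add_pos_nonneg)
  then obtain \<rho> where \<rho>: "\<And>\<alpha>. \<alpha> \<in> P \<Longrightarrow> 1 + \<kappa> * m / c \<le> \<alpha> \<bullet> \<rho>"
    using exists_dominant by blast
  have "far \<rho>"
    unfolding far_def m_def[symmetric]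
  proof (intro ballI conjI)
    fix \<beta> assume \<beta>: "\<beta> \<in> P"
    have "0 \<le> \<kappa> * m / c"
      using c \<kappa> \<open>0 \<le> m\<close> by simp
    then show "1 \<le> \<beta> \<bullet> \<rho>"
      using \<rho>[OF \<beta>] by linarith
    fix \<gamma> assume \<gamma>: "\<gamma> \<in> R"
    have "k \<beta> * m \<le> \<kappa> * m"
      using \<kappa>(2)[OF \<beta>] \<open>0 \<le> m\<close> by (intro mult_right_mono)
    also have "\<dots> = c * (\<kappa> * m / c)"
      using c by simp
    also have "\<dots> \<le> \<bar>\<gamma> \<bullet> lam\<bar> * (\<beta> \<bullet> \<rho>)"
      using c(1) c(2)[OF \<gamma>] \<rho>[OF \<beta>] \<open>0 \<le> \<kappa> * m / c\<close> by (intro mult_mono) auto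
    finally show "k \<beta> * m \<le> \<bar>\<gamma> \<bullet> lam\<bar> * (\<beta> \<bullet> \<rho>)" .
  qed
  then show ?thesis
    by (rule that)
qed

lemma far_pos: "far \<rho> \<Longrightarrow> \<beta> \<in> P \<Longrightarrow> 0 < \<beta> \<bullet> \<rho>"
  by (auto simp: far_def intro: less_le_trans[OF zero_less_one])

text \<open>On a ray in a compatible direction all |\<beta> . (x + s \<xi>)| grow at least like s
  |\<beta> . \<xi>|. The hypotheses of \<open>oscillatory_system_bound\<close> therefore hold with
  constants that depend neither on the starting point x nor on the length S, which is why
  \<open>C\<close> is chosen before both.\<close>

lemma Q_along_regular_direction:
  assumes far: "far \<rho>" and \<xi>: "\<And>\<beta>. \<beta> \<in> P \<Longrightarrow> \<beta> \<bullet> \<xi> \<noteq> 0"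
  obtains C where "\<And>x S. (\<And>\<beta>. \<beta> \<in> P \<Longrightarrow> 0 \<le> (\<beta> \<bullet> x) * sgn (\<beta> \<bullet> \<xi>)) \<Longrightarrow> 0 \<le> S \<Longrightarrow>
    Q \<rho> (x + S *\<^sub>R \<xi>) \<le> C * Q \<rho> x \<and> Q \<rho> x \<le> C * Q \<rho> (x + S *\<^sub>R \<xi>)"
proof -
  obtain c where c: "0 < c" "\<And>\<gamma>. \<gamma> \<in> R \<Longrightarrow> c \<le> \<bar>\<gamma> \<bullet> lam\<bar>"
    using finite_lower_bound[OF finite_R, of "\<lambda>\<gamma>. \<bar>\<gamma> \<bullet> lam\<bar>"] lam_regular
    by (auto simp: regular_points_def)
  obtain d where d: "0 < d" "\<And>\<beta>. \<beta> \<in> P \<Longrightarrow> d \<le> \<bar>\<beta> \<bullet> \<xi>\<bar>"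
    using finite_lower_bound[OF finite_P, of "\<lambda>\<beta>. \<bar>\<beta> \<bullet> \<xi>\<bar>"] \<xi> by auto
  obtain D where D: "0 < D" "\<And>\<beta>. \<beta> \<in> P \<Longrightarrow> \<bar>\<beta> \<bullet> \<xi>\<bar> \<le> D"
    using finite_upper_bound[OF finite_P, of "\<lambda>\<beta>. \<bar>\<beta> \<bullet> \<xi>\<bar>"] by blast
  obtain \<kappa> where \<kappa>: "0 < \<kappa>" "\<And>\<beta>. \<beta> \<in> P \<Longrightarrow> \<bar>k \<beta>\<bar> \<le> \<kappa>"
    using finite_upper_bound[OF finite_P, of "\<lambda>\<beta>. \<bar>k \<beta>\<bar>"] by blast
  \<comment> \<open>\<open>norm (u \<beta> s)\<close> is at least 1 by its real part and at least s
    d by its imaginary part; averaging the two bounds gives \<open>b * (1 + s)\<close>.\<close>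
  define b where "b = min 1 d / 2"
  have b: "0 < b" "2 * b \<le> 1" "2 * b \<le> d"
    using d by (auto simp: b_def)
  \<comment> \<open>The three summands are the bounds for \<open>A\<close>, for the remainder
    \<open>r\<close> and for \<open>\<Psi>\<close>, in this order.\<close>
  define C where "C = \<kappa> * D / b + \<kappa> * D / (c * b\<^sup>2) + \<kappa> / (c * b)"
  have C: "0 \<le> C" "\<kappa> * D / b \<le> C" "\<kappa> * D / (c * b\<^sup>2) \<le> C" "\<kappa> / (c * b) \<le> C"
    using b c D \<kappa> by (auto simp: C_def)
  define E where "E = 9 * exp (4 * real (card W) * (real (card P) * C + (real (card P) * C)\<^sup>2))"
  show ?thesis
  proof (rule that[of E])
    fix x S assume x: "\<And>\<beta>. \<beta> \<in> P \<Longrightarrow> 0 \<le> (\<beta> \<bullet> x) * sgn (\<beta> \<bullet> \<xi>)" and "0 \<le> (S::real)"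
    define u where "u \<beta> s = Complex (\<beta> \<bullet> \<rho>) (\<beta> \<bullet> (x + s *\<^sub>R \<xi>))" for \<beta> s
    define cc where "cc \<beta> w = w \<beta> \<bullet> lam" for \<beta> and w :: "'a \<Rightarrow> 'a"
    define ph where "ph \<beta> w s = cis (- cc \<beta> w * (\<beta> \<bullet> (x + s *\<^sub>R \<xi>)))" for \<beta> w s
    \<comment> \<open>Only the oscillating factor is integrated: the derivative of \<open>ph\<close>
      is -\<i> cc (\<beta> . \<xi>) ph, so division by -cc reproduces \<open>A\<close>. Here cc is
      nonzero because w \<beta> is a root and \<open>lam\<close> is regular. Differentiating 1/u
      gives the remainder \<open>r\<close>.\<close>
    define \<Psi> where "\<Psi> \<beta> w s = - complex_of_real (k \<beta> / cc \<beta> w) * (ph \<beta> w s * inverse (u \<beta> s))" for \<beta> w s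
    define A where "A \<beta> w s = coeff \<rho> \<beta> w (x + s *\<^sub>R \<xi>) \<xi>" for \<beta> w s
    define r where "r \<beta> w s = complex_of_real (k \<beta> / cc \<beta> w) * (ph \<beta> w s *
        (\<i> * complex_of_real (\<beta> \<bullet> \<xi>) / (u \<beta> s)\<^sup>2))" for \<beta> w s
    have line: "((\<lambda>s. x + s *\<^sub>R \<xi>) has_vector_derivative \<xi>) (at s)" for s
      by (auto intro!: derivative_eq_intros)
    have u_ge: "b * (1 + s) \<le> norm (u \<beta> s)" "\<beta> \<bullet> \<rho> \<le> norm (u \<beta> s)" "u \<beta> s \<noteq> 0"
      if "\<beta> \<in> P" "0 \<le> s" for \<beta> s
    proof -
      show "\<beta> \<bullet> \<rho> \<le> norm (u \<beta> s)"
        using complex_Re_le_cmod[of "u \<beta> s"] by (simp add: u_def)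
      then have "1 \<le> norm (u \<beta> s)"
        using far that by (force simp: far_def)
      moreover have "s * d \<le> norm (u \<beta> s)"
        using abs_Im_le_cmod[of "u \<beta> s"] abs_inner_compatible[OF x[OF that(1)] that(2)]
          mult_left_mono[OF d(2)[OF that(1)] that(2)]
        unfolding u_def complex.sel by linarith
      moreover have "s * (2 * b) \<le> s * d"
        using b that by (intro mult_left_mono) auto
      ultimately have "1 + s * (2 * b) \<le> 2 * norm (u \<beta> s)"
        by linarith
      then show "b * (1 + s) \<le> norm (u \<beta> s)"
        using b(2) by (simp add: algebra_simps)
      show "u \<beta> s \<noteq> 0"
        using far_pos[OF far that(1)] by (auto simp: u_def complex_eq_iff)
    qed
    have cc: "c \<le> \<bar>cc \<beta> w\<bar>" "cc \<beta> w \<noteq> 0" if "\<beta> \<in> P" "w \<in> W" for \<beta> w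
    proof -
      have "w \<beta> \<in> R"
        using reflection_group_root that P_subset by blast
      then show "c \<le> \<bar>cc \<beta> w\<bar>"
        using c(2) by (simp add: cc_def)
      then show "cc \<beta> w \<noteq> 0"
        using c(1) by auto
    qed
    have k_cc: "\<bar>k \<beta> / cc \<beta> w\<bar> \<le> \<kappa> / c" if "\<beta> \<in> P" "w \<in> W" for \<beta> w
      unfolding abs_divide using \<kappa>(2) cc(1) c(1) \<kappa>(1) that by (intro frac_le) auto
    have norm_ph: "norm (ph \<beta> w s) = 1" for \<beta> w s
      by (simp add: ph_def)
    have dK: "((\<lambda>s. K \<rho> w (x + s *\<^sub>R \<xi>)) has_vector_derivative
        (\<Sum>\<beta>\<in>P. A \<beta> w s * K \<rho> (w \<circ> root_reflection \<beta>) (x + s *\<^sub>R \<xi>))) (at s)" if "w \<in> W" for w s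
      unfolding A_def by (rule K_derivative[OF line far_pos[OF far] that])
    have d\<Psi>: "(\<Psi> \<beta> w has_vector_derivative A \<beta> w s + r \<beta> w s) (at s)"
      if that: "\<beta> \<in> P" "w \<in> W" "0 \<le> s" for \<beta> w s
    proof -
      have dph: "(ph \<beta> w has_vector_derivative \<i> * complex_of_real (- cc \<beta> w * (\<beta> \<bullet> \<xi>)) * ph \<beta> w s) (at s)"
        unfolding ph_def[abs_def]
        by (intro has_vector_derivative_cis DERIV_cmult has_vector_derivative_inner_left line)
      have du: "(u \<beta> has_vector_derivative \<i> * complex_of_real (\<beta> \<bullet> \<xi>)) (at s)"
        unfolding u_def[abs_def] by (intro has_vector_derivative_Complex_inner line)
      have "((\<lambda>z. inverse z) has_field_derivative - (inverse (u \<beta> s) ^ Suc (Suc 0))) (at (u \<beta> s))"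
        using u_ge(3)[OF that(1,3)] by (rule DERIV_inverse)
      from field_vector_diff_chain_at[OF du this]
      have dinv: "((\<lambda>s. inverse (u \<beta> s)) has_vector_derivative
          \<i> * complex_of_real (\<beta> \<bullet> \<xi>) * - (inverse (u \<beta> s) ^ Suc (Suc 0))) (at s)"
        by (simp add: o_def)
      have "(\<Psi> \<beta> w has_vector_derivative - complex_of_real (k \<beta> / cc \<beta> w) *
          (ph \<beta> w s * (\<i> * complex_of_real (\<beta> \<bullet> \<xi>) * - (inverse (u \<beta> s) ^ Suc (Suc 0))) +
           \<i> * complex_of_real (- cc \<beta> w * (\<beta> \<bullet> \<xi>)) * ph \<beta> w s * inverse (u \<beta> s))) (at s)"
        unfolding \<Psi>_def[abs_def]
        by (intro has_vector_derivative_mult_right has_vector_derivative_mult dph dinv)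
      moreover have "complex_of_real (k \<beta>) = complex_of_real (k \<beta> / cc \<beta> w) * complex_of_real (cc \<beta> w)"
        using cc(2)[OF that(1,2)] by simp
      then have "A \<beta> w s = complex_of_real (k \<beta> / cc \<beta> w) * complex_of_real (cc \<beta> w) *
          (\<i> * complex_of_real (\<beta> \<bullet> \<xi>) * inverse (u \<beta> s)) * ph \<beta> w s"
        unfolding A_def coeff_def u_def ph_def cc_def divide_inverse by simp
      moreover have "r \<beta> w s = complex_of_real (k \<beta> / cc \<beta> w) * (ph \<beta> w s *
          (\<i> * complex_of_real (\<beta> \<bullet> \<xi>) * (inverse (u \<beta> s) * inverse (u \<beta> s))))"
        unfolding r_def by (simp add: divide_inverse power2_eq_square)
      ultimately show ?thesis
        by (simp del: of_real_divide add: algebra_simps)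
    qed
    have A_le: "norm (A \<beta> w s) \<le> C / (1 + s)" if that: "\<beta> \<in> P" "w \<in> W" "0 \<le> s" for \<beta> w s
    proof -
      have "norm (A \<beta> w s) \<le> \<kappa> * D / (b * (1 + s))"
        unfolding A_def norm_coeff u_def[symmetric]
        using \<kappa> D b that u_ge(1)[OF that(1,3)] by (intro frac_le mult_mono) auto
      also have "\<dots> = \<kappa> * D / b / (1 + s)"
        by simp
      also have "\<dots> \<le> C / (1 + s)"
        using C that by (intro divide_right_mono) auto
      finally show ?thesis .
    qed
    have r_le: "norm (r \<beta> w s) \<le> C / (1 + s)\<^sup>2" if that: "\<beta> \<in> P" "w \<in> W" "0 \<le> s" for \<beta> w s
    proof -
      have "norm (r \<beta> w s) = \<bar>k \<beta> / cc \<beta> w\<bar> * (\<bar>\<beta> \<bullet> \<xi>\<bar> / (norm (u \<beta> s))\<^sup>2)"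
        by (simp add: r_def norm_mult norm_divide norm_power norm_ph)
      also have "\<dots> \<le> \<kappa> / c * (D / (b * (1 + s))\<^sup>2)"
        using k_cc[OF that(1,2)] D that b u_ge(1)[OF that(1,3)] c(1) \<kappa>(1)
        by (intro mult_mono frac_le power_mono) auto
      also have "\<dots> = \<kappa> * D / (c * b\<^sup>2) / (1 + s)\<^sup>2"
        by (simp add: power_mult_distrib)
      also have "\<dots> \<le> C / (1 + s)\<^sup>2"
        using C by (intro divide_right_mono) auto
      finally show ?thesis .
    qed
    have \<Psi>_norm: "norm (\<Psi> \<beta> w s) = \<bar>k \<beta> / cc \<beta> w\<bar> / norm (u \<beta> s)" for \<beta> w s
      by (simp add: \<Psi>_def norm_mult norm_ph norm_inverse divide_inverse abs_mult)
    have \<Psi>_le: "norm (\<Psi> \<beta> w s) \<le> C / (1 + s)" if that: "\<beta> \<in> P" "w \<in> W" "0 \<le> s" for \<beta> w s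
    proof -
      have "norm (\<Psi> \<beta> w s) \<le> \<kappa> / c / (b * (1 + s))"
        unfolding \<Psi>_norm using k_cc[OF that(1,2)] b that u_ge(1)[OF that(1,3)] c(1) \<kappa>(1)
        by (intro frac_le) auto
      also have "\<dots> = \<kappa> / (c * b) / (1 + s)"
        by simp
      also have "\<dots> \<le> C / (1 + s)"
        using C that by (intro divide_right_mono) auto
      finally show ?thesis .
    qed
    \<comment> \<open>\<open>norm (u \<beta> s)\<close> is at least \<beta> . \<rho> for every s,
      including s = 0, so the second clause of \<open>far\<close> gives the smallness on the whole
      ray.\<close>
    have \<Psi>_small: "norm (\<Psi> \<beta> w s) * (2 * real (card P) * real (card W)) \<le> 1"
      if that: "\<beta> \<in> P" "w \<in> W" "0 \<le> s" for \<beta> w s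
    proof -
      have "w \<beta> \<in> R" "0 \<le> k \<beta>"
        using that P_subset reflection_group_root k_nonneg by auto
      then have "k \<beta> * (2 * real (card P) * real (card W)) \<le> \<bar>cc \<beta> w\<bar> * (\<beta> \<bullet> \<rho>)"
        using far that(1) unfolding far_def cc_def by blast
      also have "\<dots> \<le> \<bar>cc \<beta> w\<bar> * norm (u \<beta> s)"
        using u_ge(2)[OF that(1,3)] by (intro mult_left_mono) auto
      finally show ?thesis
        unfolding \<Psi>_norm using cc(2)[OF that(1,2)] u_ge(3)[OF that(1,3)] \<open>0 \<le> k \<beta>\<close>
        by (simp add: abs_divide divide_le_eq mult_ac)
    qed
    have \<tau>: "w \<circ> root_reflection \<beta> \<in> W" if "\<beta> \<in> P" "w \<in> W" for \<beta> w
      using reflection_group_comp that P_subset by blast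
    note bounds = oscillatory_system_bound[where W = W and P = P and \<tau> = "\<lambda>\<beta> w. w \<circ> root_reflection \<beta>"
        and K = "\<lambda>w s. K \<rho> w (x + s *\<^sub>R \<xi>)" and A = A and \<Psi> = \<Psi> and r = r and C = C and S = S,
        OF finite_reflection_group finite_P \<tau> dK d\<Psi> A_le r_le \<Psi>_le \<Psi>_small \<open>0 \<le> S\<close> \<open>0 \<le> C\<close>]
    show "Q \<rho> (x + S *\<^sub>R \<xi>) \<le> E * Q \<rho> x \<and> Q \<rho> x \<le> E * Q \<rho> (x + S *\<^sub>R \<xi>)"
      using bounds unfolding Q_def E_def scaleR_zero_left add_0_right by (rule conjI)
  qed
qed

text \<open>No oscillation is involved: the segment has length at most S, while by compatibility
  every denominator along it is at least S d. The coefficients are thus bounded independently of x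
  and S, and plain Gronwall over unit time suffices.\<close>

lemma Q_shift_far_out:
  assumes far: "far \<rho>" and \<xi>: "\<And>\<beta>. \<beta> \<in> P \<Longrightarrow> \<beta> \<bullet> \<xi> \<noteq> 0"
  obtains C where "\<And>x S. (\<And>\<beta>. \<beta> \<in> P \<Longrightarrow> 0 \<le> (\<beta> \<bullet> x) * sgn (\<beta> \<bullet> \<xi>)) \<Longrightarrow> norm x \<le> S \<Longrightarrow> 0 < S \<Longrightarrow>
    Q \<rho> (x + S *\<^sub>R \<xi>) \<le> C * Q \<rho> (S *\<^sub>R \<xi>)"
proof -
  obtain d where d: "0 < d" "\<And>\<beta>. \<beta> \<in> P \<Longrightarrow> d \<le> \<bar>\<beta> \<bullet> \<xi>\<bar>"
    using finite_lower_bound[OF finite_P, of "\<lambda>\<beta>. \<bar>\<beta> \<bullet> \<xi>\<bar>"] \<xi> by auto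
  obtain D where D: "0 < D" "\<And>\<beta>. \<beta> \<in> P \<Longrightarrow> \<bar>k \<beta>\<bar> * norm \<beta> / d \<le> D"
    using finite_upper_bound[OF finite_P, of "\<lambda>\<beta>. \<bar>k \<beta>\<bar> * norm \<beta> / d"] by blast
  define c where "c = 2 * real (card W) * (real (card P) * D)"
  show ?thesis
  proof (rule that[of "exp c"])
    fix x :: 'a and S :: real assume x: "\<And>\<beta>. \<beta> \<in> P \<Longrightarrow> 0 \<le> (\<beta> \<bullet> x) * sgn (\<beta> \<bullet> \<xi>)" and S: "norm x \<le> S" "0 < S"
    define p where "p t = t *\<^sub>R x + S *\<^sub>R \<xi>" for t
    have line: "(p has_vector_derivative x) (at t)" for t
      unfolding p_def[abs_def] by (auto intro!: derivative_eq_intros)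
    define K' where "K' w t = (\<Sum>\<beta>\<in>P. coeff \<rho> \<beta> w (p t) x * K \<rho> (w \<circ> root_reflection \<beta>) (p t))" for w t
    have dK: "((\<lambda>t. K \<rho> w (p t)) has_vector_derivative K' w t) (at t)" if "w \<in> W" for w t
      unfolding K'_def by (rule K_derivative[OF line far_pos[OF far] that])
    have bound: "2 * real (card W) * norm (K' w t) \<le> c * L2_set (\<lambda>w. norm (K \<rho> w (p t))) W"
      if w: "w \<in> W" and t: "0 \<le> t" for w t
    proof -
      have "norm (K' w t) \<le> (\<Sum>\<beta>\<in>P. norm (coeff \<rho> \<beta> w (p t) x * K \<rho> (w \<circ> root_reflection \<beta>) (p t)))"
        unfolding K'_def by (rule norm_sum)
      also have "\<dots> \<le> (\<Sum>\<beta>\<in>P. D * L2_set (\<lambda>w. norm (K \<rho> w (p t))) W)"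
        unfolding norm_mult
      proof (intro sum_mono mult_mono)
        fix \<beta> assume \<beta>: "\<beta> \<in> P"
        have "0 \<le> (\<beta> \<bullet> (t *\<^sub>R x)) * sgn (\<beta> \<bullet> \<xi>)"
          using x[OF \<beta>] t by (simp add: mult.assoc)
        from abs_inner_compatible[OF this, of S]
        have "S * d \<le> \<bar>\<beta> \<bullet> p t\<bar>"
          using mult_left_mono[OF d(2)[OF \<beta>], of S] S(2) unfolding p_def by linarith
        also have "\<dots> \<le> norm (Complex (\<beta> \<bullet> \<rho>) (\<beta> \<bullet> p t))"
          using abs_Im_le_cmod[of "Complex (\<beta> \<bullet> \<rho>) (\<beta> \<bullet> p t)"] by simp
        finally have u: "S * d \<le> norm (Complex (\<beta> \<bullet> \<rho>) (\<beta> \<bullet> p t))" .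
        have "\<bar>\<beta> \<bullet> x\<bar> \<le> norm \<beta> * S"
          using Cauchy_Schwarz_ineq2[of \<beta> x] mult_left_mono[OF S(1), of "norm \<beta>"] by simp
        then have "norm (coeff \<rho> \<beta> w (p t) x) \<le> \<bar>k \<beta>\<bar> * (norm \<beta> * S) / (S * d)"
          unfolding norm_coeff using u d(1) S(2) by (intro frac_le mult_left_mono) auto
        also have "\<dots> \<le> D"
          using D(2)[OF \<beta>] S(2) by simp
        finally show "norm (coeff \<rho> \<beta> w (p t) x) \<le> D" .
        show "norm (K \<rho> (w \<circ> root_reflection \<beta>) (p t)) \<le> L2_set (\<lambda>w. norm (K \<rho> w (p t))) W"
          using member_le_L2_set[OF finite_reflection_group reflection_group_comp[OF w], of \<beta> "\<lambda>w. norm (K \<rho> w (p t))"]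
            \<beta> P_subset by auto
      qed (use D in auto)
      also have "\<dots> = real (card P) * D * L2_set (\<lambda>w. norm (K \<rho> w (p t))) W"
        by simp
      finally have "2 * real (card W) * norm (K' w t) \<le>
          2 * real (card W) * (real (card P) * D * L2_set (\<lambda>w. norm (K \<rho> w (p t))) W)"
        by (intro mult_left_mono) auto
      then show ?thesis
        by (simp add: c_def mult_ac)
    qed
    have da: "((\<lambda>t. c * t) has_real_derivative c) (at t)" for t
      by (auto intro!: derivative_eq_intros)
    have "(\<Sum>w\<in>W. (norm (K \<rho> w (p 1)))\<^sup>2) \<le> exp (c * 1 - c * 0) * (\<Sum>w\<in>W. (norm (K \<rho> w (p 0)))\<^sup>2)"
      by (rule sum_norm_power2_gronwall(1)[OF finite_reflection_group dK da bound]) simp_all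
    then show "Q \<rho> (x + S *\<^sub>R \<xi>) \<le> exp c * Q \<rho> (S *\<^sub>R \<xi>)"
      by (simp add: Q_def p_def)
  qed
qed

text \<open>To reach \<open>x\<close> from \<open>0\<close> with uniform constants, leave the walls first: go from \<open>0\<close> to \<open>S \<xi>\<close> for a
  regular \<open>\<xi>\<close> compatible with \<open>x\<close> and \<open>S > norm x\<close>, then to \<open>x + S \<xi>\<close>, and back to \<open>x\<close>.\<close>

lemma Q_bounded:
  assumes far: "far \<rho>"
  obtains C where "\<And>x. Q \<rho> x \<le> C"
proof -
  have far_nz: "\<beta> \<bullet> \<rho> \<noteq> 0" if "\<beta> \<in> P" for \<beta>
    using far_pos[OF far that] by simp
  obtain \<Xi> where \<Xi>: "finite \<Xi>" "\<And>\<xi> \<alpha>. \<xi> \<in> \<Xi> \<Longrightarrow> \<alpha> \<in> P \<Longrightarrow> \<alpha> \<bullet> \<xi> \<noteq> 0"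
    "\<And>x. \<exists>\<xi>\<in>\<Xi>. \<forall>\<alpha>\<in>P. 0 \<le> (\<alpha> \<bullet> x) * sgn (\<alpha> \<bullet> \<xi>)"
    using finite_compatible_regular[OF far_nz] by blast
  have "\<exists>C. \<forall>x. (\<forall>\<beta>\<in>P. 0 \<le> (\<beta> \<bullet> x) * sgn (\<beta> \<bullet> \<xi>)) \<longrightarrow> Q \<rho> x \<le> C" if in_Xi: "\<xi> \<in> \<Xi>" for \<xi>
  proof -
    obtain C where C: "\<And>x S. (\<And>\<beta>. \<beta> \<in> P \<Longrightarrow> 0 \<le> (\<beta> \<bullet> x) * sgn (\<beta> \<bullet> \<xi>)) \<Longrightarrow> 0 \<le> S \<Longrightarrow>
        Q \<rho> (x + S *\<^sub>R \<xi>) \<le> C * Q \<rho> x \<and> Q \<rho> x \<le> C * Q \<rho> (x + S *\<^sub>R \<xi>)"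
      using Q_along_regular_direction[OF far, of \<xi>] \<Xi>(2)[OF in_Xi] by blast
    obtain C' where C': "\<And>x S. (\<And>\<beta>. \<beta> \<in> P \<Longrightarrow> 0 \<le> (\<beta> \<bullet> x) * sgn (\<beta> \<bullet> \<xi>)) \<Longrightarrow> norm x \<le> S \<Longrightarrow> 0 < S \<Longrightarrow>
        Q \<rho> (x + S *\<^sub>R \<xi>) \<le> C' * Q \<rho> (S *\<^sub>R \<xi>)"
      using Q_shift_far_out[OF far, of \<xi>] \<Xi>(2)[OF in_Xi] by blast
    have "Q \<rho> x \<le> \<bar>C\<bar> * (\<bar>C'\<bar> * (\<bar>C\<bar> * Q \<rho> 0))" if x: "\<forall>\<beta>\<in>P. 0 \<le> (\<beta> \<bullet> x) * sgn (\<beta> \<bullet> \<xi>)" for x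
    proof -
      let ?S = "1 + norm x"
      have S: "0 \<le> ?S" "0 < ?S"
        by (simp_all add: add_pos_nonneg)
      \<comment> \<open>The constants obtained above carry no sign information, so they are replaced
        by their absolute values before the three estimates are chained.\<close>
      have up: "a * q \<le> \<bar>a\<bar> * q'" if "q \<le> q'" "0 \<le> q" for a q q' :: real
        using that by (meson abs_ge_self abs_ge_zero mult_mono)
      have "Q \<rho> (0 + ?S *\<^sub>R \<xi>) \<le> C * Q \<rho> 0"
        using C[of 0 ?S] S by simp
      then have 1: "Q \<rho> (?S *\<^sub>R \<xi>) \<le> \<bar>C\<bar> * Q \<rho> 0"
        using up[of "Q \<rho> 0" "Q \<rho> 0" C] Q_nonneg[of \<rho> 0] by simp
      have 2: "Q \<rho> (x + ?S *\<^sub>R \<xi>) \<le> \<bar>C'\<bar> * (\<bar>C\<bar> * Q \<rho> 0)"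
        using C'[of x ?S] x S up[OF 1 Q_nonneg, of C'] by auto
      have "Q \<rho> x \<le> C * Q \<rho> (x + ?S *\<^sub>R \<xi>)"
        using C[of x ?S] x S by auto
      then show ?thesis
        using up[OF 2 Q_nonneg, of C] by linarith
    qed
    then show ?thesis by blast
  qed
  then obtain C where C: "\<And>\<xi> x. \<xi> \<in> \<Xi> \<Longrightarrow> (\<forall>\<beta>\<in>P. 0 \<le> (\<beta> \<bullet> x) * sgn (\<beta> \<bullet> \<xi>)) \<Longrightarrow> Q \<rho> x \<le> C \<xi>"
    by metis
  obtain D where D: "\<And>\<xi>. \<xi> \<in> \<Xi> \<Longrightarrow> C \<xi> \<le> D"
    using finite_upper_bound[OF \<Xi>(1), of C] by blast
  show ?thesis
  proof (rule that)
    fix x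
    from \<Xi>(3)[of x] obtain \<xi> where "\<xi> \<in> \<Xi>" "\<forall>\<alpha>\<in>P. 0 \<le> (\<alpha> \<bullet> x) * sgn (\<alpha> \<bullet> \<xi>)"
      by blast
    then show "Q \<rho> x \<le> D"
      using C[of \<xi> x] D[of \<xi>] by linarith
  qed
qed

section \<open>From the orbit bound to the decay of the kernel\<close>

lemma norm_weight:
  assumes "\<And>\<beta>. \<beta> \<in> P \<Longrightarrow> 0 < \<beta> \<bullet> \<rho>"
  shows "norm (weight \<rho> x) = (\<Prod>\<beta>\<in>P. norm (Complex (\<beta> \<bullet> \<rho>) (\<beta> \<bullet> x)) powr k \<beta>)"
proof -
  have nz: "Complex (\<beta> \<bullet> \<rho>) (\<beta> \<bullet> x) \<noteq> 0" if "\<beta> \<in> P" for \<beta>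
    using assms[OF that] by (auto simp: complex_eq_iff)
  have "norm (weight \<rho> x) = exp (\<Sum>\<beta>\<in>P. k \<beta> * ln (norm (Complex (\<beta> \<bullet> \<rho>) (\<beta> \<bullet> x))))"
    using nz by (simp add: weight_def Re_Ln)
  also have "\<dots> = (\<Prod>\<beta>\<in>P. norm (Complex (\<beta> \<bullet> \<rho>) (\<beta> \<bullet> x)) powr k \<beta>)"
    unfolding exp_sum[OF finite_P] using nz by (intro prod.cong) (auto simp: powr_def)
  finally show ?thesis .
qed

text \<open>Take the component \<open>w = id\<close> of the orbit vector, whose phase has modulus 1,
  and divide by the weight. The factors \<open>2 powr k \<beta>\<close> come from 1 + |t| \<le> 2 |a
  + \<i> t| for a \<ge> 1, applied with a = \<beta> . \<rho>.\<close>

theorem dunkl_kernel_decay: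
  obtains \<rho> C where "0 \<le> C"
    "\<And>x. norm (F (\<rho>, x)) \<le> C * (\<Prod>\<beta>\<in>P. (1 + \<bar>\<beta> \<bullet> x\<bar>) powr (- k \<beta>))"
proof -
  obtain \<rho> where far: "far \<rho>"
    using exists_far by blast
  obtain C where C: "\<And>x. Q \<rho> x \<le> C"
    using Q_bounded[OF far] by blast
  have bound: "norm (F (\<rho>, x)) \<le> sqrt C * (\<Prod>\<beta>\<in>P. 2 powr k \<beta>) * (\<Prod>\<beta>\<in>P. (1 + \<bar>\<beta> \<bullet> x\<bar>) powr (- k \<beta>))" for x
  proof -
    have "(norm (K \<rho> id x))\<^sup>2 \<le> Q \<rho> x"
      unfolding Q_def using reflection_group.one[of R] by (intro member_le_sum finite_reflection_group zero_le_power2)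
    then have "(norm (K \<rho> id x))\<^sup>2 \<le> C"
      using C order_trans by blast
    then have "norm (K \<rho> id x) \<le> sqrt C"
      by (rule real_le_rsqrt)
    then have Fw: "norm (F (\<rho>, x)) * norm (weight \<rho> x) \<le> sqrt C"
      by (simp add: K_def norm_mult)
    have "(\<Prod>\<beta>\<in>P. (1 + \<bar>\<beta> \<bullet> x\<bar>) powr k \<beta>) \<le> (\<Prod>\<beta>\<in>P. 2 powr k \<beta> * norm (Complex (\<beta> \<bullet> \<rho>) (\<beta> \<bullet> x)) powr k \<beta>)"
    proof (intro prod_mono conjI)
      fix \<beta> assume \<beta>: "\<beta> \<in> P"
      have "1 + \<bar>\<beta> \<bullet> x\<bar> \<le> 2 * norm (Complex (\<beta> \<bullet> \<rho>) (\<beta> \<bullet> x))"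
        using abs_Im_le_cmod[of "Complex (\<beta> \<bullet> \<rho>) (\<beta> \<bullet> x)"] complex_Re_le_cmod[of "Complex (\<beta> \<bullet> \<rho>) (\<beta> \<bullet> x)"]
          far \<beta> by (force simp: far_def)
      then have "(1 + \<bar>\<beta> \<bullet> x\<bar>) powr k \<beta> \<le> (2 * norm (Complex (\<beta> \<bullet> \<rho>) (\<beta> \<bullet> x))) powr k \<beta>"
        using k_nonneg \<beta> P_subset by (intro powr_mono2) auto
      then show "(1 + \<bar>\<beta> \<bullet> x\<bar>) powr k \<beta> \<le> 2 powr k \<beta> * norm (Complex (\<beta> \<bullet> \<rho>) (\<beta> \<bullet> x)) powr k \<beta>"
        by (simp add: powr_mult)
    qed simp
    then have w: "(\<Prod>\<beta>\<in>P. (1 + \<bar>\<beta> \<bullet> x\<bar>) powr k \<beta>) \<le> (\<Prod>\<beta>\<in>P. 2 powr k \<beta>) * norm (weight \<rho> x)"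
      using norm_weight[OF far_pos[OF far]] by (simp add: prod.distrib)
    have pos: "(\<Prod>\<beta>\<in>P. (1 + \<bar>\<beta> \<bullet> x\<bar>) powr k \<beta>) > 0"
      by (intro prod_pos) (auto simp: add_pos_nonneg)
    have "norm (F (\<rho>, x)) * (\<Prod>\<beta>\<in>P. (1 + \<bar>\<beta> \<bullet> x\<bar>) powr k \<beta>)
        \<le> norm (F (\<rho>, x)) * ((\<Prod>\<beta>\<in>P. 2 powr k \<beta>) * norm (weight \<rho> x))"
      by (intro mult_left_mono w) simp
    also have "\<dots> \<le> (\<Prod>\<beta>\<in>P. 2 powr k \<beta>) * sqrt C"
      using mult_left_mono[OF Fw, of "\<Prod>\<beta>\<in>P. 2 powr k \<beta>"] by (simp add: prod_nonneg mult_ac)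
    finally have "norm (F (\<rho>, x)) \<le> (\<Prod>\<beta>\<in>P. 2 powr k \<beta>) * sqrt C / (\<Prod>\<beta>\<in>P. (1 + \<bar>\<beta> \<bullet> x\<bar>) powr k \<beta>)"
      using pos by (simp add: pos_le_divide_eq)
    then show ?thesis
      by (simp add: powr_minus prod_inversef[symmetric] o_def divide_inverse mult_ac)
  qed
  have "0 \<le> C"
    using C[of 0] Q_nonneg[of \<rho> 0] by linarith
  then have "0 \<le> sqrt C * (\<Prod>\<beta>\<in>P. 2 powr k \<beta>)"
    by (simp add: prod_nonneg)
  then show ?thesis
    using bound by (rule that)
qed

end

section \<open>Integrability of products of powers of linear forms\<close>

lemma nn_integral_one_plus_abs_powr_finite:
  assumes "1 < p"
  shows "(\<integral>\<^sup>+t. ennreal ((1 + \<bar>t\<bar>) powr (- p)) \<partial>lborel) < \<infinity>"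
proof -
  let ?f = "\<lambda>t::real. (1 + \<bar>t\<bar>) powr (- p)"
  define c where "c = p - 1"
  have "0 < c"
    using assms by (simp add: c_def)
  have half: "(\<integral>\<^sup>+t. ennreal (?f t) * indicator {0..} t \<partial>lborel) = ennreal (0 - (- ((1 + 0) powr (- c)) / c))"
  proof (rule nn_integral_FTC_atLeast)
    fix t :: real assume "0 \<le> t"
    then have "((\<lambda>t. - ((1 + t) powr (- c)) / c) has_real_derivative (1 + t) powr (- c - 1)) (at t)"
      using \<open>0 < c\<close> by (auto intro!: derivative_eq_intros)
    then show "((\<lambda>t. - ((1 + t) powr (- c)) / c) has_real_derivative ?f t) (at t)"
      using \<open>0 \<le> t\<close> by (simp add: c_def)
  next
    have "((\<lambda>t. (1 + t) powr (- c)) \<longlongrightarrow> 0) at_top"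
      using \<open>0 < c\<close> by (intro tendsto_neg_powr filterlim_tendsto_add_at_top[OF tendsto_const filterlim_ident]) auto
    from tendsto_divide[OF tendsto_minus[OF this] tendsto_const[of c]]
    show "((\<lambda>t. - ((1 + t) powr (- c)) / c) \<longlongrightarrow> 0) at_top"
      using \<open>0 < c\<close> by simp
  qed auto
  have "(\<integral>\<^sup>+t. ennreal (?f t) * indicator {..0} t \<partial>lborel) = (\<integral>\<^sup>+t. ennreal (?f t) * indicator {0..} t \<partial>lborel)"
    by (subst nn_integral_real_affine[where c = "-1" and t = 0])
       (auto intro!: nn_integral_cong simp: indicator_def)
  moreover have "(\<integral>\<^sup>+t. ennreal (?f t) \<partial>lborel) \<le>
      (\<integral>\<^sup>+t. ennreal (?f t) * indicator {0..} t + ennreal (?f t) * indicator {..0} t \<partial>lborel)"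
    by (intro nn_integral_mono) (auto simp: indicator_def)
  moreover have "\<dots> = (\<integral>\<^sup>+t. ennreal (?f t) * indicator {0..} t \<partial>lborel) + (\<integral>\<^sup>+t. ennreal (?f t) * indicator {..0} t \<partial>lborel)"
    by (rule nn_integral_add) auto
  ultimately have "(\<integral>\<^sup>+t. ennreal (?f t) \<partial>lborel) \<le> ennreal (1 / c) + ennreal (1 / c)"
    unfolding half by simp
  also have "\<dots> < \<infinity>"
    by (simp add: less_top[symmetric])
  finally show ?thesis .
qed

text \<open>The vectors \<open>v \<gamma>\<close> represent the coordinate functionals of the basis,
  through \<open>adjoint\<close>. The expansion of x holds because the error is orthogonal to the
  spanning set \<open>B\<close>.\<close>

lemma dual_basis:
  fixes B :: "'a::euclidean_space set"
  assumes "independent B" "span B = UNIV"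
  obtains v where "\<And>\<beta> \<gamma>. \<beta> \<in> B \<Longrightarrow> \<gamma> \<in> B \<Longrightarrow> \<beta> \<bullet> v \<gamma> = (if \<beta> = \<gamma> then 1 else 0)"
    "\<And>x. (\<Sum>\<beta>\<in>B. (\<beta> \<bullet> x) *\<^sub>R v \<beta>) = x"
proof -
  have "finite B"
    using assms(1) by (rule independent_imp_finite)
  have "\<exists>u. \<forall>\<beta>\<in>B. \<beta> \<bullet> u = (if \<beta> = \<gamma> then 1 else 0)" for \<gamma>
  proof -
    obtain f :: "'a \<Rightarrow> real" where f: "linear f" "\<forall>\<beta>\<in>B. f \<beta> = (if \<beta> = \<gamma> then 1 else 0)"
      using linear_independent_extend[OF assms(1), of "\<lambda>\<beta>. if \<beta> = \<gamma> then 1 else 0 :: real"] by auto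
    have "f x = x \<bullet> adjoint f 1" for x
      using adjoint_works[OF f(1), of x 1] by simp
    then show ?thesis
      using f(2) by (intro exI[of _ "adjoint f 1"]) simp
  qed
  then have "\<exists>v. \<forall>\<gamma>. \<forall>\<beta>\<in>B. \<beta> \<bullet> v \<gamma> = (if \<beta> = \<gamma> then 1 else 0)"
    by (intro choice allI)
  then obtain v where v: "\<And>\<beta> \<gamma>. \<beta> \<in> B \<Longrightarrow> \<beta> \<bullet> v \<gamma> = (if \<beta> = \<gamma> then 1 else 0)"
    by blast
  have "(\<Sum>\<beta>\<in>B. (\<beta> \<bullet> x) *\<^sub>R v \<beta>) = x" for x
  proof -
    let ?z = "(\<Sum>\<beta>\<in>B. (\<beta> \<bullet> x) *\<^sub>R v \<beta>) - x"
    have "orthogonal ?z \<gamma>" if "\<gamma> \<in> B" for \<gamma>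
    proof -
      have "(\<Sum>\<beta>\<in>B. (\<beta> \<bullet> x) * (\<gamma> \<bullet> v \<beta>)) = (\<Sum>\<beta>\<in>B. if \<gamma> = \<beta> then \<gamma> \<bullet> x else 0)"
        using v[OF that] by (intro sum.cong) auto
      then show ?thesis
        using that \<open>finite B\<close>
        by (simp add: orthogonal_def inner_commute[of _ \<gamma>] inner_diff_right inner_sum_right)
    qed
    then have "orthogonal ?z ?z"
      using orthogonal_to_span[of ?z B ?z] assms(2) by auto
    then show ?thesis
      by (simp add: orthogonal_self)
  qed
  then show ?thesis
    using v by (intro that)
qed

lemma nn_integral_PiM_lborel_prod:
  fixes h :: "'i \<Rightarrow> real \<Rightarrow> ennreal"
  assumes "finite B" "\<And>i. i \<in> B \<Longrightarrow> h i \<in> borel_measurable borel"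
  shows "(\<integral>\<^sup>+t. (\<Prod>i\<in>B. h i (t i)) \<partial>(PiM B (\<lambda>_. lborel))) = (\<Prod>i\<in>B. \<integral>\<^sup>+s. h i s \<partial>lborel)"
proof -
  interpret product_sigma_finite "\<lambda>_::'i. lborel :: real measure" ..
  show ?thesis
    using assms by (intro product_nn_integral_prod) auto
qed

lemma nn_integral_lborel_translate:
  fixes a :: "'a::euclidean_space"
  assumes [measurable]: "H \<in> borel_measurable borel"
  shows "(\<integral>\<^sup>+x. H x \<partial>lborel) = (\<integral>\<^sup>+x. H (a + x) \<partial>lborel)"
  by (subst lborel_distr_plus[of a, symmetric]) (simp add: nn_integral_distr)

text \<open>Averaging over the translates \<open>\<Sum>\<beta> t\<^sub>\<beta> v\<^sub>\<beta>\<close> of the fundamental parallelepiped of the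
  dual basis replaces the linear change of variables \<open>x \<mapsto> (\<beta> \<bullet> x)\<^sub>\<beta>\<close>.\<close>

lemma nn_integral_prod_independent_finite:
  fixes B :: "'a::euclidean_space set" and g :: "'a \<Rightarrow> real \<Rightarrow> ennreal"
  assumes "independent B" "span B = UNIV"
    and g: "\<And>\<beta>. \<beta> \<in> B \<Longrightarrow> g \<beta> \<in> borel_measurable borel"
    and finite_g: "\<And>\<beta>. \<beta> \<in> B \<Longrightarrow> (\<integral>\<^sup>+t. g \<beta> t \<partial>lborel) < \<infinity>"
  shows "(\<integral>\<^sup>+x. (\<Prod>\<beta>\<in>B. g \<beta> (\<beta> \<bullet> x)) \<partial>lborel) < \<infinity>"
proof -
  have "finite B"
    using assms(1) by (rule independent_imp_finite)
  obtain v where v: "\<And>\<beta> \<gamma>. \<beta> \<in> B \<Longrightarrow> \<gamma> \<in> B \<Longrightarrow> \<beta> \<bullet> v \<gamma> = (if \<beta> = \<gamma> then 1 else 0)"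
    "\<And>x. (\<Sum>\<beta>\<in>B. (\<beta> \<bullet> x) *\<^sub>R v \<beta>) = x"
    using dual_basis[OF assms(1,2)] by blast
  define T where "T t = (\<Sum>\<beta>\<in>B. t \<beta> *\<^sub>R v \<beta>)" for t :: "'a \<Rightarrow> real"
  have inner_T: "\<beta> \<bullet> T t = t \<beta>" if "\<beta> \<in> B" for \<beta> t
  proof -
    have "\<beta> \<bullet> T t = (\<Sum>\<gamma>\<in>B. if \<beta> = \<gamma> then t \<gamma> else 0)"
      unfolding T_def inner_sum_right using v(1)[OF that] by (intro sum.cong) auto
    then show ?thesis
      using that \<open>finite B\<close> by simp
  qed
  let ?M = "PiM B (\<lambda>_. lborel :: real measure)"
  interpret product_sigma_finite "\<lambda>_::'a. lborel :: real measure" ..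
  interpret finite_product_sigma_finite "\<lambda>_::'a. lborel :: real measure" B
    by standard (fact \<open>finite B\<close>)
  interpret pair_sigma_finite ?M "lborel :: 'a measure" ..
  have [measurable]: "T \<in> borel_measurable ?M"
    unfolding T_def by measurable
  have [measurable]: "(\<lambda>x. g \<beta> (\<beta> \<bullet> x)) \<in> borel_measurable borel" if "\<beta> \<in> B" for \<beta>
    using measurable_compose[OF _ g[OF that]] by measurable
  define G where "G x = (\<Prod>\<beta>\<in>B. g \<beta> (\<beta> \<bullet> x))" for x
  have [measurable]: "G \<in> borel_measurable borel"
    unfolding G_def by measurable
  \<comment> \<open>The indicator of the half-open fundamental parallelepiped. In each coordinate
    the admissible \<open>t \<beta>\<close> form an interval of length 1, so averaging over all
    \<open>t\<close> gives exactly 1.\<close>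
  define A where "A x = (\<Prod>\<beta>\<in>B. indicator {0..<1} (\<beta> \<bullet> x) :: ennreal)" for x
  have [measurable]: "A \<in> borel_measurable borel"
    unfolding A_def by measurable
  have A_eq: "A x = indicator {x. \<forall>\<beta>\<in>B. 0 \<le> \<beta> \<bullet> x \<and> \<beta> \<bullet> x < 1} x" for x
    using \<open>finite B\<close> by (auto simp: A_def indicator_def)
  have average: "(\<integral>\<^sup>+t. A (x - T t) \<partial>?M) = 1" for x
  proof -
    have "(\<integral>\<^sup>+t. A (x - T t) \<partial>?M) = (\<integral>\<^sup>+t. (\<Prod>\<beta>\<in>B. indicator {\<beta> \<bullet> x - 1 <.. \<beta> \<bullet> x} (t \<beta>)) \<partial>?M)"
      unfolding A_def by (intro nn_integral_cong prod.cong) (auto simp: inner_diff_right inner_T indicator_def)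
    also have "\<dots> = (\<Prod>\<beta>\<in>B. \<integral>\<^sup>+s. indicator {\<beta> \<bullet> x - 1 <.. \<beta> \<bullet> x} s \<partial>lborel)"
      using \<open>finite B\<close> by (intro nn_integral_PiM_lborel_prod) auto
    also have "\<dots> = 1"
      by simp
    finally show ?thesis .
  qed
  \<comment> \<open>Insert this average as a factor 1, exchange the integrals and translate x by
    \<open>T t\<close>. Now \<open>t \<beta>\<close> occurs only in the factor of \<beta>, so the
    inner integral splits into one-dimensional ones that are independent of x, and x itself is
    confined to a bounded set.\<close>
  have "(\<integral>\<^sup>+x. G x \<partial>lborel) = (\<integral>\<^sup>+x. \<integral>\<^sup>+t. G x * A (x - T t) \<partial>?M \<partial>lborel)"
    by (subst nn_integral_cmult) (simp_all add: average)
  also have "\<dots> = (\<integral>\<^sup>+t. \<integral>\<^sup>+x. G x * A (x - T t) \<partial>lborel \<partial>?M)"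
    by (rule Fubini') measurable
  also have "\<dots> = (\<integral>\<^sup>+t. \<integral>\<^sup>+x. G (T t + x) * A x \<partial>lborel \<partial>?M)"
  proof (rule nn_integral_cong)
    fix t
    show "(\<integral>\<^sup>+x. G x * A (x - T t) \<partial>lborel) = (\<integral>\<^sup>+x. G (T t + x) * A x \<partial>lborel)"
      using nn_integral_lborel_translate[of "\<lambda>x. G x * A (x - T t)" "T t"] by simp
  qed
  also have "\<dots> = (\<integral>\<^sup>+x. \<integral>\<^sup>+t. G (T t + x) * A x \<partial>?M \<partial>lborel)"
    by (rule Fubini'[symmetric]) measurable
  also have "\<dots> = (\<integral>\<^sup>+x. (\<Prod>\<beta>\<in>B. \<integral>\<^sup>+s. g \<beta> s \<partial>lborel) * A x \<partial>lborel)"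
  proof (rule nn_integral_cong)
    fix x
    have "(\<integral>\<^sup>+t. G (T t + x) * A x \<partial>?M) = (\<integral>\<^sup>+t. G (T t + x) \<partial>?M) * A x"
      by (rule nn_integral_multc) measurable
    also have "(\<integral>\<^sup>+t. G (T t + x) \<partial>?M) = (\<integral>\<^sup>+t. (\<Prod>\<beta>\<in>B. g \<beta> (\<beta> \<bullet> x + t \<beta>)) \<partial>?M)"
      unfolding G_def by (intro nn_integral_cong prod.cong) (auto simp: inner_add_right inner_T add.commute)
    also have "\<dots> = (\<Prod>\<beta>\<in>B. \<integral>\<^sup>+s. g \<beta> (\<beta> \<bullet> x + s) \<partial>lborel)"
      using \<open>finite B\<close> by (intro nn_integral_PiM_lborel_prod measurable_compose[OF _ g]) auto
    also have "\<dots> = (\<Prod>\<beta>\<in>B. \<integral>\<^sup>+s. g \<beta> s \<partial>lborel)"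
      using g by (intro prod.cong nn_integral_lborel_translate[symmetric]) auto
    finally show "(\<integral>\<^sup>+t. G (T t + x) * A x \<partial>?M) = (\<Prod>\<beta>\<in>B. \<integral>\<^sup>+s. g \<beta> s \<partial>lborel) * A x" .
  qed
  also have "\<dots> = (\<Prod>\<beta>\<in>B. \<integral>\<^sup>+s. g \<beta> s \<partial>lborel) * (\<integral>\<^sup>+x. A x \<partial>lborel)"
    by (rule nn_integral_cmult) measurable
  also have "\<dots> < \<infinity>"
  proof -
    let ?S = "{x. \<forall>\<beta>\<in>B. 0 \<le> \<beta> \<bullet> x \<and> \<beta> \<bullet> x < 1}"
    have "norm x \<le> (\<Sum>\<beta>\<in>B. norm (v \<beta>))" if "x \<in> ?S" for x
    proof -
      have "norm (\<Sum>\<beta>\<in>B. (\<beta> \<bullet> x) *\<^sub>R v \<beta>) \<le> (\<Sum>\<beta>\<in>B. norm (v \<beta>))"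
        using that by (intro sum_norm_le) (auto intro!: mult_left_le_one_le)
      then show ?thesis
        by (simp add: v(2))
    qed
    then have "bounded ?S"
      unfolding bounded_iff by blast
    then have "emeasure lborel ?S < \<infinity>"
      by (rule emeasure_bounded_finite)
    moreover have "?S \<in> sets borel"
      using \<open>finite B\<close> by measurable
    ultimately have "(\<integral>\<^sup>+x. A x \<partial>lborel) < \<infinity>"
      unfolding A_eq by simp
    moreover have "(\<Prod>\<beta>\<in>B. \<integral>\<^sup>+s. g \<beta> s \<partial>lborel) \<noteq> \<top>"
      using finite_g by (subst ennreal_prod_eq_top) (auto simp: less_top)
    ultimately show ?thesis
      by (auto simp: ennreal_mult_eq_top_iff less_top[symmetric])
  qed
  finally show ?thesis
    unfolding G_def .
qed

text \<open>Roots outside the chosen basis contribute factors at most 1. On the basis, 1 + norm x is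
  at most a constant times the product of the 1 + |\<beta> . x|, so the polynomial weight costs
  \<open>l\<close> in every exponent, and \<open>k \<beta> - l > 1\<close> makes each
  one-dimensional integral converge.\<close>

lemma integrable_of_product_decay:
  fixes \<phi> :: "'a::euclidean_space \<Rightarrow> complex"
  assumes "finite P" "span P = UNIV"
    and k: "\<And>\<beta>. \<beta> \<in> P \<Longrightarrow> real l + 1 < k \<beta>"
    and [measurable]: "\<phi> \<in> borel_measurable borel"
    and decay: "\<And>x. norm (\<phi> x) \<le> C * (\<Prod>\<beta>\<in>P. (1 + \<bar>\<beta> \<bullet> x\<bar>) powr (- k \<beta>))"
    and "0 \<le> C"
  shows "integrable lborel (\<lambda>x. (1 + norm x) ^ l *\<^sub>R \<phi> x)"
proof -
  obtain B where B: "B \<subseteq> P" "independent B" "P \<subseteq> span B"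
    using maximal_independent_subset[of P] by blast
  then have span_B: "span B = UNIV"
    using span_minimal[OF B(3) subspace_span] assms(2) by auto
  have "finite B"
    using B(1) \<open>finite P\<close> by (rule finite_subset)
  obtain v where v: "\<And>x. (\<Sum>\<beta>\<in>B. (\<beta> \<bullet> x) *\<^sub>R v \<beta>) = x"
    by (rule dual_basis[OF B(2) span_B]) (rule that)
  define V where "V = 1 + (\<Sum>\<beta>\<in>B. norm (v \<beta>))"
  have "1 \<le> V"
    by (simp add: V_def sum_nonneg)
  have norm_le: "1 + norm x \<le> V * (\<Prod>\<beta>\<in>B. 1 + \<bar>\<beta> \<bullet> x\<bar>)" for x
  proof -
    let ?\<Pi> = "\<Prod>\<beta>\<in>B. 1 + \<bar>\<beta> \<bullet> x\<bar>"
    have factor: "\<bar>\<beta> \<bullet> x\<bar> \<le> ?\<Pi>" if "\<beta> \<in> B" for \<beta>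
    proof -
      have "\<bar>\<beta> \<bullet> x\<bar> * 1 \<le> (1 + \<bar>\<beta> \<bullet> x\<bar>) * (\<Prod>\<beta>\<in>B - {\<beta>}. 1 + \<bar>\<beta> \<bullet> x\<bar>)"
        by (intro mult_mono prod_ge_1) auto
      then show ?thesis
        using prod.remove[OF \<open>finite B\<close> that, of "\<lambda>\<beta>. 1 + \<bar>\<beta> \<bullet> x\<bar>"] by simp
    qed
    have "norm x = norm (\<Sum>\<beta>\<in>B. (\<beta> \<bullet> x) *\<^sub>R v \<beta>)"
      by (simp add: v)
    also have "\<dots> \<le> (\<Sum>\<beta>\<in>B. norm (v \<beta>) * ?\<Pi>)"
      using factor by (intro sum_norm_le) (simp add: mult.commute mult_left_mono)
    also have "\<dots> = (V - 1) * ?\<Pi>"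
      by (simp add: V_def sum_distrib_right)
    finally have "norm x \<le> (V - 1) * ?\<Pi>" .
    moreover have "1 \<le> ?\<Pi>"
      by (intro prod_ge_1) auto
    ultimately show ?thesis
      by (simp add: algebra_simps)
  qed
  let ?G = "\<lambda>x. \<Prod>\<beta>\<in>B. (1 + \<bar>\<beta> \<bullet> x\<bar>) powr (- (k \<beta> - real l))"
  have bound: "norm ((1 + norm x) ^ l *\<^sub>R \<phi> x) \<le> V ^ l * C * ?G x" for x
  proof -
    have "(\<Prod>\<beta>\<in>P. (1 + \<bar>\<beta> \<bullet> x\<bar>) powr (- k \<beta>)) =
        (\<Prod>\<beta>\<in>P - B. (1 + \<bar>\<beta> \<bullet> x\<bar>) powr (- k \<beta>)) * (\<Prod>\<beta>\<in>B. (1 + \<bar>\<beta> \<bullet> x\<bar>) powr (- k \<beta>))"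
      using B \<open>finite P\<close> by (intro prod.subset_diff)
    also have "\<dots> \<le> 1 * (\<Prod>\<beta>\<in>B. (1 + \<bar>\<beta> \<bullet> x\<bar>) powr (- k \<beta>))"
    proof (intro mult_right_mono prod_le_1 prod_nonneg conjI)
      fix \<beta> assume "\<beta> \<in> P - B"
      then have "(1 + \<bar>\<beta> \<bullet> x\<bar>) powr (- k \<beta>) \<le> (1 + \<bar>\<beta> \<bullet> x\<bar>) powr 0"
        using k[of \<beta>] by (intro powr_mono) auto
      then show "(1 + \<bar>\<beta> \<bullet> x\<bar>) powr (- k \<beta>) \<le> 1"
        by (simp add: add_nonneg_eq_0_iff)
    qed auto
    finally have "norm (\<phi> x) \<le> C * (\<Prod>\<beta>\<in>B. (1 + \<bar>\<beta> \<bullet> x\<bar>) powr (- k \<beta>))"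
      using \<open>0 \<le> C\<close> by (intro order_trans[OF decay[of x]] mult_left_mono) auto
    moreover have "(1 + norm x) ^ l \<le> (V * (\<Prod>\<beta>\<in>B. 1 + \<bar>\<beta> \<bullet> x\<bar>)) ^ l"
      by (intro power_mono norm_le) auto
    ultimately have "norm ((1 + norm x) ^ l *\<^sub>R \<phi> x) \<le>
        (V * (\<Prod>\<beta>\<in>B. 1 + \<bar>\<beta> \<bullet> x\<bar>)) ^ l * (C * (\<Prod>\<beta>\<in>B. (1 + \<bar>\<beta> \<bullet> x\<bar>) powr (- k \<beta>)))"
      unfolding norm_scaleR using \<open>1 \<le> V\<close>
      by (intro mult_mono) (auto simp: prod_nonneg add_nonneg_nonneg)
    also have "\<dots> = V ^ l * C * (\<Prod>\<beta>\<in>B. (1 + \<bar>\<beta> \<bullet> x\<bar>) ^ l * (1 + \<bar>\<beta> \<bullet> x\<bar>) powr (- k \<beta>))"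
      by (simp add: power_mult_distrib prod_power_distrib prod.distrib)
    also have "(\<Prod>\<beta>\<in>B. (1 + \<bar>\<beta> \<bullet> x\<bar>) ^ l * (1 + \<bar>\<beta> \<bullet> x\<bar>) powr (- k \<beta>)) = ?G x"
    proof (rule prod.cong[OF refl])
      fix \<beta>
      have "0 < 1 + \<bar>\<beta> \<bullet> x\<bar>"
        by (simp add: add_pos_nonneg)
      then show "(1 + \<bar>\<beta> \<bullet> x\<bar>) ^ l * (1 + \<bar>\<beta> \<bullet> x\<bar>) powr (- k \<beta>) = (1 + \<bar>\<beta> \<bullet> x\<bar>) powr (- (k \<beta> - real l))"
        by (simp add: powr_realpow[symmetric] powr_add[symmetric])
    qed
    finally show ?thesis .
  qed
  have "(\<integral>\<^sup>+x. ennreal (?G x) \<partial>lborel) < \<infinity>"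
    using k B(1)
    by (subst prod_ennreal[symmetric], simp,
        intro nn_integral_prod_independent_finite[OF B(2) span_B] nn_integral_one_plus_abs_powr_finite) force+
  then have "integrable lborel ?G"
    by (intro integrableI_nonneg) (auto simp: prod_nonneg)
  then have "integrable lborel (\<lambda>x. V ^ l * C * ?G x)"
    by simp
  then show ?thesis
  proof (rule Bochner_Integration.integrable_bound)
    show "AE x in lborel. norm ((1 + norm x) ^ l *\<^sub>R \<phi> x) \<le> norm (V ^ l * C * ?G x)"
      using bound by (intro AE_I2) (simp only: real_norm_def, rule order_trans[OF _ abs_ge_self])
  qed measurable
qed

section \<open>Fourier integrals and differentiability classes\<close>

text \<open>The sign is opposite to that of the characteristic function it will invert, and the
  normalization by powers of 2 pi is left to the inversion formula.\<close>

definition fourier :: "('a::euclidean_space \<Rightarrow> complex) \<Rightarrow> 'a \<Rightarrow> complex" where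
  "fourier \<psi> y = (\<integral>x. cis (- (x \<bullet> y)) * \<psi> x \<partial>lborel)"

lemma borel_measurable_cis [measurable]: "cis \<in> borel_measurable borel"
  by (intro borel_measurable_continuous_onI continuous_intros)

text \<open>Two bounds with different tasks in \<open>has_derivative_fourier\<close>: the quadratic
  one makes the difference quotient converge pointwise, the linear one dominates it using a single
  moment of \<open>\<psi>\<close>.\<close>

lemma norm_cis_remainder:
  "norm (cis t - 1 - \<i> * complex_of_real t) \<le> t\<^sup>2 / 2"
  "norm (cis t - 1 - \<i> * complex_of_real t) \<le> 2 * \<bar>t\<bar>"
  using iexp_approx1[of t 1] iexp_approx2[of t 1]
  by (simp_all add: cis_conv_exp power2_eq_square diff_diff_eq abs_mult[symmetric] numeral_2_eq_2)

lemma integrable_cis_mult: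
  fixes \<psi> :: "'a::euclidean_space \<Rightarrow> complex"
  assumes "integrable lborel \<psi>"
  shows "integrable lborel (\<lambda>x. cis (- (x \<bullet> y)) * \<psi> x)"
proof -
  have [measurable]: "\<psi> \<in> borel_measurable borel"
    using borel_measurable_integrable[OF assms] by simp
  show ?thesis
    by (rule Bochner_Integration.integrable_bound[OF assms]) (auto simp: norm_mult)
qed

lemma continuous_on_fourier:
  fixes \<psi> :: "'a::euclidean_space \<Rightarrow> complex"
  assumes \<psi>: "integrable lborel \<psi>"
  shows "continuous_on UNIV (fourier \<psi>)"
  unfolding continuous_on_sequentially
proof (intro allI ballI impI)
  fix X :: "nat \<Rightarrow> 'a" and y assume X: "(\<forall>n. X n \<in> UNIV) \<and> X \<longlonglongrightarrow> y"
  have [measurable]: "\<psi> \<in> borel_measurable borel"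
    using borel_measurable_integrable[OF \<psi>] by simp
  show "(fourier \<psi> \<circ> X) \<longlonglongrightarrow> fourier \<psi> y"
    unfolding fourier_def o_def
  proof (rule integral_dominated_convergence[where w = "\<lambda>x. norm (\<psi> x)"])
    show "AE x in lborel. (\<lambda>n. cis (- (x \<bullet> X n)) * \<psi> x) \<longlonglongrightarrow> cis (- (x \<bullet> y)) * \<psi> x"
    proof (rule AE_I2)
      fix x
      show "(\<lambda>n. cis (- (x \<bullet> X n)) * \<psi> x) \<longlonglongrightarrow> cis (- (x \<bullet> y)) * \<psi> x"
        using X by (intro tendsto_intros) auto
    qed
  qed (use \<psi> in \<open>auto simp: norm_mult\<close>)
qed

lemma integrable_weight_mono:
  fixes \<psi> \<psi>' :: "'a::euclidean_space \<Rightarrow> complex"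
  assumes "integrable lborel (\<lambda>x. (1 + norm x) ^ l *\<^sub>R \<psi> x)"
    and [measurable]: "\<psi>' \<in> borel_measurable borel"
    and bound: "\<And>x. (1 + norm x) ^ m * norm (\<psi>' x) \<le> C * ((1 + norm x) ^ l * norm (\<psi> x))"
  shows "integrable lborel (\<lambda>x. (1 + norm x) ^ m *\<^sub>R \<psi>' x)"
proof (rule Bochner_Integration.integrable_bound)
  show "integrable lborel (\<lambda>x. C * norm ((1 + norm x) ^ l *\<^sub>R \<psi> x))"
    using assms(1) by (intro integrable_mult_right integrable_norm)
  show "AE x in lborel. norm ((1 + norm x) ^ m *\<^sub>R \<psi>' x) \<le> norm (C * norm ((1 + norm x) ^ l *\<^sub>R \<psi> x))"
  proof (rule AE_I2)
    fix x
    show "norm ((1 + norm x) ^ m *\<^sub>R \<psi>' x) \<le> norm (C * norm ((1 + norm x) ^ l *\<^sub>R \<psi> x))"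
      using bound[of x] by (simp add: abs_mult) (meson abs_ge_self order_trans mult_right_mono
          mult_nonneg_nonneg norm_ge_zero zero_le_power add_nonneg_nonneg zero_le_one)
  qed
qed measurable

lemma has_derivative_fourier:
  fixes \<psi> :: "'a::euclidean_space \<Rightarrow> complex"
  assumes [measurable]: "\<psi> \<in> borel_measurable borel"
    and int: "integrable lborel (\<lambda>x. (1 + norm x) *\<^sub>R \<psi> x)"
  shows "(fourier \<psi> has_derivative (\<lambda>v. fourier (\<lambda>x. - (\<i> * complex_of_real (x \<bullet> v)) * \<psi> x) y)) (at y)"
proof (rule has_derivativeI)
  let ?D = "\<lambda>v. fourier (\<lambda>x. - (\<i> * complex_of_real (x \<bullet> v)) * \<psi> x) y"
  have int_\<psi>: "integrable lborel \<psi>"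
    using integrable_weight_mono[of 1 \<psi> \<psi> 0 1] int by (simp add: distrib_right)
  have int_norm: "integrable lborel (\<lambda>x. norm x * norm (\<psi> x))"
    using integrable_norm[OF int]
    by (rule Bochner_Integration.integrable_bound) (auto simp: abs_mult distrib_right)
  have int_v: "integrable lborel (\<lambda>x. - (\<i> * complex_of_real (x \<bullet> v)) * \<psi> x)" for v
  proof (rule Bochner_Integration.integrable_bound)
    show "integrable lborel (\<lambda>x. norm v * (norm x * norm (\<psi> x)))"
      using int_norm by simp
    show "AE x in lborel. norm (- (\<i> * complex_of_real (x \<bullet> v)) * \<psi> x) \<le> norm (norm v * (norm x * norm (\<psi> x)))"
    proof (rule AE_I2)
      fix x
      have "\<bar>x \<bullet> v\<bar> * norm (\<psi> x) \<le> norm x * norm v * norm (\<psi> x)"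
        by (intro mult_right_mono Cauchy_Schwarz_ineq2) simp
      then show "norm (- (\<i> * complex_of_real (x \<bullet> v)) * \<psi> x) \<le> norm (norm v * (norm x * norm (\<psi> x)))"
        by (simp add: norm_mult abs_mult mult_ac)
    qed
  qed measurable
  show "bounded_linear ?D"
  proof (rule linear_conv_bounded_linear[THEN iffD1, OF linearI])
    show "?D (a + b) = ?D a + ?D b" for a b
      unfolding fourier_def
        Bochner_Integration.integral_add[OF integrable_cis_mult[OF int_v] integrable_cis_mult[OF int_v], symmetric]
      by (intro Bochner_Integration.integral_cong) (simp_all add: inner_add_right algebra_simps)
    show "?D (c *\<^sub>R a) = c *\<^sub>R ?D a" for c a
      unfolding fourier_def integral_scaleR_right[symmetric]
      by (intro Bochner_Integration.integral_cong) (simp_all add: scaleR_conv_of_real algebra_simps)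
  qed
  show "((\<lambda>z. (fourier \<psi> z - fourier \<psi> y - ?D (z - y)) /\<^sub>R norm (z - y)) \<longlongrightarrow> 0) (at y)"
    unfolding tendsto_at_iff_sequentially
  proof (intro allI impI)
    fix X :: "nat \<Rightarrow> 'a" assume ne: "\<forall>i. X i \<in> UNIV - {y}" and lim: "X \<longlonglongrightarrow> y"
    define h where "h n = X n - y" for n
    have h: "norm (h n) > 0" for n
      using ne by (auto simp: h_def)
    have h_lim: "(\<lambda>n. norm (h n)) \<longlonglongrightarrow> 0"
      using lim unfolding h_def by (auto intro!: tendsto_eq_intros)
    define R where "R n x = cis (- (x \<bullet> h n)) - 1 - \<i> * complex_of_real (- (x \<bullet> h n))" for n x
    define s where "s n x = (cis (- (x \<bullet> y)) * \<psi> x * R n x) /\<^sub>R norm (h n)" for n x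
    have abs_inner: "\<bar>x \<bullet> h n\<bar> \<le> norm x * norm (h n)" for x n
      by (rule Cauchy_Schwarz_ineq2)
    have eq: "(fourier \<psi> (X n) - fourier \<psi> y - ?D (X n - y)) /\<^sub>R norm (X n - y) = (\<integral>x. s n x \<partial>lborel)" for n
    proof -
      have X_eq: "X n = y + h n"
        by (simp add: h_def)
      have "cis (- (x \<bullet> X n)) = cis (- (x \<bullet> y)) * cis (- (x \<bullet> h n))" for x
        by (simp add: X_eq inner_add_right cis_mult)
      then have "fourier \<psi> (X n) - fourier \<psi> y - ?D (X n - y) = (\<integral>x. cis (- (x \<bullet> y)) * \<psi> x * R n x \<partial>lborel)"
        unfolding fourier_def
          Bochner_Integration.integral_diff[OF integrable_cis_mult[OF int_\<psi>] integrable_cis_mult[OF int_\<psi>], symmetric]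
          Bochner_Integration.integral_diff[OF Bochner_Integration.integrable_diff[OF
            integrable_cis_mult[OF int_\<psi>] integrable_cis_mult[OF int_\<psi>]] integrable_cis_mult[OF int_v], symmetric]
        by (intro Bochner_Integration.integral_cong) (simp_all add: R_def h_def[symmetric] algebra_simps)
      then show ?thesis
        unfolding s_def by (simp add: h_def[symmetric])
    qed
    have "(\<lambda>n. \<integral>x. s n x \<partial>lborel) \<longlonglongrightarrow> (\<integral>x. 0 \<partial>(lborel :: 'a measure))"
    proof (rule integral_dominated_convergence[where w = "\<lambda>x. 2 * (norm x * norm (\<psi> x))"])
      show "AE x in lborel. norm (s n x) \<le> 2 * (norm x * norm (\<psi> x))" for n
      proof (rule AE_I2)
        fix x
        have "norm (R n x) \<le> 2 * (norm x * norm (h n))"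
          using norm_cis_remainder(2)[of "- (x \<bullet> h n)"] abs_inner[of x n] unfolding R_def by simp
        then have "norm (\<psi> x) * norm (R n x) \<le> norm (\<psi> x) * (2 * (norm x * norm (h n)))"
          by (intro mult_left_mono) auto
        then show "norm (s n x) \<le> 2 * (norm x * norm (\<psi> x))"
          using h[of n] by (simp add: s_def norm_mult divide_simps mult_ac)
      qed
      show "AE x in lborel. (\<lambda>n. s n x) \<longlonglongrightarrow> 0"
      proof (rule AE_I2)
        fix x
        have "norm (s n x) \<le> norm (\<psi> x) * (norm x)\<^sup>2 * norm (h n)" for n
        proof -
          have "(x \<bullet> h n)\<^sup>2 \<le> (norm x * norm (h n))\<^sup>2"
            using power_mono[OF abs_inner[of x n], of 2] by simp
          then have "norm (R n x) \<le> (norm x * norm (h n))\<^sup>2"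
            using norm_cis_remainder(1)[of "- (x \<bullet> h n)"] zero_le_power2[of "x \<bullet> h n"]
            unfolding R_def power2_minus by linarith
          then have "norm (\<psi> x) * norm (R n x) \<le> norm (\<psi> x) * (norm x * norm (h n))\<^sup>2"
            by (intro mult_left_mono) auto
          then show ?thesis
            using h[of n] by (simp add: s_def norm_mult divide_simps power2_eq_square mult_ac)
        qed
        moreover have "(\<lambda>n. norm (\<psi> x) * (norm x)\<^sup>2 * norm (h n)) \<longlonglongrightarrow> 0"
          using tendsto_mult_right_zero[OF h_lim] .
        ultimately show "(\<lambda>n. s n x) \<longlonglongrightarrow> 0"
          by (intro Lim_null_comparison[of "\<lambda>n. s n x"]) auto
      qed
    qed (use int_norm in \<open>auto simp: s_def R_def\<close>)
    then show "((\<lambda>z. (fourier \<psi> z - fourier \<psi> y - ?D (z - y)) /\<^sub>R norm (z - y)) \<circ> X) \<longlonglongrightarrow> 0"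
      unfolding o_def eq by simp
  qed
qed

text \<open>The exponential is part of the statement because this shape is stable under
  differentiation: a derivative in direction v only replaces \<open>\<psi>\<close> by its product
  with -(\<i> x . v + \<rho> . v), at the cost of one power of 1 + norm x.\<close>

lemma class_C_exp_fourier:
  fixes \<psi> :: "'a::euclidean_space \<Rightarrow> complex" and \<rho> :: 'a
  assumes "\<psi> \<in> borel_measurable borel" "integrable lborel (\<lambda>x. (1 + norm x) ^ l *\<^sub>R \<psi> x)"
  shows "class_C l (\<lambda>y. exp (- (\<rho> \<bullet> y)) * Re (fourier \<psi> y))"
  using assms
proof (induction l arbitrary: \<psi>)
  case 0
  then have "continuous_on UNIV (fourier \<psi>)"
    by (intro continuous_on_fourier) simp
  then show ?case
    by (auto intro!: continuous_intros)
next
  case (Suc l)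
  note [measurable] = Suc.prems(1)
  have int1: "integrable lborel (\<lambda>x. (1 + norm x) ^ 1 *\<^sub>R \<psi> x)"
  proof (rule integrable_weight_mono[OF Suc.prems(2), of _ _ 1])
    show "(1 + norm x) ^ 1 * norm (\<psi> x) \<le> 1 * ((1 + norm x) ^ Suc l * norm (\<psi> x))" for x
      unfolding mult_1 by (intro mult_right_mono power_increasing) auto
  qed measurable
  have int0: "integrable lborel \<psi>"
    using integrable_weight_mono[OF int1, of \<psi> 0 1] by (simp add: distrib_right)
  have inner_le: "\<bar>x \<bullet> v\<bar> \<le> norm v * (1 + norm x)" for x v :: 'a
    by (rule order_trans[OF Cauchy_Schwarz_ineq2]) (simp add: distrib_left mult.commute)
  define \<psi>v where "\<psi>v v x = - (\<i> * complex_of_real (x \<bullet> v)) * \<psi> x - complex_of_real (\<rho> \<bullet> v) * \<psi> x" for v x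
  have [measurable]: "\<psi>v v \<in> borel_measurable borel" for v
    unfolding \<psi>v_def by measurable
  have \<psi>v_le: "norm (\<psi>v v x) \<le> (norm v + norm \<rho> * norm v) * ((1 + norm x) * norm (\<psi> x))" for v x
  proof -
    have "norm (\<psi>v v x) \<le> \<bar>x \<bullet> v\<bar> * norm (\<psi> x) + \<bar>\<rho> \<bullet> v\<bar> * norm (\<psi> x)"
      unfolding \<psi>v_def by (rule order_trans[OF norm_triangle_ineq4]) (simp add: norm_mult)
    also have "\<dots> \<le> norm v * (1 + norm x) * norm (\<psi> x) + norm \<rho> * norm v * (1 + norm x) * norm (\<psi> x)"
    proof (intro add_mono mult_right_mono)
      show "\<bar>x \<bullet> v\<bar> \<le> norm v * (1 + norm x)"
        by (rule inner_le)
      have "norm \<rho> * norm v * 1 \<le> norm \<rho> * norm v * (1 + norm x)"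
        by (intro mult_left_mono) auto
      then show "\<bar>\<rho> \<bullet> v\<bar> \<le> norm \<rho> * norm v * (1 + norm x)"
        using Cauchy_Schwarz_ineq2[of \<rho> v] by simp
    qed auto
    finally show ?thesis
      by (simp add: algebra_simps)
  qed
  have int_v: "integrable lborel (\<lambda>x. (1 + norm x) ^ l *\<^sub>R \<psi>v v x)" for v
  proof (rule integrable_weight_mono[OF Suc.prems(2)])
    fix x
    show "(1 + norm x) ^ l * norm (\<psi>v v x) \<le> (norm v + norm \<rho> * norm v) * ((1 + norm x) ^ Suc l * norm (\<psi> x))"
      using mult_left_mono[OF \<psi>v_le[of v x], of "(1 + norm x) ^ l"] by (simp add: mult_ac)
  qed measurable
  have int_xv: "integrable lborel (\<lambda>x. - (\<i> * complex_of_real (x \<bullet> v)) * \<psi> x)" for v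
  proof (rule Bochner_Integration.integrable_bound)
    show "integrable lborel (\<lambda>x. norm v * norm ((1 + norm x) ^ 1 *\<^sub>R \<psi> x))"
      by (intro integrable_mult_right integrable_norm int1)
    show "AE x in lborel. norm (- (\<i> * complex_of_real (x \<bullet> v)) * \<psi> x) \<le> norm (norm v * norm ((1 + norm x) ^ 1 *\<^sub>R \<psi> x))"
    proof (rule AE_I2)
      fix x
      have "\<bar>x \<bullet> v\<bar> * norm (\<psi> x) \<le> norm v * (1 + norm x) * norm (\<psi> x)"
        by (intro mult_right_mono inner_le) simp
      then show "norm (- (\<i> * complex_of_real (x \<bullet> v)) * \<psi> x) \<le> norm (norm v * norm ((1 + norm x) ^ 1 *\<^sub>R \<psi> x))"
        by (simp add: norm_mult abs_mult mult.assoc)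
    qed
  qed measurable
  have der: "((\<lambda>y. exp (- (\<rho> \<bullet> y)) * Re (fourier \<psi> y)) has_derivative
      (\<lambda>v. exp (- (\<rho> \<bullet> y)) * Re (fourier (\<psi>v v) y))) (at y)" for y
  proof -
    have "fourier (\<psi>v v) y = fourier (\<lambda>x. - (\<i> * complex_of_real (x \<bullet> v)) * \<psi> x) y
        - complex_of_real (\<rho> \<bullet> v) * fourier \<psi> y" for v
    proof -
      have "(\<integral>x. cis (- (x \<bullet> y)) * \<psi>v v x \<partial>lborel) =
          (\<integral>x. cis (- (x \<bullet> y)) * (- (\<i> * complex_of_real (x \<bullet> v)) * \<psi> x)
             - complex_of_real (\<rho> \<bullet> v) * (cis (- (x \<bullet> y)) * \<psi> x) \<partial>lborel)"
        by (rule Bochner_Integration.integral_cong) (simp_all add: \<psi>v_def algebra_simps)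
      also have "\<dots> = (\<integral>x. cis (- (x \<bullet> y)) * (- (\<i> * complex_of_real (x \<bullet> v)) * \<psi> x) \<partial>lborel)
             - (\<integral>x. complex_of_real (\<rho> \<bullet> v) * (cis (- (x \<bullet> y)) * \<psi> x) \<partial>lborel)"
        by (intro Bochner_Integration.integral_diff integrable_mult_right integrable_cis_mult int_xv int0)
      finally show ?thesis
        unfolding fourier_def by simp
    qed
    note fourier_\<psi>v = this
    have dexp: "((\<lambda>y. exp (- (\<rho> \<bullet> y))) has_derivative (\<lambda>v. exp (- (\<rho> \<bullet> y)) * - (\<rho> \<bullet> v))) (at y)"
      by (auto intro!: derivative_eq_intros)
    from has_derivative_mult[OF this
        bounded_linear.has_derivative[OF bounded_linear_Re has_derivative_fourier[OF Suc.prems(1) int1[unfolded power_one_right]]]]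
    show ?thesis
      by (rule has_derivative_eq_rhs) (simp add: fun_eq_iff fourier_\<psi>v algebra_simps)
  qed
  show ?case
    unfolding class_C.simps
  proof (intro conjI allI)
    show "(\<lambda>y. exp (- (\<rho> \<bullet> y)) * Re (fourier \<psi> y)) differentiable at y" for y
      using der differentiable_def by blast
    fix v
    have "(\<lambda>y. frechet_derivative (\<lambda>y. exp (- (\<rho> \<bullet> y)) * Re (fourier \<psi> y)) (at y) v) =
        (\<lambda>y. exp (- (\<rho> \<bullet> y)) * Re (fourier (\<psi>v v) y))"
      by (rule ext) (simp add: frechet_derivative_at[OF der, symmetric])
    then show "class_C l (\<lambda>y. frechet_derivative (\<lambda>y. exp (- (\<rho> \<bullet> y)) * Re (fourier \<psi> y)) (at y) v)"
      using Suc.IH[of "\<psi>v v"] int_v by simp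
  qed
qed

section \<open>Fourier inversion\<close>

lemma lborel_integral_prod:
  fixes f :: "'a::euclidean_space \<Rightarrow> real \<Rightarrow> complex"
  assumes int: "\<And>b. b \<in> Basis \<Longrightarrow> integrable lborel (f b)"
  shows "integrable lborel (\<lambda>x::'a. \<Prod>b\<in>Basis. f b (x \<bullet> b))"
    and "(\<integral>x. (\<Prod>b\<in>Basis. f b (x \<bullet> b)) \<partial>(lborel :: 'a measure)) = (\<Prod>b\<in>Basis. \<integral>s. f b s \<partial>lborel)"
proof -
  interpret product_sigma_finite "\<lambda>_::'a. lborel :: real measure" ..
  let ?M = "\<Pi>\<^sub>M b\<in>(Basis :: 'a set). (lborel :: real measure)"
  let ?T = "\<lambda>t::'a \<Rightarrow> real. \<Sum>b\<in>Basis. t b *\<^sub>R b"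
  have [measurable]: "f b \<in> borel_measurable borel" if "b \<in> Basis" for b
    using borel_measurable_integrable[OF int[OF that]] by simp
  have lborel_distr: "(lborel :: 'a measure) = distr ?M borel ?T"
    by (rule lborel_eq)
  have T[measurable]: "?T \<in> ?M \<rightarrow>\<^sub>M borel"
    by measurable
  have F[measurable]: "(\<lambda>x::'a. \<Prod>b\<in>Basis. f b (x \<bullet> b)) \<in> borel_measurable borel"
    by measurable
  have eq: "(\<Prod>b\<in>Basis. f b (?T t \<bullet> b)) = (\<Prod>b\<in>Basis. f b (t b))" for t
    by (intro prod.cong) (simp_all add: inner_sum_left_Basis)
  have "integrable ?M (\<lambda>t. \<Prod>b\<in>Basis. f b (t b))"
    using int by (intro product_integrable_prod) auto
  then show "integrable lborel (\<lambda>x::'a. \<Prod>b\<in>Basis. f b (x \<bullet> b))"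
    unfolding lborel_distr by (subst integrable_distr_eq[OF T F]) (simp only: eq)
  have "(\<integral>x. (\<Prod>b\<in>Basis. f b (x \<bullet> b)) \<partial>(lborel :: 'a measure)) = (\<integral>t. (\<Prod>b\<in>Basis. f b (t b)) \<partial>?M)"
    unfolding lborel_distr by (subst integral_distr[OF T F]) (simp only: eq)
  also have "\<dots> = (\<Prod>b\<in>Basis. \<integral>s. f b s \<partial>lborel)"
    using int by (intro product_integral_prod) auto
  finally show "(\<integral>x. (\<Prod>b\<in>Basis. f b (x \<bullet> b)) \<partial>(lborel :: 'a measure)) = (\<Prod>b\<in>Basis. \<integral>s. f b s \<partial>lborel)" .
qed

text \<open>Normalized by its value 1 at the origin rather than by its mass: as a regularizing
  factor under an integral, its dilations then tend to 1.\<close>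

definition gauss :: "'a::euclidean_space \<Rightarrow> real" where
  "gauss x = exp (- ((norm x)\<^sup>2) / 2)"

lemma gauss_nonneg [simp]: "0 \<le> gauss x" and gauss_le_1: "gauss x \<le> 1" and gauss_minus: "gauss (- x) = gauss x"
  by (simp_all add: gauss_def)

lemma borel_measurable_gauss [measurable]: "gauss \<in> borel_measurable borel"
  unfolding gauss_def by measurable

text \<open>The characteristic function of the standard normal distribution, with the factor
  \<open>sqrt (2 * pi)\<close> of its density moved to the other side.\<close>

lemma gauss_fourier_real:
  "integrable lborel (\<lambda>s. complex_of_real (exp (- s\<^sup>2 / 2)) * cis (s * a))"
  "(\<integral>s. complex_of_real (exp (- s\<^sup>2 / 2)) * cis (s * a) \<partial>lborel) =
     complex_of_real (sqrt (2 * pi) * exp (- a\<^sup>2 / 2))"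
proof -
  have eq: "complex_of_real (exp (- s\<^sup>2 / 2)) * cis (s * a) =
      complex_of_real (sqrt (2 * pi)) * (std_normal_density s *\<^sub>R iexp (a * s))" for s
    by (simp add: std_normal_density_def scaleR_conv_of_real cis_conv_exp mult.commute)
  have int: "integrable lborel (\<lambda>s. std_normal_density s *\<^sub>R iexp (a * s))"
    by (rule Bochner_Integration.integrable_bound[OF integrable_normal_density[of 1 0]]) auto
  then show "integrable lborel (\<lambda>s. complex_of_real (exp (- s\<^sup>2 / 2)) * cis (s * a))"
    unfolding eq by (rule integrable_mult_right)
  have "char std_normal_distribution a = (\<integral>s. std_normal_density s *\<^sub>R iexp (a * s) \<partial>lborel)"
    unfolding char_def by (subst integral_density) (auto simp: normal_density_nonneg)
  then show "(\<integral>s. complex_of_real (exp (- s\<^sup>2 / 2)) * cis (s * a) \<partial>lborel) =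
     complex_of_real (sqrt (2 * pi) * exp (- a\<^sup>2 / 2))"
    unfolding eq integral_mult_right_zero by (simp add: char_std_normal_distribution)
qed

lemma gauss_eq_prod: "gauss x = (\<Prod>b\<in>Basis. exp (- (x \<bullet> b)\<^sup>2 / 2))"
proof -
  have "(norm x)\<^sup>2 = (\<Sum>b\<in>Basis. (x \<bullet> b)\<^sup>2)"
    unfolding power2_norm_eq_inner by (subst euclidean_inner) (simp add: power2_eq_square)
  then show ?thesis
    by (simp add: gauss_def exp_sum[symmetric] sum_divide_distrib[symmetric] sum_negf)
qed

lemma cis_sum: "finite A \<Longrightarrow> cis (\<Sum>a\<in>A. g a) = (\<Prod>a\<in>A. cis (g a))"
  by (induction A rule: finite_induct) (simp_all add: cis_mult[symmetric])

lemma gauss_fourier: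
  fixes t :: "'a::euclidean_space"
  shows "integrable lborel (\<lambda>x. complex_of_real (gauss x) * cis (x \<bullet> t))"
    and "(\<integral>x. complex_of_real (gauss x) * cis (x \<bullet> t) \<partial>lborel) =
      complex_of_real (sqrt (2 * pi) ^ DIM('a) * gauss t)"
proof -
  have eq: "complex_of_real (gauss x) * cis (x \<bullet> t) =
      (\<Prod>b\<in>Basis. complex_of_real (exp (- (x \<bullet> b)\<^sup>2 / 2)) * cis ((x \<bullet> b) * (t \<bullet> b)))" for x
    by (subst euclidean_inner) (simp add: gauss_eq_prod cis_sum prod.distrib)
  show "integrable lborel (\<lambda>x. complex_of_real (gauss x) * cis (x \<bullet> t))"
    unfolding eq by (rule lborel_integral_prod(1)[OF gauss_fourier_real(1)])
  show "(\<integral>x. complex_of_real (gauss x) * cis (x \<bullet> t) \<partial>lborel) =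
      complex_of_real (sqrt (2 * pi) ^ DIM('a) * gauss t)"
    unfolding eq lborel_integral_prod(2)[OF gauss_fourier_real(1)] gauss_fourier_real(2)
    by (simp add: gauss_eq_prod prod.distrib)
qed

lemma integrable_gauss: "integrable lborel (gauss :: 'a::euclidean_space \<Rightarrow> real)"
  and integral_gauss: "(\<integral>x. gauss x \<partial>(lborel :: 'a measure)) = sqrt (2 * pi) ^ DIM('a)"
proof -
  have "integrable lborel (\<lambda>x::'a. complex_of_real (gauss x))"
    using gauss_fourier(1)[of 0] by simp
  then show "integrable lborel (gauss :: 'a \<Rightarrow> real)"
    by (simp only: complex_of_real_integrable_eq)
  have "complex_of_real (\<integral>x. gauss x \<partial>(lborel :: 'a measure)) = complex_of_real (sqrt (2 * pi) ^ DIM('a))"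
    using gauss_fourier(2)[of "0::'a"] by (simp add: gauss_def)
  then show "(\<integral>x. gauss x \<partial>(lborel :: 'a measure)) = sqrt (2 * pi) ^ DIM('a)"
    by (simp only: of_real_eq_iff)
qed

lemma lborel_affine_integral:
  fixes h :: "'a::euclidean_space \<Rightarrow> 'b::{banach, second_countable_topology}"
  assumes [measurable]: "h \<in> borel_measurable borel" and "c \<noteq> 0"
  shows "(\<integral>x. h x \<partial>lborel) = \<bar>c\<bar> ^ DIM('a) *\<^sub>R (\<integral>x. h (t + c *\<^sub>R x) \<partial>lborel)"
  by (subst lborel_affine[OF \<open>c \<noteq> 0\<close>, of t])
     (simp add: integral_density integral_distr)

lemma lborel_affine_nn_integral:
  fixes h :: "'a::euclidean_space \<Rightarrow> ennreal"
  assumes [measurable]: "h \<in> borel_measurable borel" and "c \<noteq> 0"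
  shows "(\<integral>\<^sup>+x. h x \<partial>lborel) = ennreal (\<bar>c\<bar> ^ DIM('a)) * (\<integral>\<^sup>+x. h (t + c *\<^sub>R x) \<partial>lborel)"
  by (subst lborel_affine[OF \<open>c \<noteq> 0\<close>, of t])
     (simp add: nn_integral_density nn_integral_distr nn_integral_cmult ennreal_power)

lemma lborel_affine_integrable:
  fixes h :: "'a::euclidean_space \<Rightarrow> complex"
  assumes "integrable lborel h" and "c \<noteq> 0"
  shows "integrable lborel (\<lambda>x. h (t + c *\<^sub>R x))"
proof -
  have [measurable]: "h \<in> borel_measurable borel"
    using borel_measurable_integrable[OF assms(1)] by simp
  have "integrable (density (distr lborel borel (\<lambda>x. t + c *\<^sub>R x)) (\<lambda>_. \<bar>c\<bar> ^ DIM('a))) h"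
    using assms(1) lborel_affine[OF \<open>c \<noteq> 0\<close>, of t] by simp
  then have "integrable lborel (\<lambda>x. \<bar>c\<bar> ^ DIM('a) *\<^sub>R h (t + c *\<^sub>R x))"
    by (simp add: integrable_density integrable_distr_eq)
  then have "integrable lborel (\<lambda>x. inverse (\<bar>c\<bar> ^ DIM('a)) *\<^sub>R (\<bar>c\<bar> ^ DIM('a) *\<^sub>R h (t + c *\<^sub>R x)))"
    by (rule integrable_scaleR_right)
  then show ?thesis
    using \<open>c \<noteq> 0\<close> by simp
qed

lemma gauss_fourier_scaled:
  fixes t :: "'a::euclidean_space"
  assumes "0 < m"
  shows "integrable lborel (\<lambda>x. complex_of_real (gauss (x /\<^sub>R m)) * cis (x \<bullet> t))"
    and "(\<integral>x. complex_of_real (gauss (x /\<^sub>R m)) * cis (x \<bullet> t) \<partial>lborel) =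
      complex_of_real ((m * sqrt (2 * pi)) ^ DIM('a) * gauss (m *\<^sub>R t))"
proof -
  have "integrable lborel (\<lambda>x. complex_of_real (gauss (0 + (1 / m) *\<^sub>R x)) * cis ((0 + (1 / m) *\<^sub>R x) \<bullet> (m *\<^sub>R t)))"
    by (rule lborel_affine_integrable[OF gauss_fourier(1)]) (use assms in auto)
  then show "integrable lborel (\<lambda>x. complex_of_real (gauss (x /\<^sub>R m)) * cis (x \<bullet> t))"
    using assms by (simp add: divide_inverse mult.assoc[symmetric])
  have "(\<integral>x. complex_of_real (gauss (x /\<^sub>R m)) * cis (x \<bullet> t) \<partial>lborel) =
      \<bar>m\<bar> ^ DIM('a) *\<^sub>R (\<integral>x. complex_of_real (gauss ((0 + m *\<^sub>R x) /\<^sub>R m)) * cis ((0 + m *\<^sub>R x) \<bullet> t) \<partial>lborel)"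
    by (rule lborel_affine_integral) (use assms in auto)
  also have "\<dots> = \<bar>m\<bar> ^ DIM('a) *\<^sub>R (\<integral>x. complex_of_real (gauss x) * cis (x \<bullet> (m *\<^sub>R t)) \<partial>lborel)"
    using assms by simp
  finally show "(\<integral>x. complex_of_real (gauss (x /\<^sub>R m)) * cis (x \<bullet> t) \<partial>lborel) =
      complex_of_real ((m * sqrt (2 * pi)) ^ DIM('a) * gauss (m *\<^sub>R t))"
    using assms unfolding gauss_fourier(2) by (simp add: scaleR_conv_of_real power_mult_distrib mult.assoc)
qed

section \<open>Inversion for a measure with integrable characteristic function\<close>

locale integrable_characteristic_function = finite_measure \<nu>
  for \<nu> :: "'a::euclidean_space measure" +
  fixes \<phi> :: "'a \<Rightarrow> complex"
  assumes sets_nu [measurable_cong, simp]: "sets \<nu> = sets borel"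
    and \<phi>_def: "\<And>x. \<phi> x = (\<integral>\<eta>. cis (x \<bullet> \<eta>) \<partial>\<nu>)"
    and \<phi>_integrable: "integrable lborel \<phi>"
    and abs_cont: "absolutely_continuous lborel \<nu>"
begin

lemma \<phi>_measurable [measurable]: "\<phi> \<in> borel_measurable borel"
  using borel_measurable_integrable[OF \<phi>_integrable] by simp

text \<open>The inversion integral with a Gaussian cutoff, which makes Fubini applicable.
  \<open>Suc m\<close> keeps the dilation factor positive for all \<open>m\<close>.\<close>

definition smoothed :: "nat \<Rightarrow> 'a \<Rightarrow> complex" where
  "smoothed m y = (\<integral>x. complex_of_real (gauss (x /\<^sub>R real (Suc m))) * (cis (- (x \<bullet> y)) * \<phi> x) \<partial>lborel)"

text \<open>After exchanging the integrals the inner one is the Fourier transform of a Gaussian,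
  hence again Gaussian. The cut-off inversion integral is thus a positive average of
  \<open>\<nu>\<close> concentrating at y, in particular real and nonnegative.\<close>

lemma smoothed_eq:
  "smoothed m y = complex_of_real ((real (Suc m) * sqrt (2 * pi)) ^ DIM('a) *
     (\<integral>\<eta>. gauss (real (Suc m) *\<^sub>R (\<eta> - y)) \<partial>\<nu>))"
proof -
  let ?s = "real (Suc m)"
  let ?f = "\<lambda>x \<eta>. complex_of_real (gauss (x /\<^sub>R ?s)) * cis (x \<bullet> (\<eta> - y))"
  interpret pair_sigma_finite \<nu> "lborel :: 'a measure" ..
  have int_g: "integrable lborel (\<lambda>x::'a. gauss (x /\<^sub>R ?s))"
    using gauss_fourier_scaled(1)[of ?s 0] by (simp add: complex_of_real_integrable_eq)
  have "integrable (\<nu> \<Otimes>\<^sub>M lborel) (\<lambda>(\<eta>, x). ?f x \<eta>)"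
  proof (rule Fubini_integrable)
    show "AE \<eta> in \<nu>. integrable lborel (\<lambda>x. case (\<eta>, x) of (\<eta>, x) \<Rightarrow> ?f x \<eta>)"
      using gauss_fourier_scaled(1)[of ?s] by (intro AE_I2) simp
    have "norm (?f x \<eta>) = gauss (x /\<^sub>R ?s)" for x \<eta>
      by (simp add: norm_mult)
    then show "integrable \<nu> (\<lambda>\<eta>. \<integral>x. norm (case (\<eta>, x) of (\<eta>, x) \<Rightarrow> ?f x \<eta>) \<partial>lborel)"
      by simp
  qed measurable
  then have "(\<integral>x. (\<integral>\<eta>. ?f x \<eta> \<partial>\<nu>) \<partial>lborel) = (\<integral>\<eta>. (\<integral>x. ?f x \<eta> \<partial>lborel) \<partial>\<nu>)"
    by (rule Fubini_integral)
  moreover have "(\<integral>\<eta>. ?f x \<eta> \<partial>\<nu>) = complex_of_real (gauss (x /\<^sub>R ?s)) * (cis (- (x \<bullet> y)) * \<phi> x)" for x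
  proof -
    have "?f x \<eta> = complex_of_real (gauss (x /\<^sub>R ?s)) * (cis (- (x \<bullet> y)) * cis (x \<bullet> \<eta>))" for \<eta>
      by (simp add: cis_mult inner_diff_right)
    then show ?thesis
      by (simp only: \<phi>_def integral_mult_right_zero)
  qed
  ultimately have "smoothed m y = (\<integral>\<eta>. (\<integral>x. ?f x \<eta> \<partial>lborel) \<partial>\<nu>)"
    unfolding smoothed_def by (simp only:)
  also have "\<dots> = (\<integral>\<eta>. complex_of_real ((?s * sqrt (2 * pi)) ^ DIM('a) * gauss (?s *\<^sub>R (\<eta> - y))) \<partial>\<nu>)"
    by (subst gauss_fourier_scaled(2)) simp_all
  also have "\<dots> = complex_of_real ((?s * sqrt (2 * pi)) ^ DIM('a) * (\<integral>\<eta>. gauss (?s *\<^sub>R (\<eta> - y)) \<partial>\<nu>))"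
    by (subst integral_complex_of_real) simp
  finally show ?thesis .
qed

lemma smoothed_tendsto: "(\<lambda>m. smoothed m y) \<longlonglongrightarrow> fourier \<phi> y"
  unfolding smoothed_def fourier_def
proof (rule integral_dominated_convergence[where w = "\<lambda>x. norm (\<phi> x)"])
  show "AE x in lborel. (\<lambda>m. complex_of_real (gauss (x /\<^sub>R real (Suc m))) * (cis (- (x \<bullet> y)) * \<phi> x))
      \<longlonglongrightarrow> cis (- (x \<bullet> y)) * \<phi> x"
  proof (rule AE_I2)
    fix x :: 'a
    have "(\<lambda>m. gauss (inverse (real (Suc m)) *\<^sub>R x)) \<longlonglongrightarrow> gauss (0 *\<^sub>R x)"
      unfolding gauss_def by (intro tendsto_intros LIMSEQ_inverse_real_of_nat) auto
    then have "(\<lambda>m. complex_of_real (gauss (x /\<^sub>R real (Suc m))) * (cis (- (x \<bullet> y)) * \<phi> x))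
        \<longlonglongrightarrow> complex_of_real (gauss (0 *\<^sub>R x)) * (cis (- (x \<bullet> y)) * \<phi> x)"
      by (intro tendsto_mult tendsto_of_real tendsto_const)
    then show "(\<lambda>m. complex_of_real (gauss (x /\<^sub>R real (Suc m))) * (cis (- (x \<bullet> y)) * \<phi> x))
        \<longlonglongrightarrow> cis (- (x \<bullet> y)) * \<phi> x"
      by (simp add: gauss_def)
  qed
  show "AE x in lborel. norm (complex_of_real (gauss (x /\<^sub>R real (Suc m))) * (cis (- (x \<bullet> y)) * \<phi> x)) \<le> norm (\<phi> x)" for m
    by (intro AE_I2) (simp add: norm_mult mult_left_le_one_le gauss_le_1)
qed (use \<phi>_integrable in auto)

lemma norm_smoothed_le: "norm (smoothed m y) \<le> (\<integral>x. norm (\<phi> x) \<partial>lborel)"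
  unfolding smoothed_def
proof (rule order_trans[OF integral_norm_bound], rule integral_mono')
  show "norm (complex_of_real (gauss (x /\<^sub>R real (Suc m))) * (cis (- (x \<bullet> y)) * \<phi> x)) \<le> norm (\<phi> x)" for x
    by (simp add: norm_mult mult_left_le_one_le gauss_le_1)
qed (use \<phi>_integrable in auto)

text \<open>A limit of positive averages of \<open>\<nu>\<close>. In the inversion formula
  \<open>ennreal\<close> would otherwise silently truncate negative values.\<close>

lemma Re_fourier_nonneg: "0 \<le> Re (fourier \<phi> y)"
proof (rule tendsto_lowerbound[OF tendsto_Re[OF smoothed_tendsto]])
  show "\<forall>\<^sub>F m in sequentially. 0 \<le> Re (smoothed m y)"
    unfolding smoothed_eq
    by (intro always_eventually allI) (auto intro!: mult_nonneg_nonneg Bochner_Integration.integral_nonneg)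
qed simp

lemma borel_measurable_fourier [measurable]: "fourier \<phi> \<in> borel_measurable borel"
  using continuous_on_fourier[OF \<phi>_integrable] by (rule borel_measurable_continuous_onI)

lemma borel_measurable_smoothed [measurable]: "smoothed m \<in> borel_measurable borel"
  unfolding smoothed_def by measurable

text \<open>Tonelli and the substitution y = \<eta> + v / s with s = m + 1. Its Jacobian cancels the
  power of s in \<open>smoothed_eq\<close>, so m is left only in the argument of the indicator, and
  there it tends to \<eta>.\<close>

lemma box_smoothed:
  fixes a b :: 'a and m :: nat
  shows "(\<integral>\<^sup>+y. ennreal (Re (smoothed m y)) * indicator (box a b) y \<partial>lborel) =
    ennreal (sqrt (2 * pi) ^ DIM('a)) *
      (\<integral>\<^sup>+\<eta>. (\<integral>\<^sup>+v. ennreal (gauss v) * indicator (box a b) (\<eta> + (1 / real (Suc m)) *\<^sub>R v) \<partial>lborel) \<partial>\<nu>)"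
proof -
  let ?s = "real (Suc m)" and ?d = "DIM('a)" and ?I = "indicator (box a b) :: 'a \<Rightarrow> ennreal"
  interpret pair_sigma_finite \<nu> "lborel :: 'a measure" ..
  have "ennreal (Re (smoothed m y)) = ennreal ((?s * sqrt (2 * pi)) ^ ?d) * (\<integral>\<^sup>+\<eta>. ennreal (gauss (?s *\<^sub>R (\<eta> - y))) \<partial>\<nu>)" for y
  proof -
    have "integrable \<nu> (\<lambda>\<eta>. gauss (?s *\<^sub>R (\<eta> - y)))"
      by (intro integrable_const_bound[of _ 1]) (auto simp: gauss_le_1)
    then have "ennreal (\<integral>\<eta>. gauss (?s *\<^sub>R (\<eta> - y)) \<partial>\<nu>) = (\<integral>\<^sup>+\<eta>. ennreal (gauss (?s *\<^sub>R (\<eta> - y))) \<partial>\<nu>)"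
      by (intro nn_integral_eq_integral[symmetric]) auto
    then show ?thesis
      unfolding smoothed_eq Re_complex_of_real by (subst ennreal_mult') simp_all
  qed
  then have "(\<integral>\<^sup>+y. ennreal (Re (smoothed m y)) * ?I y \<partial>lborel) =
      (\<integral>\<^sup>+y. ennreal ((?s * sqrt (2 * pi)) ^ ?d) * (\<integral>\<^sup>+\<eta>. ennreal (gauss (?s *\<^sub>R (\<eta> - y))) * ?I y \<partial>\<nu>) \<partial>lborel)"
    by (simp add: nn_integral_multc mult.assoc)
  also have "\<dots> = ennreal ((?s * sqrt (2 * pi)) ^ ?d) *
      (\<integral>\<^sup>+y. (\<integral>\<^sup>+\<eta>. ennreal (gauss (?s *\<^sub>R (\<eta> - y))) * ?I y \<partial>\<nu>) \<partial>lborel)"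
    by (rule nn_integral_cmult) measurable
  also have "(\<integral>\<^sup>+y. (\<integral>\<^sup>+\<eta>. ennreal (gauss (?s *\<^sub>R (\<eta> - y))) * ?I y \<partial>\<nu>) \<partial>lborel) =
      (\<integral>\<^sup>+\<eta>. (\<integral>\<^sup>+y. ennreal (gauss (?s *\<^sub>R (\<eta> - y))) * ?I y \<partial>lborel) \<partial>\<nu>)"
    by (rule Fubini') measurable
  also have "\<dots> = (\<integral>\<^sup>+\<eta>. ennreal (\<bar>1 / ?s\<bar> ^ ?d) *
      (\<integral>\<^sup>+v. ennreal (gauss v) * ?I (\<eta> + (1 / ?s) *\<^sub>R v) \<partial>lborel) \<partial>\<nu>)"
  proof (rule nn_integral_cong)
    fix \<eta> :: 'a
    have "?s *\<^sub>R (\<eta> - (\<eta> + (1 / ?s) *\<^sub>R v)) = - v" for v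
      by simp
    then show "(\<integral>\<^sup>+y. ennreal (gauss (?s *\<^sub>R (\<eta> - y))) * ?I y \<partial>lborel) = ennreal (\<bar>1 / ?s\<bar> ^ ?d) *
        (\<integral>\<^sup>+v. ennreal (gauss v) * ?I (\<eta> + (1 / ?s) *\<^sub>R v) \<partial>lborel)"
      by (subst lborel_affine_nn_integral[where c = "1 / ?s" and t = \<eta>]) (simp_all only: gauss_minus, auto)
  qed
  also have "\<dots> = ennreal (\<bar>1 / ?s\<bar> ^ ?d) *
      (\<integral>\<^sup>+\<eta>. (\<integral>\<^sup>+v. ennreal (gauss v) * ?I (\<eta> + (1 / ?s) *\<^sub>R v) \<partial>lborel) \<partial>\<nu>)"
    by (rule nn_integral_cmult) measurable
  also have "ennreal ((?s * sqrt (2 * pi)) ^ ?d) * (ennreal (\<bar>1 / ?s\<bar> ^ ?d) *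
      (\<integral>\<^sup>+\<eta>. (\<integral>\<^sup>+v. ennreal (gauss v) * ?I (\<eta> + (1 / ?s) *\<^sub>R v) \<partial>lborel) \<partial>\<nu>)) =
      ennreal ((?s * sqrt (2 * pi)) ^ ?d * \<bar>1 / ?s\<bar> ^ ?d) *
      (\<integral>\<^sup>+\<eta>. (\<integral>\<^sup>+v. ennreal (gauss v) * ?I (\<eta> + (1 / ?s) *\<^sub>R v) \<partial>lborel) \<partial>\<nu>)"
    by (subst ennreal_mult) (simp_all add: mult.assoc)
  also have "(?s * sqrt (2 * pi)) ^ ?d * \<bar>1 / ?s\<bar> ^ ?d = sqrt (2 * pi) ^ ?d"
    by (simp add: power_mult_distrib[symmetric])
  finally show ?thesis .
qed

text \<open>Both sides of \<open>box_smoothed\<close> converge as \<open>m\<close> tends to infinity; the boundary of the box is \<open>\<nu>\<close>-null by absolute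
  continuity.\<close>

lemma nn_integral_fourier_box:
  fixes a b :: 'a
  shows "(\<integral>\<^sup>+y. ennreal (Re (fourier \<phi> y)) * indicator (box a b) y \<partial>lborel) =
    ennreal ((2 * pi) ^ DIM('a)) * emeasure \<nu> (box a b)"
proof -
  let ?I = "indicator (box a b) :: 'a \<Rightarrow> ennreal" and ?c = "sqrt (2 * pi) ^ DIM('a)"
  define C where "C = (\<integral>x. norm (\<phi> x) \<partial>lborel)"
  have "(\<lambda>m. \<integral>\<^sup>+y. ennreal (Re (smoothed m y)) * ?I y \<partial>lborel) \<longlonglongrightarrow>
      (\<integral>\<^sup>+y. ennreal (Re (fourier \<phi> y)) * ?I y \<partial>lborel)"
  proof (rule nn_integral_dominated_convergence[where w = "\<lambda>y. ennreal C * ?I y"])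
    show "AE y in lborel. ennreal (Re (smoothed m y)) * ?I y \<le> ennreal C * ?I y" for m
      using norm_smoothed_le complex_Re_le_cmod
      by (intro AE_I2 mult_right_mono ennreal_leI) (auto simp: C_def intro: order_trans)
    show "AE y in lborel. (\<lambda>m. ennreal (Re (smoothed m y)) * ?I y) \<longlonglongrightarrow> ennreal (Re (fourier \<phi> y)) * ?I y"
    proof (rule AE_I2)
      fix y :: 'a
      have "(\<lambda>m. ennreal (Re (smoothed m y))) \<longlonglongrightarrow> ennreal (Re (fourier \<phi> y))"
        by (intro tendsto_ennrealI tendsto_Re smoothed_tendsto)
      then show "(\<lambda>m. ennreal (Re (smoothed m y)) * ?I y) \<longlonglongrightarrow> ennreal (Re (fourier \<phi> y)) * ?I y"
        by (cases "y \<in> box a b") auto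
    qed
    show "(\<integral>\<^sup>+y. ennreal C * ?I y \<partial>lborel) < \<infinity>"
      using emeasure_bounded_finite[OF bounded_box, of a b]
      by (simp add: nn_integral_cmult_indicator ennreal_mult_less_top)
  qed measurable
  moreover have "(\<lambda>m. \<integral>\<^sup>+y. ennreal (Re (smoothed m y)) * ?I y \<partial>lborel) \<longlonglongrightarrow>
      ennreal ?c * (\<integral>\<^sup>+\<eta>. ennreal ?c * ?I \<eta> \<partial>\<nu>)"
    unfolding box_smoothed
  proof (rule ennreal_tendsto_cmult)
    have fin: "(\<integral>\<^sup>+v. ennreal (gauss v) \<partial>(lborel :: 'a measure)) = ennreal ?c"
      by (subst nn_integral_eq_integral) (simp_all add: integrable_gauss integral_gauss)
    show "(\<lambda>m. \<integral>\<^sup>+\<eta>. (\<integral>\<^sup>+v. ennreal (gauss v) * ?I (\<eta> + (1 / real (Suc m)) *\<^sub>R v) \<partial>lborel) \<partial>\<nu>) \<longlonglongrightarrow>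
        (\<integral>\<^sup>+\<eta>. ennreal ?c * ?I \<eta> \<partial>\<nu>)"
    proof (rule nn_integral_dominated_convergence[where w = "\<lambda>_. ennreal ?c"])
      show "AE \<eta> in \<nu>. (\<integral>\<^sup>+v. ennreal (gauss v) * ?I (\<eta> + (1 / real (Suc m)) *\<^sub>R v) \<partial>lborel) \<le> ennreal ?c" for m
      proof (rule AE_I2)
        fix \<eta> :: 'a
        show "(\<integral>\<^sup>+v. ennreal (gauss v) * ?I (\<eta> + (1 / real (Suc m)) *\<^sub>R v) \<partial>lborel) \<le> ennreal ?c"
          unfolding fin[symmetric] by (intro nn_integral_mono) (simp split: split_indicator)
      qed
      have "cbox a b - box a b \<in> null_sets lborel"
        using negligible_frontier_interval[of a b]
        by (simp add: negligible_iff_null_sets null_sets_completion_iff)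
      then have "cbox a b - box a b \<in> null_sets \<nu>"
        using abs_cont by (auto simp: absolutely_continuous_def)
      then have "AE \<eta> in \<nu>. \<eta> \<notin> cbox a b - box a b"
        by (rule AE_not_in)
      then show "AE \<eta> in \<nu>. (\<lambda>m. \<integral>\<^sup>+v. ennreal (gauss v) * ?I (\<eta> + (1 / real (Suc m)) *\<^sub>R v) \<partial>lborel) \<longlonglongrightarrow>
          ennreal ?c * ?I \<eta>"
      proof eventually_elim
        case (elim \<eta>)
        have "(\<lambda>m. \<integral>\<^sup>+v. ennreal (gauss v) * ?I (\<eta> + (1 / real (Suc m)) *\<^sub>R v) \<partial>lborel) \<longlonglongrightarrow>
            (\<integral>\<^sup>+v. ennreal (gauss v) * ?I \<eta> \<partial>(lborel :: 'a measure))"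
        proof (rule nn_integral_dominated_convergence[where w = "\<lambda>v. ennreal (gauss v)"])
          show "AE v in lborel. (\<lambda>m. ennreal (gauss v) * ?I (\<eta> + (1 / real (Suc m)) *\<^sub>R v))
              \<longlonglongrightarrow> ennreal (gauss v) * ?I \<eta>"
          proof (rule AE_I2)
            fix v :: 'a
            have "(\<lambda>m. \<eta> + inverse (real (Suc m)) *\<^sub>R v) \<longlonglongrightarrow> \<eta> + 0 *\<^sub>R v"
              by (intro tendsto_intros LIMSEQ_inverse_real_of_nat)
            then have lim: "(\<lambda>m. \<eta> + (1 / real (Suc m)) *\<^sub>R v) \<longlonglongrightarrow> \<eta>"
              by (simp add: divide_inverse)
            \<comment> \<open>Off the boundary, \<eta> lies in one of two open sets on which the
              indicator is constant, so the indicators along the sequence are eventually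
              constant.\<close>
            have "\<eta> \<in> box a b \<or> \<eta> \<in> - cbox a b"
              using elim by auto
            then have "\<forall>\<^sub>F m in sequentially. ?I (\<eta> + (1 / real (Suc m)) *\<^sub>R v) = ?I \<eta>"
            proof
              assume in_box: "\<eta> \<in> box a b"
              from topological_tendstoD[OF lim open_box in_box] show ?thesis
                by eventually_elim (use in_box in simp)
            next
              assume out: "\<eta> \<in> - cbox a b"
              then have "\<eta> \<notin> box a b"
                using box_subset_cbox by auto
              have "open (- cbox a b)"
                by (intro open_Compl closed_cbox)
              from topological_tendstoD[OF lim this out] show ?thesis
                by eventually_elim (use box_subset_cbox \<open>\<eta> \<notin> box a b\<close> in \<open>auto simp: indicator_def\<close>)
            qed
            then have "\<forall>\<^sub>F m in sequentially.
                ennreal (gauss v) * ?I (\<eta> + (1 / real (Suc m)) *\<^sub>R v) = ennreal (gauss v) * ?I \<eta>"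
              by eventually_elim simp
            then show "(\<lambda>m. ennreal (gauss v) * ?I (\<eta> + (1 / real (Suc m)) *\<^sub>R v)) \<longlonglongrightarrow> ennreal (gauss v) * ?I \<eta>"
              by (rule tendsto_eventually)
          qed
          show "(\<integral>\<^sup>+v. ennreal (gauss v) \<partial>(lborel :: 'a measure)) < \<infinity>"
            unfolding fin by simp
        qed (auto split: split_indicator)
        then show ?case
          by (simp add: nn_integral_multc fin)
      qed
      show "(\<integral>\<^sup>+\<eta>. ennreal ?c \<partial>\<nu>) < \<infinity>"
      proof -
        have "emeasure \<nu> (space \<nu>) < \<top>"
          by (simp add: less_top[symmetric])
        then show ?thesis
          by (simp add: ennreal_mult_less_top)
      qed
    qed measurable
  qed simp
  ultimately have "(\<integral>\<^sup>+y. ennreal (Re (fourier \<phi> y)) * ?I y \<partial>lborel) =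
      ennreal ?c * (\<integral>\<^sup>+\<eta>. ennreal ?c * ?I \<eta> \<partial>\<nu>)"
    by (rule LIMSEQ_unique)
  also have "\<dots> = ennreal (?c * ?c) * emeasure \<nu> (box a b)"
    by (simp add: nn_integral_cmult_indicator ennreal_mult mult.assoc)
  \<comment> \<open>One factor stems from the Fourier transform of the Gaussian, the other from its
    total mass.\<close>
  also have "?c * ?c = (2 * pi) ^ DIM('a)"
    unfolding power_mult_distrib[symmetric] by simp
  finally show ?thesis .
qed

text \<open>Two measures that agree on open boxes coincide: the boxes are stable under intersection,
  generate the Borel sets and exhaust the space, and \<open>\<nu>\<close> is finite.\<close>

theorem fourier_inversion: "\<nu> = density lborel (\<lambda>y. ennreal (Re (fourier \<phi> y) / (2 * pi) ^ DIM('a)))"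
proof (rule measure_eqI_generator_eq)
  let ?E = "range (\<lambda>(a, b). box a b::'a set)" and ?p = "(2 * pi) ^ DIM('a)"
  let ?D = "density lborel (\<lambda>y. ennreal (Re (fourier \<phi> y) / ?p))"
  show "Int_stable ?E"
    by (auto simp: Int_stable_def box_Int_box)
  show "?E \<subseteq> Pow UNIV" "sets \<nu> = sigma_sets UNIV ?E" "sets ?D = sigma_sets UNIV ?E"
    by (simp_all add: borel_eq_box)
  let ?A = "\<lambda>n::nat. box (- (real n *\<^sub>R One)) (real n *\<^sub>R One) :: 'a set"
  show "range ?A \<subseteq> ?E" "(\<Union>i. ?A i) = UNIV"
    unfolding UN_box_eq_UNIV by auto
  show "emeasure \<nu> (?A i) \<noteq> \<infinity>" for i
    by simp
  show "emeasure \<nu> X = emeasure ?D X" if "X \<in> ?E" for X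
  proof -
    obtain a b where X: "X = box a b"
      using \<open>X \<in> ?E\<close> by auto
    have "emeasure ?D X = (\<integral>\<^sup>+y. ennreal (1 / ?p) * (ennreal (Re (fourier \<phi> y)) * indicator (box a b) y) \<partial>lborel)"
      unfolding X using Re_fourier_nonneg
      by (subst emeasure_density) (auto intro!: nn_integral_cong simp: mult.assoc[symmetric] ennreal_mult[symmetric])
    also have "\<dots> = ennreal (1 / ?p) * (ennreal ?p * emeasure \<nu> (box a b))"
      by (subst nn_integral_cmult) (simp_all add: nn_integral_fourier_box)
    also have "\<dots> = emeasure \<nu> X"
      unfolding X by (simp add: mult.assoc[symmetric] ennreal_mult[symmetric])
    finally show ?thesis ..
  qed
qed

end

section \<open>Regularity of the density\<close>

lemma class_C_continuous: "class_C l g \<Longrightarrow> continuous_on UNIV g"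
  by (cases l) (auto intro!: continuous_at_imp_continuous_on differentiable_imp_continuous_within)

text \<open>For a continuous function this upgrades vanishing almost everywhere on an open set to
  vanishing everywhere there.\<close>

lemma open_AE_empty:
  fixes U :: "'a::euclidean_space set"
  assumes "open U" "AE x in lborel. x \<notin> U"
  shows "U = {}"
proof (rule ccontr)
  assume "U \<noteq> {}"
  have "U \<in> null_sets lborel"
    using assms by (subst AE_iff_null_sets) auto
  then have "negligible U"
    by (simp add: negligible_iff_null_sets null_sets_completionI)
  then show False
    using open_not_negligible[OF \<open>open U\<close> \<open>U \<noteq> {}\<close>] by blast
qed

context dunkl_measure
begin

lemma continuous_on_laplace_transform: "continuous_on UNIV (\<lambda>x. F (\<rho>, x))"
proof -
  have "continuous_on UNIV F"
    using has_derivative_continuous[OF laplace_transform_1_has_derivative]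
    by (intro continuous_at_imp_continuous_on) auto
  then show ?thesis
    by (rule continuous_on_compose2) (auto intro!: continuous_intros)
qed

text \<open>The tilted measure \<open>\<nu>\<close> has characteristic function
  \<open>F (\<rho>, x)\<close>, whose decay gives integrability against (1 + norm x)^l. Inversion
  expresses the density of \<open>\<nu>\<close> as a Fourier integral, and dividing by the tilt
  returns to \<open>f\<close>.\<close>

lemma density_class_C:
  assumes k_large: "\<And>\<alpha>. \<alpha> \<in> R \<Longrightarrow> real l + 1 < k \<alpha>"
    and f: "is_lebesgue_density \<mu> f"
  shows "\<exists>g. class_C l g \<and> (AE x in lborel. f x = g x)"
proof -
  have [measurable]: "f \<in> borel_measurable borel" and f_nonneg: "AE x in lborel. 0 \<le> f x"
    and \<mu>_eq: "\<mu> = density lborel (\<lambda>x. ennreal (f x))"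
    using f by (auto simp: is_lebesgue_density_def)
  obtain \<rho> C where C: "0 \<le> C"
    "\<And>x. norm (F (\<rho>, x)) \<le> C * (\<Prod>\<beta>\<in>P. (1 + \<bar>\<beta> \<bullet> x\<bar>) powr (- k \<beta>))"
    by (rule dunkl_kernel_decay) (rule that)
  define \<phi> where "\<phi> x = F (\<rho>, x)" for x
  have [measurable]: "\<phi> \<in> borel_measurable borel"
    unfolding \<phi>_def using continuous_on_laplace_transform by (rule borel_measurable_continuous_onI)
  have int_l: "integrable lborel (\<lambda>x. (1 + norm x) ^ l *\<^sub>R \<phi> x)"
    using C[folded \<phi>_def] k_large P_subset
    by (intro integrable_of_product_decay[OF finite_P span_P, where k = k and C = C]) auto
  have int_0: "integrable lborel \<phi>"
  proof -
    have "integrable lborel (\<lambda>x. (1 + norm x) ^ 0 *\<^sub>R \<phi> x)"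
    proof (rule integrable_weight_mono[OF int_l, of _ _ 1])
      show "(1 + norm x) ^ 0 * norm (\<phi> x) \<le> 1 * ((1 + norm x) ^ l * norm (\<phi> x))" for x
        unfolding mult_1 by (intro mult_right_mono power_increasing) auto
    qed measurable
    then show ?thesis by simp
  qed
  define \<nu> where "\<nu> = density \<mu> (\<lambda>\<eta>. ennreal (exp (\<rho> \<bullet> \<eta>)))"
  have \<nu>_eq: "\<nu> = density lborel (\<lambda>\<eta>. ennreal (f \<eta>) * ennreal (exp (\<rho> \<bullet> \<eta>)))"
    unfolding \<nu>_def by (subst \<mu>_eq) (rule density_density_eq; measurable)
  have "emeasure \<nu> (space \<nu>) \<noteq> \<infinity>"
  proof -
    have bound: "AE \<eta> in \<mu>. ennreal (exp (\<rho> \<bullet> \<eta>)) \<le> ennreal (exp (norm \<rho> * r))"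
      using inner_bounded[of \<rho>] by eventually_elim (auto intro!: ennreal_leI)
    have "emeasure \<nu> (space \<nu>) = (\<integral>\<^sup>+\<eta>. ennreal (exp (\<rho> \<bullet> \<eta>)) * indicator (space \<mu>) \<eta> \<partial>\<mu>)"
      unfolding \<nu>_def space_density by (rule emeasure_density) measurable
    also have "\<dots> = (\<integral>\<^sup>+\<eta>. ennreal (exp (\<rho> \<bullet> \<eta>)) \<partial>\<mu>)"
      by (rule nn_integral_cong) simp
    also have "\<dots> \<le> (\<integral>\<^sup>+\<eta>. ennreal (exp (norm \<rho> * r)) \<partial>\<mu>)"
      using bound by (rule nn_integral_mono_AE)
    also have "\<dots> < \<infinity>"
    proof -
      have "emeasure \<mu> (space \<mu>) < \<top>"
        by (simp add: less_top[symmetric])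
      then show ?thesis
        by (simp add: ennreal_mult_less_top)
    qed
    finally show ?thesis by simp
  qed
  then interpret \<nu>: finite_measure \<nu>
    by (rule finite_measureI)
  have char: "\<phi> x = (\<integral>\<eta>. cis (x \<bullet> \<eta>) \<partial>\<nu>)" for x
  proof -
    have "exp (cbilin (\<rho>, x) (complexify \<eta>)) = exp (\<rho> \<bullet> \<eta>) *\<^sub>R cis (x \<bullet> \<eta>)" for \<eta>
      by (simp add: cbilin_complexify exp_eq_polar scaleR_conv_of_real)
    then show ?thesis
      unfolding \<phi>_def laplace_transform_def \<nu>_def by (subst integral_density) auto
  qed
  interpret integrable_characteristic_function \<nu> \<phi>
  proof
    show "sets \<nu> = sets borel"
      by (simp add: \<nu>_def)
    show "absolutely_continuous lborel \<nu>"
      unfolding \<nu>_eq by (rule absolutely_continuousI_density) measurable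
  qed (fact char int_0)+
  \<comment> \<open>The normalization is moved inside the Fourier integral, so that \<open>g\<close>
    has literally the form treated by \<open>class_C_exp_fourier\<close>.\<close>
  define c where "c = 1 / (2 * pi) ^ DIM('a)"
  define \<psi> where "\<psi> x = complex_of_real c * \<phi> x" for x
  define g where "g y = exp (- (\<rho> \<bullet> y)) * Re (fourier \<psi> y)" for y
  have Re_fourier_\<psi>: "Re (fourier \<psi> y) = c * Re (fourier \<phi> y)" for y
  proof -
    have "fourier \<psi> y = complex_of_real c * fourier \<phi> y"
      unfolding fourier_def \<psi>_def by (subst integral_mult_right_zero[symmetric]) (simp only: mult_ac)
    then show ?thesis by simp
  qed
  have "integrable lborel (\<lambda>x. (1 + norm x) ^ l *\<^sub>R \<psi> x)"
    unfolding \<psi>_def mult_scaleR_right[symmetric] by (intro integrable_mult_right int_l)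
  then have "class_C l g"
    unfolding g_def[abs_def] by (intro class_C_exp_fourier) (simp_all add: \<psi>_def[abs_def])
  moreover have "AE x in lborel. f x = g x"
  proof -
    \<comment> \<open>Both sides are Lebesgue densities of \<open>\<nu>\<close>, and densities are
      unique up to null sets.\<close>
    have "AE y in lborel. ennreal (f y) * ennreal (exp (\<rho> \<bullet> y)) = ennreal (Re (fourier \<phi> y) / (2 * pi) ^ DIM('a))"
      using fourier_inversion unfolding \<nu>_eq by (subst (asm) sigma_finite_measure.density_unique_iff[OF sigma_finite_lborel]) auto
    then show ?thesis
      using f_nonneg
    proof eventually_elim
      case (elim y)
      have "0 \<le> Re (fourier \<phi> y) / (2 * pi) ^ DIM('a)"
        using Re_fourier_nonneg by simp
      then have "f y * exp (\<rho> \<bullet> y) = Re (fourier \<phi> y) / (2 * pi) ^ DIM('a)"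
        using elim by (simp add: ennreal_mult[symmetric])
      then have "Re (fourier \<psi> y) = f y * exp (\<rho> \<bullet> y)"
        by (simp add: Re_fourier_\<psi> c_def)
      then show ?case
        by (simp add: g_def exp_minus)
    qed
  qed
  ultimately show ?thesis by blast
qed

text \<open>Outside the ball of radius \<open>r\<close> that carries \<open>\<mu>\<close>,
  \<open>f\<close> and hence \<open>g\<close> vanish almost everywhere; as \<open>g\<close> is
  continuous and the exterior of the ball is open, \<open>g\<close> vanishes there
  identically.\<close>

lemma density_class_Cc:
  assumes k_large: "\<And>\<alpha>. \<alpha> \<in> R \<Longrightarrow> real l + 1 < k \<alpha>"
    and f: "is_lebesgue_density \<mu> f"
  shows "\<exists>g. class_Cc l g \<and> (AE x in lborel. f x = g x)"
proof -
  obtain g where g: "class_C l g" "AE x in lborel. f x = g x"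
    using density_class_C[OF assms] by blast
  have [measurable]: "f \<in> borel_measurable borel" and f_nonneg: "AE x in lborel. 0 \<le> f x"
    and \<mu>_eq: "\<mu> = density lborel (\<lambda>x. ennreal (f x))"
    using f by (auto simp: is_lebesgue_density_def)
  have cont: "continuous_on UNIV g"
    using g(1) by (rule class_C_continuous)
  \<comment> \<open>A statement almost everywhere for \<open>\<mu>\<close> says nothing about points
    where \<open>f\<close> is zero, hence the implication.\<close>
  have "AE x in lborel. 0 < ennreal (f x) \<longrightarrow> norm x \<le> r"
    using supported unfolding \<mu>_eq by (subst (asm) AE_density) auto
  then have "AE x in lborel. x \<notin> {x. g x \<noteq> 0} \<inter> {x. r < norm x}"
    using g(2) f_nonneg by eventually_elim auto
  moreover have "open ({x. g x \<noteq> 0} \<inter> {x. r < norm x})"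
    using cont by (intro open_Int open_Collect_neq open_Collect_less continuous_intros)
  ultimately have "{x. g x \<noteq> 0} \<inter> {x. r < norm x} = {}"
    by (intro open_AE_empty)
  then have "{x. g x \<noteq> 0} \<subseteq> cball 0 r"
    by force
  then have "bounded {x. g x \<noteq> 0}"
    using bounded_cball bounded_subset by blast
  then have "compact (closure {x. g x \<noteq> 0})"
    by (simp add: compact_closure)
  then show ?thesis
    using g by (auto simp: class_Cc_def)
qed

end

theorem proposition7p3:
  fixes R P :: "'a::euclidean_space set"
    and k :: "'a \<Rightarrow> real"
    and l :: nat
    and lam :: 'a
    and E :: "'a complexified \<Rightarrow> 'a complexified \<Rightarrow> complex"
    and \<mu> :: "'a measure"
    and f :: "'a \<Rightarrow> real"
  assumes "normalized_root_system R"
    and "positive_roots R P"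
    and "W_invariant R k"
    and "\<forall>\<alpha>\<in>R. k \<alpha> > real l + (real DIM('a) + 1) / 2"
    and "lam \<in> regular_points R"
    and "is_dunkl_kernel P (\<lambda>\<alpha>. complex_of_real (k \<alpha>)) E"
    and "is_representing_measure E lam \<mu>"
    and "is_lebesgue_density \<mu> f"
  shows "\<exists>g. class_Cc l g \<and> (AE x in lborel. f x = g x)"
proof -
  have prob: "prob_space \<mu>" and sets_\<mu>: "sets \<mu> = sets borel"
    and rep: "\<And>z. E (complexify lam) z = (\<integral>\<xi>. exp (cbilin z (complexify \<xi>)) \<partial>\<mu>)"
    using assms(7) by (auto simp: is_representing_measure_def)
  obtain S where S: "compact S" "emeasure \<mu> (- S) = 0"
    using assms(7) by (auto simp: is_representing_measure_def)
  obtain r where r: "0 < r" "\<And>x. x \<in> S \<Longrightarrow> norm x \<le> r"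
    using compact_imp_bounded[OF S(1)] bounded_pos by blast
  \<comment> \<open>The dimension is at least 1, so (n + 1) / 2 is at least 1.\<close>
  have large: "real l + 1 < k \<alpha>" if "\<alpha> \<in> R" for \<alpha>
  proof -
    define d where "d = real DIM('a)"
    have "1 \<le> d"
      using DIM_positive[where 'a = 'a] by (simp add: d_def Suc_le_eq)
    moreover have "real l + (d + 1) / 2 < k \<alpha>"
      using assms(4) that by (simp add: d_def)
    ultimately show ?thesis
      by (simp add: field_simps)
  qed
  interpret prob_space \<mu>
    by (fact prob)
  interpret compactly_supported_measure \<mu> r
  proof
    show "sets \<mu> = sets borel"
      by (fact sets_\<mu>)
    show "AE \<eta> in \<mu>. norm \<eta> \<le> r"
      using S r(2) by (intro AE_I[of _ _ "- S"]) (auto simp: sets_\<mu> compact_imp_closed)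
  qed (use r in simp)
  have E_eq: "E (complexify lam) = laplace_transform (\<lambda>_. 1)"
    by (simp add: fun_eq_iff laplace_transform_def rep)
  have "dunkl_eigenfunction P (\<lambda>\<alpha>. complex_of_real (k \<alpha>)) (complexify lam) (laplace_transform (\<lambda>_. 1))"
    using assms(6) unfolding is_dunkl_kernel_def E_eq[symmetric] by blast
  moreover have "0 \<le> k \<alpha>" if "\<alpha> \<in> R" for \<alpha>
    using large[OF that] by simp
  ultimately interpret dunkl_measure \<mu> r R P k lam
    using assms by unfold_locales auto
  show ?thesis
    using large assms(8) by (rule density_class_Cc)
qed

end
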